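(* Let $M$ be an $n$-dimensional manifold immersed in a Riemannian manifold $N$, $V$ a Killing vector field of $N$ and $\eta$ a parallel unit normal section of $M$. If $f:M\to\mathbb{R}$ is given by $f(q)=\langle\eta(q),V(q)\rangle$, $q\in M$, then $$-\Delta_M f=n\langle\mathrm{grad}\langle\overrightarrow{H},\eta\rangle,V\rangle+n\langle\overrightarrow{H},\nabla_\eta V\rangle+\langle\tilde{\mathcal{B}}(\eta),V\rangle+\langle\mathrm{Ric}_M^\perp(\eta),V\rangle,$$ where $\overrightarrow{H}$ is the mean curvature vector of $M$.
   Context: $\nabla$ is the Riemannian connection of $N$, $\mathrm{grad}$ and $\Delta_M$ are the gradient and Laplacian ($\Delta_M=\mathrm{div}\,\mathrm{grad}$) on $M$. Parallel means parallel in the normal connection of $M$. $\overrightarrow{H}=\frac1n\mathrm{tr}$ of the second fundamental form. $S_\eta(X)=-(\nabla_X\eta)^\top$ is the shape operator. With $\{E_i\}$ a local orthonormal frame of $M$, the Simons operator $\tilde{\mathcal{B}}$ on the normal bundle is defined by $\langle\tilde{\mathcal{B}}(\eta_1),\eta_2\rangle=\sum_i\langle S_{\eta_1}(E_i),S_{\eta_2}(E_i)\rangle$. The curvature tensor of $N$ is $\mathrm{R}(X,Y)Z=\nabla_Y\nabla_XZ-\nabla_X\nabla_YZ+\nabla_{[X,Y]}Z$; $\mathrm{Ric}_M(Z,W)=\sum_i\langle\mathrm{R}(Z,E_i)W,E_i\rangle$ for vector fields $Z,W$ of $N$ along $M$, and the normal Ricci operator $\mathrm{Ric}_M^\perp$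 on the normal bundle is defined by $\langle\mathrm{Ric}_M^\perp(\eta_1),\eta_2\rangle=\mathrm{Ric}_M(\eta_1,\eta_2)$ for normal $\eta_1,\eta_2$. *)

theory Defs
  imports "HOL-Analysis.Analysis"
begin

section \<open>Smooth maps between open sets of Euclidean spaces\<close>

text \<open>Both notions are only used for open \<open>S\<close>.\<close>

fun Ck_on :: "nat \<Rightarrow> 'a::euclidean_space set \<Rightarrow> ('a \<Rightarrow> 'b::real_normed_vector) \<Rightarrow> bool" where
  "Ck_on 0 S f \<longleftrightarrow> continuous_on S f"
| "Ck_on (Suc k) S f \<longleftrightarrow>
     f differentiable_on S \<and> (\<forall>v. Ck_on k S (\<lambda>x. frechet_derivative f (at x) v))"

definition smooth_on :: "'a::euclidean_space set \<Rightarrow> ('a \<Rightarrow> 'b::real_normed_vector) \<Rightarrow> bool" where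
  "smooth_on S f \<longleftrightarrow> (\<forall>k. Ck_on k S f)"


section \<open>Smooth manifolds\<close>

text \<open>A manifold is a Hausdorff, second countable type \<open>'m\<close> together with a smooth atlas modelled
  on a Euclidean space \<open>'e\<close>, so its dimension is \<open>DIM('e)\<close>.  A chart is a pair of its domain and
  its coordinate map; the coordinate map is irrelevant outside the domain.  The atlas need not be
  maximal.\<close>

type_synonym ('m, 'e) chart = "'m set \<times> ('m \<Rightarrow> 'e)"

abbreviation cdom :: "('m, 'e) chart \<Rightarrow> 'm set" where
  "cdom c \<equiv> fst c"

abbreviation cmap :: "('m, 'e) chart \<Rightarrow> 'm \<Rightarrow> 'e" where
  "cmap c \<equiv> snd c"

definition cinv :: "('m, 'e) chart \<Rightarrow> 'e \<Rightarrow> 'm" where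
  "cinv c = inv_into (cdom c) (cmap c)"

definition smooth_atlas ::
  "('m::{t2_space, second_countable_topology}, 'e::euclidean_space) chart set \<Rightarrow> bool" where
  "smooth_atlas A \<longleftrightarrow>
     (\<forall>c\<in>A. open (cdom c) \<and> open (cmap c ` cdom c) \<and>
        (\<exists>h. homeomorphism (cdom c) (cmap c ` cdom c) (cmap c) h)) \<and>
     (\<Union>c\<in>A. cdom c) = UNIV \<and>
     (\<forall>c\<in>A. \<forall>d\<in>A. smooth_on (cmap c ` (cdom c \<inter> cdom d)) (cmap d \<circ> cinv c))"

definition chart_at :: "('m, 'e) chart set \<Rightarrow> 'm \<Rightarrow> ('m, 'e) chart" where
  "chart_at A p = (SOME c. c \<in> A \<and> p \<in> cdom c)"

text \<open>The tangent space at \<open>p\<close> is the model space \<open>'e\<close>: a tangent vector at \<open>p\<close> is given by its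
  components in the preferred chart \<open>chart_at A p\<close>.  Since the preferred chart varies with \<open>p\<close>,
  a vector field \<open>X :: 'm \<Rightarrow> 'e\<close> need not be continuous as a map into \<open>'e\<close> when it is smooth;
  smoothness is expressed through its components in a fixed chart.

  \<open>comps A c p v\<close> are the components in the chart \<open>c\<close> of the vector \<open>v\<close> tangent at \<open>p\<close>, and
  \<open>vec_of A c p a\<close> is the vector tangent at \<open>p\<close> whose components in the chart \<open>c\<close> are \<open>a\<close>.  In
  particular \<open>\<lambda>p. vec_of A c p j\<close> with \<open>j \<in> Basis\<close> are the coordinate vector fields of \<open>c\<close>.\<close>

definition comps ::
  "('m, 'e::euclidean_space) chart set \<Rightarrow> ('m, 'e) chart \<Rightarrow> 'm \<Rightarrow> 'e \<Rightarrow> 'e" where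
  "comps A c p v =
     frechet_derivative (cmap c \<circ> cinv (chart_at A p)) (at (cmap (chart_at A p) p)) v"

definition vec_of ::
  "('m, 'e::euclidean_space) chart set \<Rightarrow> ('m, 'e) chart \<Rightarrow> 'm \<Rightarrow> 'e \<Rightarrow> 'e" where
  "vec_of A c p a =
     frechet_derivative (cmap (chart_at A p) \<circ> cinv c) (at (cmap c p)) a"

definition smooth_fun_on ::
  "('m, 'e::euclidean_space) chart set \<Rightarrow> 'm set \<Rightarrow> ('m \<Rightarrow> real) \<Rightarrow> bool" where
  "smooth_fun_on A U h \<longleftrightarrow> (\<forall>c\<in>A. smooth_on (cmap c ` (cdom c \<inter> U)) (h \<circ> cinv c))"

definition dfun ::
  "('m, 'e::euclidean_space) chart set \<Rightarrow> ('m \<Rightarrow> real) \<Rightarrow> 'm \<Rightarrow> 'e \<Rightarrow> real" where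
  "dfun A h p v = frechet_derivative (h \<circ> cinv (chart_at A p)) (at (cmap (chart_at A p) p)) v"

definition smooth_map ::
  "('m::topological_space, 'e::euclidean_space) chart set \<Rightarrow>
   ('n::topological_space, 'd::euclidean_space) chart set \<Rightarrow> ('m \<Rightarrow> 'n) \<Rightarrow> bool" where
  "smooth_map A B F \<longleftrightarrow> continuous_on UNIV F \<and>
     (\<forall>c\<in>A. \<forall>d\<in>B. smooth_on (cmap c ` (cdom c \<inter> F -` cdom d)) (cmap d \<circ> F \<circ> cinv c))"

definition dmap ::
  "('m, 'e::euclidean_space) chart set \<Rightarrow> ('n, 'd::euclidean_space) chart set \<Rightarrow> ('m \<Rightarrow> 'n) \<Rightarrow>
   'm \<Rightarrow> 'e \<Rightarrow> 'd" where
  "dmap A B F p v =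
     frechet_derivative (cmap (chart_at B (F p)) \<circ> F \<circ> cinv (chart_at A p))
       (at (cmap (chart_at A p) p)) v"

definition immersion ::
  "('m::topological_space, 'e::euclidean_space) chart set \<Rightarrow>
   ('n::topological_space, 'd::euclidean_space) chart set \<Rightarrow> ('m \<Rightarrow> 'n) \<Rightarrow> bool" where
  "immersion A B F \<longleftrightarrow> smooth_map A B F \<and> (\<forall>p. inj (dmap A B F p))"


section \<open>Vector fields and sections along a map\<close>

definition smooth_vf_on ::
  "('m, 'e::euclidean_space) chart set \<Rightarrow> 'm set \<Rightarrow> ('m \<Rightarrow> 'e) \<Rightarrow> bool" where
  "smooth_vf_on A U X \<longleftrightarrow>
     (\<forall>c\<in>A. smooth_on (cmap c ` (cdom c \<inter> U)) (\<lambda>x. comps A c (cinv c x) (X (cinv c x))))"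

text \<open>A section along \<open>F\<close> assigns to \<open>q\<close> a vector tangent to the target manifold at \<open>F q\<close>.\<close>

definition smooth_section_on ::
  "('m, 'e::euclidean_space) chart set \<Rightarrow> ('n, 'd::euclidean_space) chart set \<Rightarrow> ('m \<Rightarrow> 'n) \<Rightarrow>
   'm set \<Rightarrow> ('m \<Rightarrow> 'd) \<Rightarrow> bool" where
  "smooth_section_on A B F U \<xi> \<longleftrightarrow>
     (\<forall>c\<in>A. \<forall>d\<in>B. smooth_on (cmap c ` (cdom c \<inter> F -` cdom d \<inter> U))
        (\<lambda>x. comps B d (F (cinv c x)) (\<xi> (cinv c x))))"

text \<open>The Lie bracket \<open>[X, Y] = DY(X) - DX(Y)\<close> in the coordinates of \<open>chart_at A p\<close>, that is,
  \<open>[X, Y] h = X (Y h) - Y (X h)\<close>.\<close>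

definition lie_bracket ::
  "('m, 'e::euclidean_space) chart set \<Rightarrow> ('m \<Rightarrow> 'e) \<Rightarrow> ('m \<Rightarrow> 'e) \<Rightarrow> 'm \<Rightarrow> 'e" where
  "lie_bracket A X Y p =
    (let c = chart_at A p;
         loc = (\<lambda>Z x. comps A c (cinv c x) (Z (cinv c x)))
     in frechet_derivative (loc Y) (at (cmap c p)) (X p)
        - frechet_derivative (loc X) (at (cmap c p)) (Y p))"


section \<open>Riemannian metrics and the Riemannian connection\<close>

definition inner_product :: "('e::euclidean_space \<Rightarrow> 'e \<Rightarrow> real) \<Rightarrow> bool" where
  "inner_product G \<longleftrightarrow> bilinear G \<and> (\<forall>u v. G u v = G v u) \<and> (\<forall>u. u \<noteq> 0 \<longrightarrow> G u u > 0)"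

definition riemannian_metric ::
  "('m, 'e::euclidean_space) chart set \<Rightarrow> ('m \<Rightarrow> 'e \<Rightarrow> 'e \<Rightarrow> real) \<Rightarrow> bool" where
  "riemannian_metric A g \<longleftrightarrow> (\<forall>p. inner_product (g p)) \<and>
     (\<forall>c\<in>A. \<forall>i\<in>Basis. \<forall>j\<in>Basis.
        smooth_fun_on A (cdom c) (\<lambda>p. g p (vec_of A c p i) (vec_of A c p j)))"

text \<open>\<open>nabla p v Y\<close> is the covariant derivative at \<open>p\<close>, in the direction \<open>v\<close>, of a vector field
  \<open>Y\<close> that is smooth in a neighbourhood of \<open>p\<close>.  A connection on globally defined fields has
  exactly one extension to locally defined fields, which is what is axiomatised here; no condition
  is imposed on the values at fields that are not smooth near \<open>p\<close>.\<close>

definition connection ::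
  "('m::topological_space, 'e::euclidean_space) chart set \<Rightarrow>
   ('m \<Rightarrow> 'e \<Rightarrow> ('m \<Rightarrow> 'e) \<Rightarrow> 'e) \<Rightarrow> bool" where
  "connection A nabla \<longleftrightarrow>
     (\<forall>U Y p. open U \<and> p \<in> U \<and> smooth_vf_on A U Y \<longrightarrow>
        linear (\<lambda>v. nabla p v Y) \<and>
        (\<forall>v Z. (\<forall>q\<in>U. Z q = Y q) \<longrightarrow> nabla p v Z = nabla p v Y) \<and>
        (\<forall>v Z. smooth_vf_on A U Z \<longrightarrow>
           nabla p v (\<lambda>q. Y q + Z q) = nabla p v Y + nabla p v Z) \<and>
        (\<forall>v h. smooth_fun_on A U h \<longrightarrow>
           nabla p v (\<lambda>q. h q *\<^sub>R Y q) = dfun A h p v *\<^sub>R Y p + h p *\<^sub>R nabla p v Y)) \<and>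
     (\<forall>U X Y. open U \<and> smooth_vf_on A U X \<and> smooth_vf_on A U Y \<longrightarrow>
        smooth_vf_on A U (\<lambda>q. nabla q (X q) Y))"

text \<open>Torsion-free and compatible with the metric.\<close>

definition riemannian_connection ::
  "('m::topological_space, 'e::euclidean_space) chart set \<Rightarrow> ('m \<Rightarrow> 'e \<Rightarrow> 'e \<Rightarrow> real) \<Rightarrow>
   ('m \<Rightarrow> 'e \<Rightarrow> ('m \<Rightarrow> 'e) \<Rightarrow> 'e) \<Rightarrow> bool" where
  "riemannian_connection A g nabla \<longleftrightarrow> connection A nabla \<and>
     (\<forall>U X Y p. open U \<and> p \<in> U \<and> smooth_vf_on A U X \<and> smooth_vf_on A U Y \<longrightarrow>
        nabla p (X p) Y - nabla p (Y p) X = lie_bracket A X Y p \<and>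
        (\<forall>v. dfun A (\<lambda>q. g q (X q) (Y q)) p v
             = g p (nabla p v X) (Y p) + g p (X p) (nabla p v Y)))"

text \<open>The Lie derivative of the metric along \<open>V\<close> vanishes:
  \<open>V\<langle>X, Y\<rangle> = \<langle>[V, X], Y\<rangle> + \<langle>X, [V, Y]\<rangle>\<close>.\<close>

definition killing_field ::
  "('m::topological_space, 'e::euclidean_space) chart set \<Rightarrow> ('m \<Rightarrow> 'e \<Rightarrow> 'e \<Rightarrow> real) \<Rightarrow>
   ('m \<Rightarrow> 'e) \<Rightarrow> bool" where
  "killing_field A g V \<longleftrightarrow> smooth_vf_on A UNIV V \<and>
     (\<forall>U X Y p. open U \<and> p \<in> U \<and> smooth_vf_on A U X \<and> smooth_vf_on A U Y \<longrightarrow>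
        dfun A (\<lambda>q. g q (X q) (Y q)) p (V p)
        = g p (lie_bracket A V X p) (Y p) + g p (X p) (lie_bracket A V Y p))"

text \<open>\<open>R(X, Y)Z = \<nabla>\<^sub>Y \<nabla>\<^sub>X Z - \<nabla>\<^sub>X \<nabla>\<^sub>Y Z + \<nabla>\<^bsub>[X, Y]\<^esub> Z\<close>, evaluated on vectors \<open>x, y, z\<close> tangent at \<open>p\<close>
  by means of arbitrary smooth local extensions; the value does not depend on the extensions.\<close>

definition curvature ::
  "('m::topological_space, 'e::euclidean_space) chart set \<Rightarrow>
   ('m \<Rightarrow> 'e \<Rightarrow> ('m \<Rightarrow> 'e) \<Rightarrow> 'e) \<Rightarrow> 'm \<Rightarrow> 'e \<Rightarrow> 'e \<Rightarrow> 'e \<Rightarrow> 'e" where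
  "curvature A nabla p x y z =
    (THE r. \<forall>U X Y Z. open U \<and> p \<in> U \<and>
        smooth_vf_on A U X \<and> smooth_vf_on A U Y \<and> smooth_vf_on A U Z \<and>
        X p = x \<and> Y p = y \<and> Z p = z \<longrightarrow>
        nabla p y (\<lambda>q. nabla q (X q) Z) - nabla p x (\<lambda>q. nabla q (Y q) Z)
          + nabla p (lie_bracket A X Y p) Z = r)"

definition orthonormal_basis ::
  "('e::euclidean_space \<Rightarrow> 'e \<Rightarrow> real) \<Rightarrow> ('e \<Rightarrow> 'e) \<Rightarrow> bool" where
  "orthonormal_basis G E \<longleftrightarrow> (\<forall>i\<in>Basis. \<forall>j\<in>Basis. G (E i) (E j) = (if i = j then 1 else 0))"

text \<open>\<open>\<Sum>\<^sub>i b(E\<^sub>i, E\<^sub>i)\<close> for a \<open>G\<close>-orthonormal basis \<open>(E\<^sub>i)\<close>, indexed by the standard basis of the model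
  space.  For bilinear \<open>b\<close> it does not depend on the chosen orthonormal basis.\<close>

definition metric_trace ::
  "('e::euclidean_space \<Rightarrow> 'e \<Rightarrow> real) \<Rightarrow> ('e \<Rightarrow> 'e \<Rightarrow> 'b::real_vector) \<Rightarrow> 'b" where
  "metric_trace G b = (let E = (SOME E. orthonormal_basis G E) in \<Sum>i\<in>Basis. b (E i) (E i))"

definition gradient ::
  "('m, 'e::euclidean_space) chart set \<Rightarrow> ('m \<Rightarrow> 'e \<Rightarrow> 'e \<Rightarrow> real) \<Rightarrow> ('m \<Rightarrow> real) \<Rightarrow> 'm \<Rightarrow> 'e" where
  "gradient A g h p = (THE w. \<forall>v. g p w v = dfun A h p v)"

definition divergence ::
  "('m \<Rightarrow> 'e::euclidean_space \<Rightarrow> 'e \<Rightarrow> real) \<Rightarrow> ('m \<Rightarrow> 'e \<Rightarrow> ('m \<Rightarrow> 'e) \<Rightarrow> 'e) \<Rightarrow>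
   ('m \<Rightarrow> 'e) \<Rightarrow> 'm \<Rightarrow> real" where
  "divergence g nabla X p = metric_trace (g p) (\<lambda>u v. g p (nabla p u X) v)"

definition laplacian ::
  "('m, 'e::euclidean_space) chart set \<Rightarrow> ('m \<Rightarrow> 'e \<Rightarrow> 'e \<Rightarrow> real) \<Rightarrow>
   ('m \<Rightarrow> 'e \<Rightarrow> ('m \<Rightarrow> 'e) \<Rightarrow> 'e) \<Rightarrow> ('m \<Rightarrow> real) \<Rightarrow> 'm \<Rightarrow> real" where
  "laplacian A g nabla h p = divergence g nabla (gradient A g h) p"


section \<open>Geometry of an immersion\<close>

text \<open>Throughout, \<open>A\<close> is the atlas of the immersed manifold \<open>M\<close>, \<open>B\<close> that of the ambient manifold
  \<open>N\<close>, \<open>F\<close> the immersion of \<open>M\<close> into \<open>N\<close>, \<open>g\<close> the metric of \<open>N\<close> and \<open>nabla\<close> its Riemannian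
  connection.  Tangent vectors of \<open>M\<close> have type \<open>'e\<close> and act in \<open>N\<close> through \<open>dmap A B F\<close>.\<close>

definition induced_metric ::
  "('m, 'e::euclidean_space) chart set \<Rightarrow> ('n, 'd::euclidean_space) chart set \<Rightarrow> ('m \<Rightarrow> 'n) \<Rightarrow>
   ('n \<Rightarrow> 'd \<Rightarrow> 'd \<Rightarrow> real) \<Rightarrow> 'm \<Rightarrow> 'e \<Rightarrow> 'e \<Rightarrow> real" where
  "induced_metric A B F g p u v = g (F p) (dmap A B F p u) (dmap A B F p v)"

text \<open>The covariant derivative \<open>\<nabla>\<^sub>v \<xi>\<close> of a section along \<open>F\<close> (the pulled-back connection).  With
  \<open>\<xi> = \<Sum>\<^sub>j a\<^sub>j (\<partial>\<^sub>j \<circ> F)\<close> in coordinates of \<open>N\<close> near \<open>F p\<close>, it is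
  \<open>\<Sum>\<^sub>j (v a\<^sub>j) \<partial>\<^sub>j + a\<^sub>j \<nabla>\<^bsub>dF(v)\<^esub> \<partial>\<^sub>j\<close>; this does not depend on the coordinates.\<close>

definition cov_along ::
  "('m, 'e::euclidean_space) chart set \<Rightarrow> ('n, 'd::euclidean_space) chart set \<Rightarrow> ('m \<Rightarrow> 'n) \<Rightarrow>
   ('n \<Rightarrow> 'd \<Rightarrow> ('n \<Rightarrow> 'd) \<Rightarrow> 'd) \<Rightarrow> 'm \<Rightarrow> 'e \<Rightarrow> ('m \<Rightarrow> 'd) \<Rightarrow> 'd" where
  "cov_along A B F nabla p v \<xi> =
    (let d = chart_at B (F p); a = (\<lambda>j q. comps B d (F q) (\<xi> q) \<bullet> j)
     in \<Sum>j\<in>Basis. dfun A (a j) p v *\<^sub>R vec_of B d (F p) j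
          + a j p *\<^sub>R nabla (F p) (dmap A B F p v) (\<lambda>y. vec_of B d y j))"

text \<open>\<open>tang A B F g p w\<close> is the tangential part of \<open>w\<close>, as a vector tangent to \<open>M\<close> at \<open>p\<close>.\<close>

definition tang ::
  "('m, 'e::euclidean_space) chart set \<Rightarrow> ('n, 'd::euclidean_space) chart set \<Rightarrow> ('m \<Rightarrow> 'n) \<Rightarrow>
   ('n \<Rightarrow> 'd \<Rightarrow> 'd \<Rightarrow> real) \<Rightarrow> 'm \<Rightarrow> 'd \<Rightarrow> 'e" where
  "tang A B F g p w = (THE u. \<forall>v. g (F p) (w - dmap A B F p u) (dmap A B F p v) = 0)"

definition normal_part ::
  "('m, 'e::euclidean_space) chart set \<Rightarrow> ('n, 'd::euclidean_space) chart set \<Rightarrow> ('m \<Rightarrow> 'n) \<Rightarrow>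
   ('n \<Rightarrow> 'd \<Rightarrow> 'd \<Rightarrow> real) \<Rightarrow> 'm \<Rightarrow> 'd \<Rightarrow> 'd" where
  "normal_part A B F g p w = w - dmap A B F p (tang A B F g p w)"

definition is_normal ::
  "('m, 'e::euclidean_space) chart set \<Rightarrow> ('n, 'd::euclidean_space) chart set \<Rightarrow> ('m \<Rightarrow> 'n) \<Rightarrow>
   ('n \<Rightarrow> 'd \<Rightarrow> 'd \<Rightarrow> real) \<Rightarrow> 'm \<Rightarrow> 'd \<Rightarrow> bool" where
  "is_normal A B F g p w \<longleftrightarrow> (\<forall>v. g (F p) w (dmap A B F p v) = 0)"

definition normal_section_on ::
  "('m, 'e::euclidean_space) chart set \<Rightarrow> ('n, 'd::euclidean_space) chart set \<Rightarrow> ('m \<Rightarrow> 'n) \<Rightarrow>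
   ('n \<Rightarrow> 'd \<Rightarrow> 'd \<Rightarrow> real) \<Rightarrow> 'm set \<Rightarrow> ('m \<Rightarrow> 'd) \<Rightarrow> bool" where
  "normal_section_on A B F g U \<xi> \<longleftrightarrow>
     smooth_section_on A B F U \<xi> \<and> (\<forall>q\<in>U. is_normal A B F g q (\<xi> q))"

text \<open>Parallel in the normal connection \<open>(\<nabla>\<^sub>v \<xi>)\<^sup>\<bottom>\<close>.\<close>

definition parallel_normal ::
  "('m, 'e::euclidean_space) chart set \<Rightarrow> ('n, 'd::euclidean_space) chart set \<Rightarrow> ('m \<Rightarrow> 'n) \<Rightarrow>
   ('n \<Rightarrow> 'd \<Rightarrow> 'd \<Rightarrow> real) \<Rightarrow> ('n \<Rightarrow> 'd \<Rightarrow> ('n \<Rightarrow> 'd) \<Rightarrow> 'd) \<Rightarrow> ('m \<Rightarrow> 'd) \<Rightarrow> bool" where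
  "parallel_normal A B F g nabla \<xi> \<longleftrightarrow>
     (\<forall>p v. normal_part A B F g p (cov_along A B F nabla p v \<xi>) = 0)"

text \<open>\<open>II(u, v) = (\<nabla>\<^sub>u Y)\<^sup>\<bottom>\<close> for an arbitrary smooth local extension \<open>Y\<close> of \<open>v\<close> to a vector field of
  \<open>M\<close>; the value does not depend on the extension.\<close>

definition second_ff ::
  "('m::topological_space, 'e::euclidean_space) chart set \<Rightarrow> ('n, 'd::euclidean_space) chart set \<Rightarrow>
   ('m \<Rightarrow> 'n) \<Rightarrow> ('n \<Rightarrow> 'd \<Rightarrow> 'd \<Rightarrow> real) \<Rightarrow> ('n \<Rightarrow> 'd \<Rightarrow> ('n \<Rightarrow> 'd) \<Rightarrow> 'd) \<Rightarrow>
   'm \<Rightarrow> 'e \<Rightarrow> 'e \<Rightarrow> 'd" where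
  "second_ff A B F g nabla p u v =
    (THE w. \<forall>U Y. open U \<and> p \<in> U \<and> smooth_vf_on A U Y \<and> Y p = v \<longrightarrow>
        normal_part A B F g p (cov_along A B F nabla p u (\<lambda>q. dmap A B F q (Y q))) = w)"

definition mean_curvature ::
  "('m::topological_space, 'e::euclidean_space) chart set \<Rightarrow> ('n, 'd::euclidean_space) chart set \<Rightarrow>
   ('m \<Rightarrow> 'n) \<Rightarrow> ('n \<Rightarrow> 'd \<Rightarrow> 'd \<Rightarrow> real) \<Rightarrow> ('n \<Rightarrow> 'd \<Rightarrow> ('n \<Rightarrow> 'd) \<Rightarrow> 'd) \<Rightarrow>
   'm \<Rightarrow> 'd" where
  "mean_curvature A B F g nabla p =
     (1 / real DIM('e)) *\<^sub>R
       metric_trace (induced_metric A B F g p) (second_ff A B F g nabla p)"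

definition shape_op ::
  "('m, 'e::euclidean_space) chart set \<Rightarrow> ('n, 'd::euclidean_space) chart set \<Rightarrow> ('m \<Rightarrow> 'n) \<Rightarrow>
   ('n \<Rightarrow> 'd \<Rightarrow> 'd \<Rightarrow> real) \<Rightarrow> ('n \<Rightarrow> 'd \<Rightarrow> ('n \<Rightarrow> 'd) \<Rightarrow> 'd) \<Rightarrow>
   ('m \<Rightarrow> 'd) \<Rightarrow> 'm \<Rightarrow> 'e \<Rightarrow> 'e" where
  "shape_op A B F g nabla \<xi> p u = - tang A B F g p (cov_along A B F nabla p u \<xi>)"

text \<open>The Simons operator: \<open>\<langle>B(\<eta>), \<xi>\<rangle> = \<Sum>\<^sub>i \<langle>S\<^sub>\<eta> E\<^sub>i, S\<^sub>\<xi> E\<^sub>i\<rangle>\<close> for all local normal sections \<open>\<xi>\<close>.\<close>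

definition simons_op ::
  "('m::topological_space, 'e::euclidean_space) chart set \<Rightarrow> ('n, 'd::euclidean_space) chart set \<Rightarrow>
   ('m \<Rightarrow> 'n) \<Rightarrow> ('n \<Rightarrow> 'd \<Rightarrow> 'd \<Rightarrow> real) \<Rightarrow> ('n \<Rightarrow> 'd \<Rightarrow> ('n \<Rightarrow> 'd) \<Rightarrow> 'd) \<Rightarrow>
   ('m \<Rightarrow> 'd) \<Rightarrow> 'm \<Rightarrow> 'd" where
  "simons_op A B F g nabla \<eta> p =
    (THE \<zeta>. is_normal A B F g p \<zeta> \<and>
       (\<forall>U \<xi>. open U \<and> p \<in> U \<and> normal_section_on A B F g U \<xi> \<longrightarrow>
          g (F p) \<zeta> (\<xi> p) =
          metric_trace (induced_metric A B F g p)
            (\<lambda>u v. induced_metric A B F g p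
                     (shape_op A B F g nabla \<eta> p u) (shape_op A B F g nabla \<xi> p v))))"

definition Ric_M ::
  "('m, 'e::euclidean_space) chart set \<Rightarrow> ('n::topological_space, 'd::euclidean_space) chart set \<Rightarrow>
   ('m \<Rightarrow> 'n) \<Rightarrow> ('n \<Rightarrow> 'd \<Rightarrow> 'd \<Rightarrow> real) \<Rightarrow> ('n \<Rightarrow> 'd \<Rightarrow> ('n \<Rightarrow> 'd) \<Rightarrow> 'd) \<Rightarrow>
   'm \<Rightarrow> 'd \<Rightarrow> 'd \<Rightarrow> real" where
  "Ric_M A B F g nabla p z w =
     metric_trace (induced_metric A B F g p)
       (\<lambda>u v. g (F p) (curvature B nabla (F p) z (dmap A B F p u) w) (dmap A B F p v))"

definition Ric_perp ::
  "('m, 'e::euclidean_space) chart set \<Rightarrow> ('n::topological_space, 'd::euclidean_space) chart set \<Rightarrow>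
   ('m \<Rightarrow> 'n) \<Rightarrow> ('n \<Rightarrow> 'd \<Rightarrow> 'd \<Rightarrow> real) \<Rightarrow> ('n \<Rightarrow> 'd \<Rightarrow> ('n \<Rightarrow> 'd) \<Rightarrow> 'd) \<Rightarrow>
   'm \<Rightarrow> 'd \<Rightarrow> 'd" where
  "Ric_perp A B F g nabla p w =
    (THE \<zeta>. is_normal A B F g p \<zeta> \<and>
       (\<forall>z. is_normal A B F g p z \<longrightarrow> g (F p) \<zeta> z = Ric_M A B F g nabla p w z))"

end

theory Submission
  imports Defs
begin

text \<open>
  Everything is a computation at one point \<open>q\<close>, made in a chart \<open>c\<close> of \<open>M\<close> at \<open>q\<close> and a chart \<open>d\<close> of \<open>N\<close>
  at \<open>F q\<close>.  There the immersion is a smooth map \<open>\<phi>\<close> between open sets of Euclidean spaces, the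
  metric of \<open>N\<close> is a field \<open>G\<close> of inner products, its connection is given by Christoffel symbols \<open>\<Gamma>\<close>,
  and the covariant derivative along \<open>\<phi>\<close> is \<open>D\<^sub>u \<xi> = \<partial>\<^sub>u \<xi> + \<Gamma>(\<phi>)(\<partial>\<^sub>u \<phi>, \<xi>)\<close>.

  Write \<open>\<phi>\<^sub>u = \<partial>\<^sub>u \<phi>\<close> and let \<open>\<nabla>\<^sup>2V(a, b) = \<nabla>\<^sub>a \<nabla>\<^sub>b V - \<nabla>\<^bsub>\<nabla>\<^sub>a b\<^esub> V\<close>.  Differentiating
  \<open>f = G(\<eta>, V)\<close> twice and subtracting \<open>\<partial>\<^sub>w f\<close>, where \<open>\<phi>\<^sub>w\<close> is the tangential part of \<open>D\<^sub>u \<phi>\<^sub>v\<close>, gives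
  the Hessian of \<open>f\<close> as a sum of five terms (\<open>hessian_along\<close>).  Taking the trace over an orthonormal
  frame \<open>E\<^sub>i\<close>, they behave as follows.

  \<^item> \<open>G(D\<^sub>u \<eta>, \<nabla>V)\<close> occurs twice and has trace zero: since \<open>\<eta>\<close> is parallel, \<open>D\<eta>\<close> is tangent and given
    by the symmetric shape operator, while \<open>\<nabla>V\<close> is skew by the Killing equation (\<open>shape_skew_trace\<close>).
  \<^item> \<open>G(\<eta>, \<nabla>V)\<close> applied to the second fundamental form becomes \<open>- n\<langle>H, \<nabla>\<^sub>\<eta> V\<rangle>\<close>, again by skewness.
  \<^item> \<open>G(\<eta>, \<nabla>\<^sup>2V(e, e))\<close> equals \<open>- \<langle>R(\<eta>, e)V, e\<rangle>\<close>, because \<open>\<nabla>\<^sup>2V(a, b)\<close> is skew in \<open>b\<close> against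
    the vector it is paired with, and commuting \<open>a\<close> and \<open>b\<close> costs a curvature (\<open>nab2_diagonal\<close>).  Its
    trace is \<open>- Ric\<^sub>M(\<eta>, V)\<close>.
  \<^item> \<open>G(D\<^sup>2\<eta>, V)\<close> is split along \<open>V = \<phi>\<^sub>t + \<xi>\<close> with \<open>\<xi>\<close> normal.  Differentiating \<open>G(D\<eta>, \<xi>) = 0\<close>, the
    normal part has trace \<open>- \<langle>B(\<eta>), \<xi>\<rangle>\<close>.  For the tangential part the Codazzi equation
    (\<open>codazzi_sym\<close> and \<open>cov_commute\<close>) moves \<open>t\<close> into the slot of the outer derivative, where the trace is
    \<open>- n \<partial>\<^sub>t \<langle>H, \<eta>\<rangle>\<close> (\<open>trace_deriv\<close>), at the price of a term \<open>Ric\<^sub>M(\<eta>, \<phi>\<^sub>t)\<close>.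

  The two Ricci terms combine to \<open>- Ric\<^sub>M(\<eta>, V - \<phi>\<^sub>t) = - Ric\<^sub>M(\<eta>, \<xi>)\<close>, which is why only the normal
  Ricci operator survives.  This is \<open>laplacian_formula\<close>.

  The second half of the work identifies the invariantly defined objects with their expressions in
  charts.  The connection is only known through its axioms, so its Christoffel symbols are extracted from
  its values on coordinate fields (\<open>nabla_chart\<close>); curvature, second fundamental form, Simons operator
  and normal Ricci operator are definite descriptions, for which existence and uniqueness have to be
  shown (\<open>curvature_chart\<close>, \<open>second_ff_local\<close>, \<open>simons_op_local\<close>, \<open>Ric_perp_local\<close>).  A smooth local
  orthonormal frame (\<open>smooth_orthonormal_frame\<close>) makes gradients, traces and orthogonal projections
  visibly smooth, without inverting the Gram matrix.
\<close>


section \<open>Calculus of smooth maps\<close>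

text \<open>Directional derivatives, with the direction first, so that \<open>pd v f\<close> is again a function of the point and
derivatives can be iterated.\<close>

abbreviation pd :: "'a::real_normed_vector \<Rightarrow> ('a \<Rightarrow> 'b::real_normed_vector) \<Rightarrow> 'a \<Rightarrow> 'b" where
  "pd v f x \<equiv> frechet_derivative f (at x) v"

lemma pd_eqI: "(f has_derivative f') (at x) \<Longrightarrow> pd v f x = f' v"
  using frechet_derivative_at by metis

text \<open>The derivative at a point depends only on the germ.  This is used throughout to replace a function by a
formula that is valid only on an open set.\<close>

lemma pd_cong_open:
  assumes "open S" "x \<in> S" "\<And>y. y \<in> S \<Longrightarrow> f y = g y"
  shows "pd v f x = pd v g x"
proof -
  have "(f has_derivative D) (at x) \<longleftrightarrow> (g has_derivative D) (at x)" for D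
    using has_derivative_transform_within_open[of f D x UNIV S g]
      has_derivative_transform_within_open[of g D x UNIV S f] assms by auto
  then show ?thesis
    unfolding frechet_derivative_def by simp
qed

lemma Ck_on_cong:
  assumes "open S" "\<And>x. x \<in> S \<Longrightarrow> f x = g x" "Ck_on k S g"
  shows "Ck_on k S f"
  using assms(2,3)
proof (induction k arbitrary: f g)
  case 0
  then show ?case using continuous_on_cong[of S S f g] by simp
next
  case (Suc k)
  have "f differentiable_on S"
    unfolding differentiable_on_def
  proof
    fix x assume "x \<in> S"
    then show "f differentiable (at x within S)"
      using Suc.prems differentiable_transform_within[of g x S 1 f]
      by (simp add: differentiable_on_def)
  qed
  moreover have "Ck_on k S (\<lambda>x. pd v f x)" for v
    by (rule Suc.IH[where g="\<lambda>x. pd v g x"])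
       (use Suc.prems assms(1) pd_cong_open[of S _ f g v] in auto)
  ultimately show ?case by simp
qed

lemma Ck_on_Suc_imp: "Ck_on (Suc k) S f \<Longrightarrow> Ck_on k S f"
proof (induction k arbitrary: f)
  case 0
  then show ?case by (simp add: differentiable_imp_continuous_on)
next
  case (Suc k)
  then have "f differentiable_on S" "\<And>v. Ck_on k S (\<lambda>x. pd v f x)" by auto
  then show ?case by simp
qed

lemma Ck_on_subset: "Ck_on k S f \<Longrightarrow> T \<subseteq> S \<Longrightarrow> Ck_on k T f"
proof (induction k arbitrary: f)
  case 0
  then show ?case using continuous_on_subset by auto
next
  case (Suc k)
  then show ?case by (auto intro: differentiable_on_subset)
qed

lemma Ck_on_has_derivative:
  "open S \<Longrightarrow> Ck_on (Suc k) S f \<Longrightarrow> x \<in> S \<Longrightarrow> (f has_derivative (\<lambda>v. pd v f x)) (at x)"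
  by (simp add: differentiable_on_eq_differentiable_at frechet_derivative_works)

text \<open>Proofs of \<open>Ck_on\<close> by induction exhibit some derivative on \<open>S\<close>, while the definition speaks about the
\<open>frechet_derivative\<close>; the two agree only on \<open>S\<close>.\<close>

lemma Ck_on_Suc_derivI:
  assumes "open S" "\<And>x. x \<in> S \<Longrightarrow> (f has_derivative f' x) (at x)"
    and "\<And>v. Ck_on k S (\<lambda>x. f' x v)"
  shows "Ck_on (Suc k) S f"
proof -
  have "f differentiable_on S"
    using differentiableI[OF assms(2)] by (simp add: differentiable_at_imp_differentiable_on)
  moreover have "Ck_on k S (\<lambda>x. pd v f x)" for v
    by (rule Ck_on_cong[OF assms(1) _ assms(3)[of v]]) (simp add: pd_eqI[OF assms(2)])
  ultimately show ?thesis by simp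
qed

lemma Ck_on_const: "open S \<Longrightarrow> Ck_on k S (\<lambda>x. c)"
proof (induction k arbitrary: c)
  case (Suc k)
  show ?case
    by (rule Ck_on_Suc_derivI[where f'="\<lambda>x v. 0"]) (use Suc in \<open>auto intro: Suc.IH\<close>)
qed auto

lemma Ck_on_bounded_linear:
  assumes "bounded_linear L" "open S"
  shows "Ck_on k S f \<Longrightarrow> Ck_on k S (\<lambda>x. L (f x))"
proof (induction k arbitrary: f)
  case 0
  then show ?case
    using assms(1) by (auto intro: bounded_linear.continuous_on)
next
  case (Suc k)
  show ?case
  proof (rule Ck_on_Suc_derivI[where f'="\<lambda>x v. L (pd v f x)"])
    show "((\<lambda>x. L (f x)) has_derivative (\<lambda>v. L (pd v f x))) (at x)" if "x \<in> S" for x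
      by (rule bounded_linear.has_derivative[OF assms(1) Ck_on_has_derivative[OF assms(2) Suc.prems that]])
  qed (use assms Suc in auto)
qed

lemma Ck_on_add:
  assumes "open S"
  shows "Ck_on k S f \<Longrightarrow> Ck_on k S g \<Longrightarrow> Ck_on k S (\<lambda>x. f x + g x)"
proof (induction k arbitrary: f g)
  case 0
  then show ?case by (auto intro: continuous_on_add)
next
  case (Suc k)
  show ?case
  proof (rule Ck_on_Suc_derivI[where f'="\<lambda>x v. pd v f x + pd v g x"])
    show "((\<lambda>x. f x + g x) has_derivative (\<lambda>v. pd v f x + pd v g x)) (at x)" if "x \<in> S" for x
      by (rule has_derivative_add[OF Suc.prems[THEN Ck_on_has_derivative[OF assms], OF that]])
  qed (use assms Suc in auto)
qed

lemma Ck_on_bilinear: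
  assumes b: "bounded_bilinear b" and "open S"
  shows "Ck_on k S f \<Longrightarrow> Ck_on k S g \<Longrightarrow> Ck_on k S (\<lambda>x. b (f x) (g x))"
proof (induction k arbitrary: f g)
  case 0
  then show ?case using bounded_bilinear.continuous_on[OF b] by auto
next
  case (Suc k)
  note fg = Suc.prems[THEN Ck_on_Suc_imp]
  show ?case
  proof (rule Ck_on_Suc_derivI[where f'="\<lambda>x v. b (f x) (pd v g x) + b (pd v f x) (g x)"])
    show "((\<lambda>x. b (f x) (g x)) has_derivative (\<lambda>v. b (f x) (pd v g x) + b (pd v f x) (g x))) (at x)"
      if "x \<in> S" for x
      by (rule bounded_bilinear.FDERIV[OF b Suc.prems[THEN Ck_on_has_derivative[OF assms(2)], OF that]])
    show "Ck_on k S (\<lambda>x. b (f x) (pd v g x) + b (pd v f x) (g x))" for v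
      using Suc.prems by (intro Ck_on_add[OF assms(2)] Suc.IH fg) simp_all
  qed (use assms in auto)
qed

lemma Ck_on_sum:
  assumes "open S" "finite I" "\<And>i. i \<in> I \<Longrightarrow> Ck_on k S (f i)"
  shows "Ck_on k S (\<lambda>x. \<Sum>i\<in>I. f i x)"
  using assms(2,3) by (induction I rule: finite_induct) (auto intro: Ck_on_const Ck_on_add assms(1))

text \<open>As a rewrite rule this loops; it serves to reduce statements about all arguments of a linear map to
the finitely many basis vectors.\<close>

lemma linear_expand:
  fixes L :: "'a::euclidean_space \<Rightarrow> 'b::real_vector"
  assumes "linear L"
  shows "L u = (\<Sum>i\<in>Basis. (u \<bullet> i) *\<^sub>R L i)"
proof -
  have "L u = L (\<Sum>i\<in>Basis. (u \<bullet> i) *\<^sub>R i)" by (simp add: euclidean_representation)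
  also have "\<dots> = (\<Sum>i\<in>Basis. (u \<bullet> i) *\<^sub>R L i)"
    using assms by (simp add: linear_sum linear_scale)
  finally show ?thesis .
qed

text \<open>The chain rule produces \<open>pd (pd v g x) f (g x)\<close>, whose direction varies with \<open>x\<close>.  Expanding the direction in
the standard basis leaves products of derivatives of \<open>g\<close> with \<open>(pd i f) \<circ> g\<close> for fixed \<open>i\<close>, to which the
induction hypothesis applies.\<close>

lemma Ck_on_compose:
  fixes f :: "'b::euclidean_space \<Rightarrow> 'c::real_normed_vector"
  assumes "open S" "open T"
  shows "Ck_on k T f \<Longrightarrow> Ck_on k S g \<Longrightarrow> g ` S \<subseteq> T \<Longrightarrow> Ck_on k S (\<lambda>x. f (g x))"
proof (induction k arbitrary: f)
  case 0
  then show ?case by (auto intro: continuous_on_compose2)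
next
  case (Suc k)
  note g = Ck_on_Suc_imp[OF Suc.prems(2)]
  show ?case
  proof (rule Ck_on_Suc_derivI[where f'="\<lambda>x v. \<Sum>i\<in>Basis. (pd v g x \<bullet> i) *\<^sub>R pd i f (g x)"])
    show "((\<lambda>x. f (g x)) has_derivative (\<lambda>v. \<Sum>i\<in>Basis. (pd v g x \<bullet> i) *\<^sub>R pd i f (g x))) (at x)"
      if "x \<in> S" for x
    proof -
      have 1: "(f has_derivative (\<lambda>v. pd v f (g x))) (at (g x))"
        by (rule Ck_on_has_derivative[OF assms(2) Suc.prems(1)]) (use that Suc.prems in auto)
      have "((\<lambda>x. f (g x)) has_derivative (\<lambda>v. pd (pd v g x) f (g x))) (at x)"
        by (rule has_derivative_compose[OF Ck_on_has_derivative[OF assms(1) Suc.prems(2) that] 1])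
      then show ?thesis
        by (rule has_derivative_eq_rhs) (rule ext, rule linear_expand[OF has_derivative_linear[OF 1]])
    qed
    show "Ck_on k S (\<lambda>x. \<Sum>i\<in>Basis. (pd v g x \<bullet> i) *\<^sub>R pd i f (g x))" for v
      by (intro Ck_on_sum Ck_on_bilinear[OF bounded_bilinear_scaleR]
          Ck_on_bounded_linear[OF bounded_linear_inner_left] Suc.IH g assms)
         (use assms Suc.prems in auto)
  qed (use assms in auto)
qed

lemma Ck_on_inverse:
  fixes f :: "'a::euclidean_space \<Rightarrow> real"
  assumes "open S" "\<And>x. x \<in> S \<Longrightarrow> f x \<noteq> 0"
  shows "Ck_on k S f \<Longrightarrow> Ck_on k S (\<lambda>x. inverse (f x))"
proof (induction k)
  case 0
  then show ?case using assms by (auto intro: continuous_on_inverse)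
next
  case (Suc k)
  note f = Ck_on_Suc_imp[OF Suc.prems]
  show ?case
  proof (rule Ck_on_Suc_derivI[where f'="\<lambda>x v. (inverse (f x) * pd v f x) * (- 1 * inverse (f x))"])
    show "((\<lambda>x. inverse (f x)) has_derivative (\<lambda>v. (inverse (f x) * pd v f x) * (- 1 * inverse (f x)))) (at x)"
      if "x \<in> S" for x
      using Deriv.has_derivative_inverse[OF assms(2)[OF that] Ck_on_has_derivative[OF assms(1) Suc.prems that]]
      by simp
    show "Ck_on k S (\<lambda>x. (inverse (f x) * pd v f x) * (- 1 * inverse (f x)))" for v
      by (intro Ck_on_bilinear[OF bounded_bilinear_mult] Ck_on_const Suc.IH f assms(1))
         (use Suc.prems in auto)
  qed (use assms in auto)
qed

lemma Ck_on_sqrt: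
  fixes f :: "'a::euclidean_space \<Rightarrow> real"
  assumes "open S" "\<And>x. x \<in> S \<Longrightarrow> f x > 0"
  shows "Ck_on k S f \<Longrightarrow> Ck_on k S (\<lambda>x. sqrt (f x))"
proof (induction k)
  case 0
  then show ?case using assms by (auto intro: continuous_on_real_sqrt)
next
  case (Suc k)
  note f = Ck_on_Suc_imp[OF Suc.prems]
  show ?case
  proof (rule Ck_on_Suc_derivI[where f'="\<lambda>x v. pd v f x * (inverse (sqrt (f x)) * (1/2))"])
    show "((\<lambda>x. sqrt (f x)) has_derivative (\<lambda>v. pd v f x * (inverse (sqrt (f x)) * (1/2)))) (at x)"
      if "x \<in> S" for x
      using has_derivative_real_sqrt[OF assms(2)[OF that] Ck_on_has_derivative[OF assms(1) Suc.prems that]]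
      by (simp add: field_simps)
    have "Ck_on k S (\<lambda>x. inverse (sqrt (f x)))"
      by (rule Ck_on_inverse[OF assms(1) _ Suc.IH[OF f]]) (use assms(2) in force)
    then show "Ck_on k S (\<lambda>x. pd v f x * (inverse (sqrt (f x)) * (1/2)))" for v
      by (intro Ck_on_bilinear[OF bounded_bilinear_mult] Ck_on_const assms(1))
         (use Suc.prems in auto)
  qed (use assms in auto)
qed

lemma smooth_on_const: "open S \<Longrightarrow> smooth_on S (\<lambda>x. c)"
  by (simp add: smooth_on_def Ck_on_const)

lemma smooth_on_add: "open S \<Longrightarrow> smooth_on S f \<Longrightarrow> smooth_on S h \<Longrightarrow> smooth_on S (\<lambda>x. f x + h x)"
  by (simp add: smooth_on_def Ck_on_add)

lemma smooth_on_sum: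
  "open S \<Longrightarrow> finite I \<Longrightarrow> (\<And>i. i \<in> I \<Longrightarrow> smooth_on S (F i)) \<Longrightarrow> smooth_on S (\<lambda>x. \<Sum>i\<in>I. F i x)"
  by (simp add: smooth_on_def Ck_on_sum)

lemma smooth_on_bounded_linear:
  "open S \<Longrightarrow> bounded_linear L \<Longrightarrow> smooth_on S f \<Longrightarrow> smooth_on S (\<lambda>x. L (f x))"
  by (simp add: smooth_on_def Ck_on_bounded_linear)

lemma smooth_on_bilinear:
  "open S \<Longrightarrow> bounded_bilinear b \<Longrightarrow> smooth_on S f \<Longrightarrow> smooth_on S h \<Longrightarrow> smooth_on S (\<lambda>x. b (f x) (h x))"
  by (simp add: smooth_on_def Ck_on_bilinear)

lemma smooth_on_cong:
  "open S \<Longrightarrow> smooth_on S h \<Longrightarrow> (\<And>x. x \<in> S \<Longrightarrow> f x = h x) \<Longrightarrow> smooth_on S f"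
  unfolding smooth_on_def using Ck_on_cong[of S f h] by blast

lemma smooth_on_subset: "smooth_on S f \<Longrightarrow> T \<subseteq> S \<Longrightarrow> smooth_on T f"
  unfolding smooth_on_def using Ck_on_subset by blast

lemma smooth_on_inverse:
  "open S \<Longrightarrow> smooth_on S r \<Longrightarrow> (\<And>x. x \<in> S \<Longrightarrow> r x \<noteq> 0) \<Longrightarrow> smooth_on S (\<lambda>x. inverse (r x :: real))"
  by (simp add: smooth_on_def Ck_on_inverse)

lemma smooth_on_sqrt:
  "open S \<Longrightarrow> smooth_on S r \<Longrightarrow> (\<And>x. x \<in> S \<Longrightarrow> r x > 0) \<Longrightarrow> smooth_on S (\<lambda>x. sqrt (r x))"
  by (simp add: smooth_on_def Ck_on_sqrt)

lemma smooth_on_pd: "smooth_on S f \<Longrightarrow> smooth_on S (\<lambda>x. pd v f x)"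
  unfolding smooth_on_def using Ck_on.simps(2) by blast

lemma smooth_on_compose:
  fixes f :: "'b::euclidean_space \<Rightarrow> 'c::real_normed_vector"
  assumes "open S" "open T" "smooth_on T f" "smooth_on S g" "\<And>x. x \<in> S \<Longrightarrow> g x \<in> T"
  shows "smooth_on S (\<lambda>x. f (g x))"
  using assms Ck_on_compose[of S T _ f g] unfolding smooth_on_def by blast

lemmas smooth_on_scaleR = smooth_on_bilinear[OF _ bounded_bilinear_scaleR]
lemmas smooth_on_inner_left = smooth_on_bounded_linear[OF _ bounded_linear_inner_left]

lemma smooth_on_minus: "open S \<Longrightarrow> smooth_on S f \<Longrightarrow> smooth_on S (\<lambda>x. - f x)"
  by (rule smooth_on_bounded_linear[OF _ bounded_linear_minus[OF bounded_linear_ident]])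

lemma smooth_on_diff:
  assumes "open S" "smooth_on S f" "smooth_on S g"
  shows "smooth_on S (\<lambda>x. f x - g x)"
  using smooth_on_add[OF assms(1,2) smooth_on_minus[OF assms(1,3)]] by simp

lemma smooth_on_ident: "open S \<Longrightarrow> smooth_on S (\<lambda>x. x)"
  unfolding smooth_on_def
proof
  fix k assume S: "open S"
  show "Ck_on k S (\<lambda>x. x)"
  proof (cases k)
    case (Suc m)
    show ?thesis unfolding Suc
      by (rule Ck_on_Suc_derivI[where f'="\<lambda>x v. v"]) (use S in \<open>auto intro: Ck_on_const\<close>)
  qed auto
qed

lemma smooth_on_has_derivative:
  "open S \<Longrightarrow> smooth_on S f \<Longrightarrow> x \<in> S \<Longrightarrow> (f has_derivative (\<lambda>v. pd v f x)) (at x)"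
  by (rule Ck_on_has_derivative[of S 0]) (auto simp only: smooth_on_def)

lemma smooth_on_linear_pd: "open S \<Longrightarrow> smooth_on S f \<Longrightarrow> x \<in> S \<Longrightarrow> linear (\<lambda>v. pd v f x)"
  by (rule has_derivative_linear[OF smooth_on_has_derivative])

lemma pd_compose:
  assumes "open S" "open T" "smooth_on T f" "smooth_on S g" "x \<in> S" "g x \<in> T"
  shows "pd v (\<lambda>x. f (g x)) x = pd (pd v g x) f (g x)"
  by (rule pd_eqI[OF has_derivative_compose[OF smooth_on_has_derivative[OF assms(1,4,5)]
        smooth_on_has_derivative[OF assms(2,3,6)]]])

lemma mvt_pd:
  fixes f :: "'a::euclidean_space \<Rightarrow> real"
  assumes "0 < h" "\<And>s. 0 \<le> s \<Longrightarrow> s \<le> h \<Longrightarrow> (f has_derivative (\<lambda>w. pd w f (a + s *\<^sub>R u))) (at (a + s *\<^sub>R u))"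
  shows "\<exists>s. 0 < s \<and> s < h \<and> f (a + h *\<^sub>R u) - f a = h * pd u f (a + s *\<^sub>R u)"
proof -
  let ?g = "\<lambda>s. f (a + s *\<^sub>R u)"
  have "DERIV ?g s :> pd u f (a + s *\<^sub>R u)" if "0 \<le> s" "s \<le> h" for s
  proof -
    have "((\<lambda>s. a + s *\<^sub>R u) has_derivative (\<lambda>t. t *\<^sub>R u)) (at s)"
      by (auto intro!: derivative_eq_intros)
    from has_derivative_compose[OF this assms(2)[OF that]]
    have "(?g has_derivative (\<lambda>t. pd (t *\<^sub>R u) f (a + s *\<^sub>R u))) (at s)" .
    moreover have "linear (\<lambda>w. pd w f (a + s *\<^sub>R u))"
      using assms(2)[OF that] has_derivative_linear by blast
    ultimately show ?thesis
      by (simp add: has_field_derivative_def linear_scale mult_commute_abs)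
  qed
  from MVT2[OF assms(1) this] show ?thesis by auto
qed

text \<open>The mean value theorem applied to \<open>y \<mapsto> f (y + h *\<^sub>R v) - f y\<close> in the direction \<open>u\<close>, and then to \<open>pd u f\<close> in
the direction \<open>v\<close>.  The second difference on the left is symmetric in \<open>u\<close> and \<open>v\<close>, the right side is
not.\<close>

lemma mixed_difference:
  fixes f :: "'a::euclidean_space \<Rightarrow> real"
  assumes "open S" "smooth_on S f" "0 < h"
    and S: "\<And>s t. 0 \<le> s \<Longrightarrow> s \<le> h \<Longrightarrow> 0 \<le> t \<Longrightarrow> t \<le> h \<Longrightarrow> x + s *\<^sub>R u + t *\<^sub>R v \<in> S"
  shows "\<exists>s t. 0 < s \<and> s < h \<and> 0 < t \<and> t < h \<and>
    f (x + h *\<^sub>R u + h *\<^sub>R v) - f (x + h *\<^sub>R u) - (f (x + h *\<^sub>R v) - f x)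
      = h * (h * pd v (pd u f) (x + s *\<^sub>R u + t *\<^sub>R v))"
proof -
  let ?k = "\<lambda>y. f (y + h *\<^sub>R v) - f y"
  have D: "(?k has_derivative (\<lambda>w. pd w f (y + h *\<^sub>R v) - pd w f y)) (at y)"
    if "y \<in> S" "y + h *\<^sub>R v \<in> S" for y
  proof -
    have 1: "((\<lambda>y. y + h *\<^sub>R v) has_derivative (\<lambda>w. w)) (at y)"
      by (auto intro!: derivative_eq_intros)
    have "((\<lambda>y. f (y + h *\<^sub>R v)) has_derivative (\<lambda>w. pd w f (y + h *\<^sub>R v))) (at y)"
      using has_derivative_compose[OF 1 smooth_on_has_derivative[OF assms(1,2) that(2)]] by simp
    then show ?thesis
      by (intro has_derivative_diff smooth_on_has_derivative[OF assms(1,2)] that)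
  qed
  have S1: "x + s *\<^sub>R u \<in> S \<and> x + s *\<^sub>R u + h *\<^sub>R v \<in> S" if "0 \<le> s" "s \<le> h" for s
    using S[OF that, of 0] S[OF that, of h] assms(3) by auto
  have "\<exists>s. 0 < s \<and> s < h \<and> ?k (x + h *\<^sub>R u) - ?k x = h * pd u ?k (x + s *\<^sub>R u)"
  proof (rule mvt_pd[OF assms(3)])
    fix s assume "0 \<le> s" "s \<le> h"
    with S1 D show "(?k has_derivative (\<lambda>w. pd w ?k (x + s *\<^sub>R u))) (at (x + s *\<^sub>R u))"
      using differentiableI frechet_derivative_works by blast
  qed
  then obtain s where s: "0 < s" "s < h" "?k (x + h *\<^sub>R u) - ?k x = h * pd u ?k (x + s *\<^sub>R u)"
    by blast
  have k: "pd u ?k (x + s *\<^sub>R u) = pd u f (x + s *\<^sub>R u + h *\<^sub>R v) - pd u f (x + s *\<^sub>R u)"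
    using pd_eqI[OF D] S1 s by simp
  have "\<exists>t. 0 < t \<and> t < h \<and> pd u f (x + s *\<^sub>R u + h *\<^sub>R v) - pd u f (x + s *\<^sub>R u)
      = h * pd v (pd u f) (x + s *\<^sub>R u + t *\<^sub>R v)"
    by (rule mvt_pd[OF assms(3)], rule smooth_on_has_derivative[OF assms(1) smooth_on_pd[OF assms(2)]])
       (use S s in auto)
  with s k show ?thesis by (metis (no_types, lifting) diff_diff_eq)
qed

text \<open>Both orders of \<open>mixed_difference\<close> evaluate the same second difference, so the two mixed derivatives agree
at two points arbitrarily close to \<open>x\<close>; they are continuous.\<close>

lemma pd_commute_real:
  fixes f :: "'a::euclidean_space \<Rightarrow> real"
  assumes S: "open S" and f: "smooth_on S f" and x: "x \<in> S"
  shows "pd v (pd u f) x = pd u (pd v f) x"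
proof (rule ccontr)
  assume ne: "pd v (pd u f) x \<noteq> pd u (pd v f) x"
  define e where "e = \<bar>pd v (pd u f) x - pd u (pd v f) x\<bar> / 2"
  have e: "e > 0" using ne by (simp add: e_def)
  have cont: "continuous (at x) (pd b (pd a f))" for a b
    by (rule has_derivative_continuous[OF smooth_on_has_derivative[OF S smooth_on_pd[OF smooth_on_pd[OF f]] x]])
  have "\<exists>d>0. \<forall>y. dist y x < d \<longrightarrow> dist (pd b (pd a f) y) (pd b (pd a f) x) < e" for a b
    using cont[of a b, unfolded continuous_at_eps_delta] e by auto
  from this[of v u] this[of u v] obtain d1 d2 where d: "d1 > 0" "d2 > 0"
    "\<And>y. dist y x < d1 \<Longrightarrow> dist (pd v (pd u f) y) (pd v (pd u f) x) < e"
    "\<And>y. dist y x < d2 \<Longrightarrow> dist (pd u (pd v f) y) (pd u (pd v f) x) < e"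
    by auto
  obtain d3 where d3: "d3 > 0" "\<And>y. dist y x < d3 \<Longrightarrow> y \<in> S"
    using S x open_dist by metis
  define r where "r = min d1 (min d2 d3)"
  \<comment> \<open>With this side length the parallelogram spanned at \<open>x\<close> stays in the ball of radius \<open>r\<close>.\<close>
  define h where "h = r / (2 * (1 + norm u + norm v))"
  have pos: "1 + norm u + norm v > 0" by (smt (verit) norm_ge_zero)
  have r: "r > 0" using d d3 by (simp add: r_def)
  have h: "h > 0" using r pos by (simp add: h_def)
  have near: "dist (x + s *\<^sub>R u + t *\<^sub>R v) x < r" if "0 \<le> s" "s \<le> h" "0 \<le> t" "t \<le> h" for s t
  proof -
    have "dist (x + s *\<^sub>R u + t *\<^sub>R v) x = norm (s *\<^sub>R u + t *\<^sub>R v)" by (simp add: dist_norm)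
    also have "\<dots> \<le> s * norm u + t * norm v"
      using norm_triangle_ineq[of "s *\<^sub>R u" "t *\<^sub>R v"] that by simp
    also have "\<dots> \<le> h * norm u + h * norm v"
      using that by (intro add_mono mult_right_mono) auto
    also have "\<dots> \<le> h * (1 + norm u + norm v)" using h by (simp add: distrib_left)
    also have "\<dots> = r / 2"
    proof -
      have "r / (2 * a) * a = r / 2" if "a > 0" for a using that by simp
      from this[OF pos] show ?thesis unfolding h_def .
    qed
    also have "\<dots> < r" using r by simp
    finally show ?thesis .
  qed
  have inS: "x + s *\<^sub>R u + t *\<^sub>R v \<in> S" if "0 \<le> s" "s \<le> h" "0 \<le> t" "t \<le> h" for s t
    using d3 near[OF that] by (simp add: r_def)
  obtain s t where st: "0 < s" "s < h" "0 < t" "t < h"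
    "f (x + h *\<^sub>R u + h *\<^sub>R v) - f (x + h *\<^sub>R u) - (f (x + h *\<^sub>R v) - f x)
      = h * (h * pd v (pd u f) (x + s *\<^sub>R u + t *\<^sub>R v))"
    using mixed_difference[OF S f h inS] by blast
  have inS': "x + s *\<^sub>R v + t *\<^sub>R u \<in> S" if "0 \<le> s" "s \<le> h" "0 \<le> t" "t \<le> h" for s t
    using inS[of t s] that by (simp add: algebra_simps)
  obtain s' t' where st': "0 < s'" "s' < h" "0 < t'" "t' < h"
    "f (x + h *\<^sub>R v + h *\<^sub>R u) - f (x + h *\<^sub>R v) - (f (x + h *\<^sub>R u) - f x)
      = h * (h * pd u (pd v f) (x + s' *\<^sub>R v + t' *\<^sub>R u))"
    using mixed_difference[OF S f h inS'] by blast
  have eq: "pd v (pd u f) (x + s *\<^sub>R u + t *\<^sub>R v) = pd u (pd v f) (x + t' *\<^sub>R u + s' *\<^sub>R v)"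
    using st(5) st'(5) h by (simp add: algebra_simps)
  have "dist (pd v (pd u f) (x + s *\<^sub>R u + t *\<^sub>R v)) (pd v (pd u f) x) < e"
    using near[of s t] st d by (simp add: r_def)
  moreover have "dist (pd u (pd v f) (x + t' *\<^sub>R u + s' *\<^sub>R v)) (pd u (pd v f) x) < e"
    using near[of t' s'] st' d by (simp add: r_def)
  ultimately show False
    using eq unfolding e_def dist_real_def by (smt (verit) field_sum_of_halves)
qed

lemma pd_bounded_linear:
  assumes "open S" "smooth_on S f" "x \<in> S" "bounded_linear L"
  shows "pd v (\<lambda>x. L (f x)) x = L (pd v f x)"
  by (rule pd_eqI, rule bounded_linear.has_derivative[OF assms(4) smooth_on_has_derivative])
     (use assms in auto)

lemma pd_commute:
  fixes f :: "'a::euclidean_space \<Rightarrow> 'b::euclidean_space"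
  assumes S: "open S" and f: "smooth_on S f" and x: "x \<in> S"
  shows "pd v (pd u f) x = pd u (pd v f) x"
proof (rule euclidean_eqI)
  fix i :: 'b assume "i \<in> Basis"
  let ?L = "\<lambda>w::'b. w \<bullet> i"
  have L: "bounded_linear ?L" by (rule bounded_linear_inner_left)
  have "?L (pd v (pd u f) x) = pd v (pd u (\<lambda>x. ?L (f x))) x" for u v
    unfolding pd_bounded_linear[OF S smooth_on_pd[OF f] x L, symmetric]
    by (rule pd_cong_open[OF S x]) (simp add: pd_bounded_linear[OF S f _ L])
  then show "?L (pd v (pd u f) x) = ?L (pd u (pd v f) x)"
    using pd_commute_real[OF S smooth_on_inner_left[OF S f] x] by simp
qed


section \<open>Fields of linear and bilinear maps\<close>

text \<open>A linear map depending on a point is treated as a function \<open>L\<close> of two arguments whose regularity is known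
only for fixed second argument.  Expansion in the standard basis extends it to varying second
arguments, and yields the product rule.\<close>

lemma linear_field_has_derivative:
  fixes L :: "'a::real_normed_vector \<Rightarrow> 'u::euclidean_space \<Rightarrow> 'c::real_normed_vector"
  assumes S: "open S" "x \<in> S" and L: "\<And>y. y \<in> S \<Longrightarrow> linear (L y)"
    and D: "\<And>a. ((\<lambda>y. L y a) has_derivative D a) (at x)"
    and u: "(u has_derivative u') (at x)"
  shows "((\<lambda>y. L y (u y)) has_derivative (\<lambda>h. D (u x) h + L x (u' h))) (at x)"
proof -
  have sums: "((\<lambda>y. \<Sum>i\<in>Basis. (w y \<bullet> i) *\<^sub>R L y i) has_derivative
      (\<lambda>h. \<Sum>i\<in>Basis. (w x \<bullet> i) *\<^sub>R D i h + (w' h \<bullet> i) *\<^sub>R L x i)) (at x)"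
    if "(w has_derivative w') (at x)" for w w'
    by (intro has_derivative_sum bounded_bilinear.FDERIV[OF bounded_bilinear_scaleR]
        has_derivative_inner_left that D)
  have eq: "L y (w y) = (\<Sum>i\<in>Basis. (w y \<bullet> i) *\<^sub>R L y i)" if "y \<in> S" for y w
    by (rule linear_expand[OF L[OF that]])
  have der: "((\<lambda>y. L y (w y)) has_derivative
      (\<lambda>h. (\<Sum>i\<in>Basis. (w x \<bullet> i) *\<^sub>R D i h) + L x (w' h))) (at x)"
    if w: "(w has_derivative w') (at x)" for w w'
  proof -
    have "((\<lambda>y. L y (w y)) has_derivative
      (\<lambda>h. \<Sum>i\<in>Basis. (w x \<bullet> i) *\<^sub>R D i h + (w' h \<bullet> i) *\<^sub>R L x i)) (at x)"
      by (rule has_derivative_transform_within_open[OF sums[OF w] S]) (simp add: eq)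
    moreover have "(\<Sum>i\<in>Basis. (w x \<bullet> i) *\<^sub>R D i h + (w' h \<bullet> i) *\<^sub>R L x i)
        = (\<Sum>i\<in>Basis. (w x \<bullet> i) *\<^sub>R D i h) + L x (w' h)" for h
      using linear_expand[OF L[OF S(2)], of "w' h"] by (simp add: sum.distrib)
    ultimately show ?thesis by simp
  qed
  have "D (u x) h = (\<Sum>i\<in>Basis. (u x \<bullet> i) *\<^sub>R D i h)" for h
    using fun_cong[OF has_derivative_unique[OF D[of "u x"] der[OF has_derivative_const[of "u x"]]], of h]
    by (simp add: linear_0[OF L[OF S(2)]])
  then show ?thesis using der[OF u] by simp
qed

lemma smooth_on_linear_field:
  fixes L :: "'a::euclidean_space \<Rightarrow> 'u::euclidean_space \<Rightarrow> 'c::real_normed_vector"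
  assumes S: "open S" and L: "\<And>y. y \<in> S \<Longrightarrow> linear (L y)"
    and sm: "\<And>a. smooth_on S (\<lambda>y. L y a)" and u: "smooth_on S u"
  shows "smooth_on S (\<lambda>y. L y (u y))"
proof (rule smooth_on_cong[OF S])
  show "smooth_on S (\<lambda>y. \<Sum>i\<in>Basis. (u y \<bullet> i) *\<^sub>R L y i)"
    by (intro smooth_on_sum[OF S] smooth_on_scaleR[OF S] smooth_on_inner_left[OF S] sm u) simp
qed (rule linear_expand[OF L])

lemma pd_linear_field:
  fixes L :: "'a::euclidean_space \<Rightarrow> 'u::euclidean_space \<Rightarrow> 'c::real_normed_vector"
  assumes S: "open S" "x \<in> S" and L: "\<And>y. y \<in> S \<Longrightarrow> linear (L y)"
    and sm: "\<And>a. smooth_on S (\<lambda>y. L y a)" and u: "smooth_on S u"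
  shows "pd h (\<lambda>y. L y (u y)) x = pd h (\<lambda>y. L y (u x)) x + L x (pd h u x)"
  by (rule pd_eqI[OF linear_field_has_derivative[OF S L smooth_on_has_derivative[OF S(1) sm S(2)]
      smooth_on_has_derivative[OF S(1) u S(2)]]])

text \<open>Metrics and Christoffel symbols in a chart.  Smoothness is required for constant arguments only;
\<open>smooth_on_bilinear_field\<close> extends it to smooth arguments.\<close>

definition bilinear_field ::
  "'a::euclidean_space set \<Rightarrow> ('a \<Rightarrow> 'u::euclidean_space \<Rightarrow> 'v::euclidean_space \<Rightarrow> 'c::real_normed_vector) \<Rightarrow> bool"
  where "bilinear_field S b \<longleftrightarrow> (\<forall>x\<in>S. bilinear (b x)) \<and> (\<forall>u v. smooth_on S (\<lambda>x. b x u v))"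

lemma bilinear_linear: "bilinear f \<Longrightarrow> linear (f x)" "bilinear f \<Longrightarrow> linear (\<lambda>x. f x y)"
  by (simp_all add: bilinear_def)

lemma smooth_on_bilinear_field:
  assumes S: "open S" and b: "bilinear_field S b" and u: "smooth_on S u" and v: "smooth_on S v"
  shows "smooth_on S (\<lambda>x. b x (u x) (v x))"
proof (rule smooth_on_linear_field[OF S, where L="\<lambda>x a. b x a (v x)", OF _ _ u])
  show "linear (\<lambda>a. b y a (v y))" if "y \<in> S" for y
    using b that by (simp add: bilinear_field_def bilinear_def)
  show "smooth_on S (\<lambda>y. b y a (v y))" for a
    by (rule smooth_on_linear_field[OF S _ _ v])
       (use b in \<open>auto simp: bilinear_field_def bilinear_def\<close>)
qed

lemma pd_bilinear_field:
  assumes S: "open S" "x \<in> S" and b: "bilinear_field S b" and u: "smooth_on S u" and v: "smooth_on S v"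
  shows "pd h (\<lambda>y. b y (u y) (v y)) x
    = pd h (\<lambda>y. b y (u x) (v x)) x + b x (pd h u x) (v x) + b x (u x) (pd h v x)"
proof -
  have "pd h (\<lambda>y. b y (u y) (v y)) x = pd h (\<lambda>y. b y (u x) (v y)) x + b x (pd h u x) (v x)"
    by (rule pd_linear_field[OF S, where L="\<lambda>x a. b x a (v x)", OF _ _ u])
       (use b in \<open>auto simp: bilinear_field_def bilinear_def
          intro: smooth_on_bilinear_field[OF S(1) b smooth_on_const[OF S(1)] v]\<close>)
  also have "pd h (\<lambda>y. b y (u x) (v y)) x = pd h (\<lambda>y. b y (u x) (v x)) x + b x (u x) (pd h v x)"
    by (rule pd_linear_field[OF S, where L="\<lambda>y. b y (u x)", OF _ _ v])
       (use b in \<open>auto simp: bilinear_field_def bilinear_def\<close>)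
  finally show ?thesis by simp
qed

lemma bilinear_field_compose:
  assumes "open S" "open T" "smooth_on S \<phi>" "\<And>x. x \<in> S \<Longrightarrow> \<phi> x \<in> T" "bilinear_field T b"
  shows "bilinear_field S (\<lambda>x. b (\<phi> x))"
  unfolding bilinear_field_def
proof (intro conjI ballI allI)
  show "bilinear (b (\<phi> x))" if "x \<in> S" for x
    using assms that by (simp add: bilinear_field_def)
  show "smooth_on S (\<lambda>x. b (\<phi> x) u v)" for u v
    by (rule smooth_on_compose[OF assms(1,2) _ assms(3,4), where f="\<lambda>y. b y u v"])
       (use assms(5) in \<open>simp add: bilinear_field_def\<close>)
qed


section \<open>Orthonormal bases, traces and frames\<close>

lemma inner_productD:
  assumes "inner_product G"
  shows "bilinear G" "G u v = G v u" "u \<noteq> 0 \<Longrightarrow> G u u > 0"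
  using assms by (auto simp: inner_product_def)

lemma inner_product_eqI:
  assumes G: "inner_product G" and "\<And>w. G u w = G v w"
  shows "u = v"
proof (rule ccontr)
  assume "u \<noteq> v"
  then have "G (u - v) (u - v) > 0" using inner_productD(3)[OF G] by simp
  moreover have "G (u - v) w = 0" for w
    using assms(2)[of w] bilinear_lsub[OF inner_productD(1)[OF G]] by simp
  ultimately show False by simp
qed

lemma sum_mult_delta:
  fixes c d :: "'i \<Rightarrow> real"
  assumes "finite J" "j \<in> J" "\<And>i. i \<in> J \<Longrightarrow> d i = (if i = j then 1 else 0)"
  shows "(\<Sum>i\<in>J. c i * d i) = c j"
proof -
  have "(\<Sum>i\<in>J. c i * d i) = (\<Sum>i\<in>J. if i = j then c i else 0)"
    by (rule sum.cong) (auto simp: assms(3))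
  then show ?thesis using assms(1,2) by simp
qed

lemma orthonormal_expand:
  fixes G :: "'e::euclidean_space \<Rightarrow> 'e \<Rightarrow> real"
  assumes G: "inner_product G" and E: "orthonormal_basis G E"
  shows "v = (\<Sum>i\<in>Basis. G v (E i) *\<^sub>R E i)"
proof -
  note lin = bilinear_linear[OF inner_productD(1)[OF G]]
  have GE: "G (E i) (E j) = (if i = j then 1 else 0)" if "i \<in> Basis" "j \<in> Basis" for i j
    using E that by (simp add: orthonormal_basis_def)
  have inj: "inj_on E Basis"
    by (rule inj_onI) (metis GE zero_neq_one)
  have ind: "independent (E ` Basis)"
  proof (rule independent_if_scalars_zero)
    fix c x assume s: "(\<Sum>x\<in>E ` Basis. c x *\<^sub>R x) = 0" and x: "x \<in> E ` Basis"
    then obtain j where j: "j \<in> Basis" "x = E j" by auto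
    have "0 = G (\<Sum>i\<in>Basis. c (E i) *\<^sub>R E i) (E j)"
      using s linear_0[OF lin(2)[of "E j"]] by (simp add: sum.reindex[OF inj])
    also have "\<dots> = (\<Sum>i\<in>Basis. c (E i) * G (E i) (E j))"
      by (simp add: linear_sum[OF lin(2)] linear_scale[OF lin(2)])
    also have "\<dots> = c (E j)"
      by (rule sum_mult_delta) (use j GE in auto)
    finally show "c x = 0" using j by simp
  qed simp
  have "span (E ` Basis) = UNIV"
    using card_ge_dim_independent[of "E ` Basis" UNIV] ind card_image[OF inj] by auto
  then have "v \<in> span (E ` Basis)" by simp
  then obtain c where "v = (\<Sum>x\<in>E ` Basis. c x *\<^sub>R x)"
    by (auto simp: span_finite)
  then have c: "v = (\<Sum>i\<in>Basis. c (E i) *\<^sub>R E i)" by (simp add: sum.reindex[OF inj])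
  have "G v (E j) = c (E j)" if j: "j \<in> Basis" for j
  proof -
    have "G v (E j) = (\<Sum>i\<in>Basis. c (E i) * G (E i) (E j))"
      unfolding c by (simp add: linear_sum[OF lin(2)] linear_scale[OF lin(2)])
    also have "\<dots> = c (E j)"
      by (rule sum_mult_delta) (use j GE in auto)
    finally show ?thesis .
  qed
  then show ?thesis using c by simp
qed

text \<open>With \<open>E'\<^sub>i = \<Sum>\<^sub>k C\<^sub>i\<^sub>k E\<^sub>k\<close> the matrix \<open>C\<close> is orthogonal, so that \<open>\<Sum>\<^sub>i C\<^sub>i\<^sub>k C\<^sub>i\<^sub>l = \<delta>\<^sub>k\<^sub>l\<close>.\<close>

lemma orthonormal_sum_unique:
  fixes b :: "'e::euclidean_space \<Rightarrow> 'e \<Rightarrow> 'b::real_vector"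
  assumes G: "inner_product G" and E: "orthonormal_basis G E" and E': "orthonormal_basis G E'"
    and b: "\<And>x. linear (b x)" "\<And>y. linear (\<lambda>x. b x y)"
  shows "(\<Sum>i\<in>Basis. b (E' i) (E' i)) = (\<Sum>i\<in>Basis. b (E i) (E i))"
proof -
  let ?c = "\<lambda>i k. G (E' i) (E k)"
  note lin = bilinear_linear[OF inner_productD(1)[OF G]]
  have exp: "b (E' i) (E' i) = (\<Sum>k\<in>Basis. \<Sum>l\<in>Basis. (?c i k * ?c i l) *\<^sub>R b (E k) (E l))" for i
  proof -
    have "b (E' i) (E' i) = b (\<Sum>k\<in>Basis. ?c i k *\<^sub>R E k) (\<Sum>l\<in>Basis. ?c i l *\<^sub>R E l)"
      using orthonormal_expand[OF G E, of "E' i"] by simp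
    then show ?thesis
      by (simp add: linear_sum[OF b(2)] linear_sum[OF b(1)] linear_scale[OF b(2)] linear_scale[OF b(1)]
          scaleR_sum_right sum_distrib_left)
        (rule sum.swap[THEN trans], intro sum.cong refl, simp add: mult.commute)
  qed
  have orth: "(\<Sum>i\<in>Basis. ?c i k * ?c i l) = (if k = l then 1 else 0)" if "k \<in> Basis" "l \<in> Basis" for k l
  proof -
    have "G (E k) (E l) = G (\<Sum>i\<in>Basis. G (E k) (E' i) *\<^sub>R E' i) (E l)"
      using orthonormal_expand[OF G E', of "E k"] by simp
    also have "\<dots> = (\<Sum>i\<in>Basis. ?c i k * ?c i l)"
      by (simp add: linear_sum[OF lin(2)] linear_scale[OF lin(2)] inner_productD(2)[OF G, of "E k"])
    finally show ?thesis using E that by (simp add: orthonormal_basis_def)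
  qed
  have "(\<Sum>i\<in>Basis. b (E' i) (E' i))
      = (\<Sum>k\<in>Basis. \<Sum>l\<in>Basis. \<Sum>i\<in>Basis. (?c i k * ?c i l) *\<^sub>R b (E k) (E l))"
    unfolding exp by (subst sum.swap, rule sum.cong[OF refl], subst sum.swap, rule refl)
  also have "\<dots> = (\<Sum>k\<in>Basis. \<Sum>l\<in>Basis. (if k = l then 1 else 0) *\<^sub>R b (E k) (E l))"
    by (intro sum.cong refl) (simp only: orth scaleR_left.sum[symmetric])
  also have "\<dots> = (\<Sum>k\<in>Basis. b (E k) (E k))"
    by (intro sum.cong refl) (simp add: if_distrib[of "\<lambda>r. r *\<^sub>R _"] sum.delta cong: if_cong)
  finally show ?thesis .
qed

text \<open>The basis chosen inside \<open>metric_trace\<close> may therefore be replaced by any other orthonormal one.\<close>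

lemma metric_trace_eq:
  assumes G: "inner_product G" and E: "orthonormal_basis G E"
    and b: "\<And>x. linear (b x)" "\<And>y. linear (\<lambda>x. b x y)"
  shows "metric_trace G b = (\<Sum>i\<in>Basis. b (E i) (E i))"
  unfolding metric_trace_def Let_def
  by (rule orthonormal_sum_unique[OF G E _ b]) (rule someI[of "orthonormal_basis G", OF E])

text \<open>Gram-Schmidt, started from the constant standard basis.  Each step uses only sums, products, inverses and
square roots of positive smooth functions, so the frame is smooth wherever the metric is.\<close>

lemma smooth_orthonormal_frame:
  fixes G :: "'a::euclidean_space \<Rightarrow> 'e::euclidean_space \<Rightarrow> 'e \<Rightarrow> real"
  assumes S: "open S" and G: "bilinear_field S G" and ip: "\<And>x. x \<in> S \<Longrightarrow> inner_product (G x)"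
  shows "\<exists>E. (\<forall>i\<in>Basis. smooth_on S (\<lambda>x. E x i)) \<and> (\<forall>x\<in>S. orthonormal_basis (G x) (E x))"
proof -
  have "\<exists>E. (\<forall>i\<in>J. smooth_on S (\<lambda>x. E x i)) \<and>
      (\<forall>x\<in>S. (\<forall>i\<in>J. E x i \<in> span J) \<and>
        (\<forall>i\<in>J. \<forall>j\<in>J. G x (E x i) (E x j) = (if i = j then 1 else 0)))"
    if "finite J" "J \<subseteq> Basis" for J :: "'e set"
    using that
  proof (induction J rule: finite_induct)
    case empty
    then show ?case by simp
  next
    case (insert b J)
    then have "\<exists>E. (\<forall>i\<in>J. smooth_on S (\<lambda>x. E x i)) \<and>
      (\<forall>x\<in>S. (\<forall>i\<in>J. E x i \<in> span J) \<and>
        (\<forall>i\<in>J. \<forall>j\<in>J. G x (E x i) (E x j) = (if i = j then 1 else 0)))"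
      by simp
    then obtain E where E: "\<And>i. i \<in> J \<Longrightarrow> smooth_on S (\<lambda>x. E x i)"
      "\<And>x i. x \<in> S \<Longrightarrow> i \<in> J \<Longrightarrow> E x i \<in> span J"
      "\<And>x i j. x \<in> S \<Longrightarrow> i \<in> J \<Longrightarrow> j \<in> J \<Longrightarrow> G x (E x i) (E x j) = (if i = j then 1 else 0)"
      by (elim exE conjE) blast
    define w where "w x = b - (\<Sum>i\<in>J. G x b (E x i) *\<^sub>R E x i)" for x
    define e where "e x = inverse (sqrt (G x (w x) (w x))) *\<^sub>R w x" for x
    \<comment> \<open>The earlier vectors of the frame span the same space as the earlier basis vectors, hence \<open>w\<close> below never vanishes.\<close>
    have indep: "b \<notin> span J"
    proof -
      have "independent (insert b J)"
        using insert.prems independent_Basis independent_mono by blast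
      then show ?thesis using insert.hyps by (simp add: independent_insert)
    qed
    have sumJ: "(\<Sum>i\<in>J. G x b (E x i) *\<^sub>R E x i) \<in> span J" if "x \<in> S" for x
      using E(2) that by (intro span_sum span_scale) auto
    have w0: "w x \<noteq> 0" if "x \<in> S" for x
      using indep sumJ[OF that] by (auto simp: w_def)
    have Gw: "G x (w x) (w x) > 0" if "x \<in> S" for x
      using inner_productD(3)[OF ip[OF that] w0[OF that]] .
    have sw: "smooth_on S w"
      unfolding w_def
      by (intro smooth_on_diff[OF S] smooth_on_sum[OF S] smooth_on_scaleR[OF S]
          smooth_on_bilinear_field[OF S G] smooth_on_const[OF S] E(1) insert.hyps(1))
    have se: "smooth_on S e"
      unfolding e_def
      by (intro smooth_on_scaleR[OF S] smooth_on_inverse[OF S] smooth_on_sqrt[OF S]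
          smooth_on_bilinear_field[OF S G] sw Gw) (auto dest: Gw)
    have wE: "G x (w x) (E x j) = 0" if x: "x \<in> S" and j: "j \<in> J" for x j
    proof -
      note lin = bilinear_linear(2)[OF inner_productD(1)[OF ip[OF x]], of "E x j"]
      have "G x (w x) (E x j) = G x b (E x j) - (\<Sum>i\<in>J. G x b (E x i) * G x (E x i) (E x j))"
        unfolding w_def by (simp add: linear_diff[OF lin] linear_sum[OF lin] linear_scale[OF lin])
      also have "(\<Sum>i\<in>J. G x b (E x i) * G x (E x i) (E x j)) = G x b (E x j)"
        by (rule sum_mult_delta) (use E(3)[OF x _ j] j insert.hyps(1) in auto)
      finally show ?thesis by simp
    qed
    have eE: "G x (e x) (E x j) = 0" "G x (E x j) (e x) = 0" if x: "x \<in> S" and j: "j \<in> J" for x j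
      using wE[OF that] inner_productD(2)[OF ip[OF x], of "E x j"]
        bilinear_lmul[OF inner_productD(1)[OF ip[OF x]]] by (simp_all add: e_def)
    have ee: "G x (e x) (e x) = 1" if x: "x \<in> S" for x
      using Gw[OF x] bilinear_lmul[OF inner_productD(1)[OF ip[OF x]]]
        bilinear_rmul[OF inner_productD(1)[OF ip[OF x]]]
      by (simp add: e_def field_simps)
    have espan: "e x \<in> span (insert b J)" if "x \<in> S" for x
    proof -
      have "(\<Sum>i\<in>J. G x b (E x i) *\<^sub>R E x i) \<in> span (insert b J)"
        using sumJ[OF that] span_mono[of J "insert b J"] by auto
      then show ?thesis
        unfolding e_def w_def by (intro span_scale span_diff) (simp_all add: span_base)
    qed
    have Espan: "E x i \<in> span (insert b J)" if "x \<in> S" "i \<in> J" for x i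
      using E(2)[OF that] span_mono[of J "insert b J"] by auto
    have b: "b \<notin> J" by fact
    let ?E = "\<lambda>x i. if i = b then e x else E x i"
    have "smooth_on S (\<lambda>x. ?E x i)" if "i \<in> insert b J" for i
      using that se E(1)[of i] b by (cases "i = b") simp_all
    moreover have "?E x i \<in> span (insert b J)" if "x \<in> S" "i \<in> insert b J" for x i
      using that espan[of x] Espan[of x i] by (cases "i = b") simp_all
    moreover have "G x (?E x i) (?E x j) = (if i = j then 1 else 0)"
      if "x \<in> S" "i \<in> insert b J" "j \<in> insert b J" for x i j
      using that E(3)[of x i j] eE[of x] ee[of x] b by (cases "i = b"; cases "j = b") auto
    ultimately show ?case
      by (intro exI[of _ ?E] conjI ballI)
  qed
  from this[OF finite_Basis order_refl] show ?thesis
    by (auto simp: orthonormal_basis_def)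
qed

text \<open>The case of a metric that does not depend on the point.\<close>

lemma orthonormal_basis_exists:
  fixes G :: "'e::euclidean_space \<Rightarrow> 'e \<Rightarrow> real"
  assumes "inner_product G"
  shows "\<exists>E. orthonormal_basis G E"
  using smooth_orthonormal_frame[of "UNIV :: real set" "\<lambda>x. G"] assms
  by (auto simp: bilinear_field_def inner_productD smooth_on_const)

text \<open>Turns linear functionals into vectors; gradients and the normal Ricci operator are obtained in this
way.\<close>

lemma riesz_inner_product:
  fixes G :: "'e::euclidean_space \<Rightarrow> 'e \<Rightarrow> real"
  assumes G: "inner_product G" and L: "linear L"
  obtains w where "\<And>v. G w v = L v"
proof -
  obtain E where E: "orthonormal_basis G E" using orthonormal_basis_exists[OF G] by blast
  have "G (\<Sum>i\<in>Basis. L (E i) *\<^sub>R E i) v = L v" for v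
  proof -
    note lin = bilinear_linear(2)[OF inner_productD(1)[OF G], of v]
    have "L v = L (\<Sum>i\<in>Basis. G v (E i) *\<^sub>R E i)"
      using orthonormal_expand[OF G E, of v] by simp
    then show ?thesis
      by (simp add: linear_sum[OF lin] linear_scale[OF lin] linear_sum[OF L] linear_scale[OF L]
          inner_productD(2)[OF G, of v] mult.commute)
  qed
  then show ?thesis using that by blast
qed

lemma inner_product_pullback:
  assumes G: "inner_product G" and L: "linear L" and inj: "\<And>u. L u = 0 \<Longrightarrow> u = 0"
  shows "inner_product (\<lambda>u v. G (L u) (L v))"
  unfolding inner_product_def bilinear_def
  using linear_compose[OF L bilinear_linear(1)[OF inner_productD(1)[OF G]], unfolded o_def]
    linear_compose[OF L bilinear_linear(2)[OF inner_productD(1)[OF G]], unfolded o_def]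
    inner_productD(2,3)[OF G] inj by blast

lemma gradient_property:
  assumes G: "inner_product (g p)" and L: "linear (dfun A h p)"
  shows "g p (gradient A g h p) v = dfun A h p v"
proof -
  obtain w where w: "\<And>v. g p w v = dfun A h p v" using riesz_inner_product[OF G L] by blast
  have "gradient A g h p = w"
    unfolding gradient_def
    by (rule the_equality) (use w inner_product_eqI[OF G] in \<open>simp_all add: w\<close>)
  then show ?thesis using w by simp
qed


section \<open>The Levi-Civita connection along a map\<close>

text \<open>The pull-back along \<open>\<phi>\<close> of the connection with Christoffel symbols \<open>\<Gamma>\<close>, applied to a section \<open>\<xi>\<close> along
\<open>\<phi>\<close>.\<close>

definition cov :: "('d \<Rightarrow> 'd \<Rightarrow> 'd \<Rightarrow> 'd) \<Rightarrow> ('a \<Rightarrow> 'd) \<Rightarrow> 'a::euclidean_space \<Rightarrow> ('a \<Rightarrow> 'd::euclidean_space) \<Rightarrow> 'a \<Rightarrow> 'd"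
  where "cov \<Gamma> \<phi> u \<xi> x = pd u \<xi> x + \<Gamma> (\<phi> x) (pd u \<phi> x) (\<xi> x)"

text \<open>For \<open>\<phi> = id\<close> this is the connection itself, acting on vector fields of the target.\<close>

abbreviation nab :: "('d \<Rightarrow> 'd \<Rightarrow> 'd \<Rightarrow> 'd) \<Rightarrow> 'd::euclidean_space \<Rightarrow> ('d \<Rightarrow> 'd) \<Rightarrow> 'd \<Rightarrow> 'd"
  where "nab \<Gamma> \<equiv> cov \<Gamma> (\<lambda>y. y)"

lemma nab_eq: "nab \<Gamma> a W y = pd a W y + \<Gamma> y a (W y)"
  by (simp add: cov_def)

text \<open>The curvature \<open>R(a, b)z = \<nabla>\<^sub>b \<nabla>\<^sub>a z - \<nabla>\<^sub>a \<nabla>\<^sub>b z\<close>, computed for constant \<open>a\<close>, \<open>b\<close> and \<open>z\<close>, whose brackets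
vanish.\<close>

definition Riem :: "('d \<Rightarrow> 'd \<Rightarrow> 'd \<Rightarrow> 'd) \<Rightarrow> 'd \<Rightarrow> 'd::euclidean_space \<Rightarrow> 'd \<Rightarrow> 'd \<Rightarrow> 'd"
  where "Riem \<Gamma> y a b z = pd b (\<lambda>y. \<Gamma> y a z) y + \<Gamma> y b (\<Gamma> y a z)
    - (pd a (\<lambda>y. \<Gamma> y b z) y + \<Gamma> y a (\<Gamma> y b z))"

text \<open>The second covariant derivative \<open>\<nabla>\<^sub>a \<nabla>\<^sub>b W - \<nabla>\<^bsub>\<nabla>\<^sub>a b\<^esub> W\<close> for constant \<open>b\<close>, where \<open>\<nabla>\<^sub>a b = \<Gamma>(a, b)\<close>.\<close>

definition nab2 :: "('d \<Rightarrow> 'd \<Rightarrow> 'd \<Rightarrow> 'd) \<Rightarrow> 'd::euclidean_space \<Rightarrow> 'd \<Rightarrow> ('d \<Rightarrow> 'd) \<Rightarrow> 'd \<Rightarrow> 'd"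
  where "nab2 \<Gamma> a b W y = nab \<Gamma> a (nab \<Gamma> b W) y - nab \<Gamma> (\<Gamma> y a b) W y"

text \<open>A Riemannian metric \<open>G\<close> on \<open>T\<close> with its Christoffel symbols \<open>\<Gamma>\<close>, and a smooth map \<open>\<phi>\<close> into \<open>T\<close>.  The map is
arbitrary, so that every identity along \<open>\<phi>\<close> also gives, for \<open>\<phi> = id\<close>, the corresponding identity for
vector fields on \<open>T\<close> (\<open>nab_levi_civita\<close> below).\<close>

locale levi_civita_along =
  fixes S :: "'a::euclidean_space set" and T :: "'d::euclidean_space set"
    and \<phi> :: "'a \<Rightarrow> 'd" and G :: "'d \<Rightarrow> 'd \<Rightarrow> 'd \<Rightarrow> real" and \<Gamma> :: "'d \<Rightarrow> 'd \<Rightarrow> 'd \<Rightarrow> 'd"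
  assumes open_S: "open S" and open_T: "open T"
    and map_in: "\<And>x. x \<in> S \<Longrightarrow> \<phi> x \<in> T" and map_smooth: "smooth_on S \<phi>"
    and G_field: "bilinear_field T G" and G_inner: "\<And>y. y \<in> T \<Longrightarrow> inner_product (G y)"
    and \<Gamma>_field: "bilinear_field T \<Gamma>" and \<Gamma>_sym: "\<And>y a b. y \<in> T \<Longrightarrow> \<Gamma> y a b = \<Gamma> y b a"
    and compat: "\<And>y w a b. y \<in> T \<Longrightarrow>
      pd w (\<lambda>y. G y a b) y = G y (\<Gamma> y w a) b + G y a (\<Gamma> y w b)"
begin

abbreviation D where "D \<equiv> cov \<Gamma> \<phi>"

lemma G_bil: "y \<in> T \<Longrightarrow> bilinear (G y)" and \<Gamma>_bil: "y \<in> T \<Longrightarrow> bilinear (\<Gamma> y)"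
  using G_field \<Gamma>_field by (simp_all add: bilinear_field_def)

lemma G_sym: "y \<in> T \<Longrightarrow> G y a b = G y b a"
  using inner_productD(2)[OF G_inner] .

lemmas G_lin = G_bil[THEN bilinear_ladd] G_bil[THEN bilinear_radd] G_bil[THEN bilinear_lsub]
  G_bil[THEN bilinear_rsub] G_bil[THEN bilinear_lneg] G_bil[THEN bilinear_rneg]
  G_bil[THEN bilinear_lmul] G_bil[THEN bilinear_rmul]

lemmas \<Gamma>_lin = \<Gamma>_bil[THEN bilinear_ladd] \<Gamma>_bil[THEN bilinear_radd] \<Gamma>_bil[THEN bilinear_lsub]
  \<Gamma>_bil[THEN bilinear_rsub] \<Gamma>_bil[THEN bilinear_lneg] \<Gamma>_bil[THEN bilinear_rneg]
  \<Gamma>_bil[THEN bilinear_lmul] \<Gamma>_bil[THEN bilinear_rmul]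

lemma G_along: "bilinear_field S (\<lambda>x. G (\<phi> x))" and \<Gamma>_along: "bilinear_field S (\<lambda>x. \<Gamma> (\<phi> x))"
  by (rule bilinear_field_compose[OF open_S open_T map_smooth map_in], simp_all add: G_field \<Gamma>_field)+

lemma smooth_on_G: "smooth_on S \<xi> \<Longrightarrow> smooth_on S \<zeta> \<Longrightarrow> smooth_on S (\<lambda>x. G (\<phi> x) (\<xi> x) (\<zeta> x))"
  by (rule smooth_on_bilinear_field[OF open_S G_along])

lemma smooth_on_cov: "smooth_on S \<xi> \<Longrightarrow> smooth_on S (D u \<xi>)"
  unfolding cov_def[abs_def]
  by (intro smooth_on_add[OF open_S] smooth_on_bilinear_field[OF open_S \<Gamma>_along] smooth_on_pd map_smooth)

lemma pd_map_linear: "x \<in> S \<Longrightarrow> linear (\<lambda>u. pd u \<phi> x)"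
  by (rule smooth_on_linear_pd[OF open_S map_smooth])

lemma cov_linear:
  assumes "smooth_on S \<xi>" "x \<in> S"
  shows "linear (\<lambda>u. D u \<xi> x)"
  unfolding cov_def
  using linear_compose[OF pd_map_linear[OF assms(2)] bilinear_linear(2)[OF \<Gamma>_bil[OF map_in[OF assms(2)]], of "\<xi> x"]]
  by (intro linear_compose_add smooth_on_linear_pd[OF open_S assms]) (simp add: o_def)

lemma pd_pull:
  assumes "smooth_on T h" "x \<in> S"
  shows "pd u (\<lambda>x. h (\<phi> x)) x = pd (pd u \<phi> x) h (\<phi> x)"
  by (rule pd_compose[OF open_S open_T assms(1) map_smooth assms(2) map_in[OF assms(2)]])

lemma metric_deriv:
  assumes "smooth_on S \<xi>" "smooth_on S \<zeta>" "x \<in> S"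
  shows "pd u (\<lambda>x. G (\<phi> x) (\<xi> x) (\<zeta> x)) x
    = G (\<phi> x) (D u \<xi> x) (\<zeta> x) + G (\<phi> x) (\<xi> x) (D u \<zeta> x)"
proof -
  have T: "\<phi> x \<in> T" using map_in assms by blast
  have "pd u (\<lambda>y. G (\<phi> y) (\<xi> x) (\<zeta> x)) x = pd (pd u \<phi> x) (\<lambda>y. G y (\<xi> x) (\<zeta> x)) (\<phi> x)"
    by (rule pd_pull) (use G_field assms in \<open>auto simp: bilinear_field_def\<close>)
  then show ?thesis
    using pd_bilinear_field[OF open_S assms(3) G_along assms(1,2), of u] compat[OF T] G_lin[OF T]
    by (simp add: cov_def)
qed

text \<open>The symmetry of second derivatives and of the Christoffel symbols.\<close>

lemma torsion_free: "x \<in> S \<Longrightarrow> D u (pd v \<phi>) x = D v (pd u \<phi>) x"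
  using pd_commute[OF open_S map_smooth, of x u v] \<Gamma>_sym[OF map_in, of x "pd u \<phi> x"]
  by (simp add: cov_def)

lemma cov_cong:
  assumes "x \<in> S" "\<And>y. y \<in> S \<Longrightarrow> \<xi> y = \<zeta> y"
  shows "D u \<xi> x = D u \<zeta> x"
  using pd_cong_open[OF open_S assms(1), of \<xi> \<zeta>] assms by (simp add: cov_def)

lemma cov_cov:
  assumes \<xi>: "smooth_on S \<xi>" and x: "x \<in> S"
  shows "D u (D v \<xi>) x = pd u (pd v \<xi>) x
    + pd (pd u \<phi> x) (\<lambda>y. \<Gamma> y (pd v \<phi> x) (\<xi> x)) (\<phi> x)
    + \<Gamma> (\<phi> x) (pd u (pd v \<phi>) x) (\<xi> x) + \<Gamma> (\<phi> x) (pd v \<phi> x) (pd u \<xi> x)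
    + \<Gamma> (\<phi> x) (pd u \<phi> x) (pd v \<xi> x) + \<Gamma> (\<phi> x) (pd u \<phi> x) (\<Gamma> (\<phi> x) (pd v \<phi> x) (\<xi> x))"
proof -
  have T: "\<phi> x \<in> T" using map_in x by blast
  have v: "smooth_on S (pd v \<phi>)" by (rule smooth_on_pd[OF map_smooth])
  have "pd u (\<lambda>z. \<Gamma> (\<phi> z) (pd v \<phi> z) (\<xi> z)) x
    = pd u (\<lambda>z. \<Gamma> (\<phi> z) (pd v \<phi> x) (\<xi> x)) x
      + \<Gamma> (\<phi> x) (pd u (pd v \<phi>) x) (\<xi> x) + \<Gamma> (\<phi> x) (pd v \<phi> x) (pd u \<xi> x)"
    by (rule pd_bilinear_field[OF open_S x \<Gamma>_along v \<xi>])
  moreover have "pd u (\<lambda>z. \<Gamma> (\<phi> z) (pd v \<phi> x) (\<xi> x)) x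
      = pd (pd u \<phi> x) (\<lambda>y. \<Gamma> y (pd v \<phi> x) (\<xi> x)) (\<phi> x)"
    by (rule pd_pull) (use \<Gamma>_field x in \<open>auto simp: bilinear_field_def\<close>)
  moreover have "pd u (\<lambda>z. pd v \<xi> z + \<Gamma> (\<phi> z) (pd v \<phi> z) (\<xi> z)) x
      = pd u (pd v \<xi>) x + pd u (\<lambda>z. \<Gamma> (\<phi> z) (pd v \<phi> z) (\<xi> z)) x"
    by (rule pd_eqI[OF has_derivative_add]; rule smooth_on_has_derivative[OF open_S _ x])
       (intro smooth_on_pd \<xi> smooth_on_bilinear_field[OF open_S \<Gamma>_along] v)+
  ultimately show ?thesis
    unfolding cov_def by (simp add: \<Gamma>_lin[OF T])
qed

text \<open>In the expansion of \<open>cov_cov\<close> all terms except those of the curvature are symmetric in \<open>u\<close> and \<open>v\<close>.\<close>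

lemma cov_commute:
  assumes \<xi>: "smooth_on S \<xi>" and x: "x \<in> S"
  shows "D u (D v \<xi>) x - D v (D u \<xi>) x
    = - Riem \<Gamma> (\<phi> x) (pd u \<phi> x) (pd v \<phi> x) (\<xi> x)"
  unfolding cov_cov[OF assms] Riem_def
  using pd_commute[OF open_S \<xi> x, of u v] pd_commute[OF open_S map_smooth x, of u v] by simp

lemma second_metric_deriv:
  assumes "smooth_on S \<xi>" "smooth_on S \<zeta>" "x \<in> S"
  shows "pd u (pd v (\<lambda>x. G (\<phi> x) (\<xi> x) (\<zeta> x))) x
    = G (\<phi> x) (D u (D v \<xi>) x) (\<zeta> x) + G (\<phi> x) (D v \<xi> x) (D u \<zeta> x)
      + G (\<phi> x) (D u \<xi> x) (D v \<zeta> x) + G (\<phi> x) (\<xi> x) (D u (D v \<zeta>) x)"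
proof -
  note sm = assms(1,2) smooth_on_cov[OF assms(1)] smooth_on_cov[OF assms(2)]
  have "pd u (pd v (\<lambda>x. G (\<phi> x) (\<xi> x) (\<zeta> x))) x
    = pd u (\<lambda>x. G (\<phi> x) (D v \<xi> x) (\<zeta> x) + G (\<phi> x) (\<xi> x) (D v \<zeta> x)) x"
    by (rule pd_cong_open[OF open_S assms(3)]) (rule metric_deriv[OF assms(1,2)])
  also have "\<dots> = pd u (\<lambda>x. G (\<phi> x) (D v \<xi> x) (\<zeta> x)) x
      + pd u (\<lambda>x. G (\<phi> x) (\<xi> x) (D v \<zeta> x)) x"
    by (rule pd_eqI[OF has_derivative_add]; rule smooth_on_has_derivative[OF open_S _ assms(3)])
       (intro smooth_on_G sm)+
  finally show ?thesis
    using metric_deriv[OF sm(3,2) assms(3)] metric_deriv[OF sm(1,4) assms(3)] by simp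
qed

lemma nab_levi_civita: "levi_civita_along T T (\<lambda>y. y) G \<Gamma>"
  by unfold_locales
    (auto simp: open_T smooth_on_ident G_field G_inner \<Gamma>_field compat intro: \<Gamma>_sym)

text \<open>The second derivatives of \<open>G(c, d)\<close> for constant \<open>c\<close> and \<open>d\<close> commute.  Expressed through covariant
derivatives, their difference is \<open>- G(R(a, b)c, d) - G(c, R(a, b)d)\<close>.\<close>

lemma Riem_skew_last:
  assumes y: "y \<in> T"
  shows "G y (Riem \<Gamma> y a b c) d = - G y (Riem \<Gamma> y a b d) c"
proof -
  interpret N: levi_civita_along T T "\<lambda>y. y" G \<Gamma> by (rule nab_levi_civita)
  note c = smooth_on_const[OF open_T]
  have "smooth_on T (\<lambda>y. G y c d)" using G_field by (simp add: bilinear_field_def)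
  from pd_commute[OF open_T this y, of a b]
  have "G y (nab \<Gamma> a (nab \<Gamma> b (\<lambda>_. c)) y - nab \<Gamma> b (nab \<Gamma> a (\<lambda>_. c)) y) d
      + G y c (nab \<Gamma> a (nab \<Gamma> b (\<lambda>_. d)) y - nab \<Gamma> b (nab \<Gamma> a (\<lambda>_. d)) y) = 0"
    using N.second_metric_deriv[OF c c y, of c d a b] N.second_metric_deriv[OF c c y, of c d b a]
    by (simp add: G_lin[OF y])
  then have "G y (Riem \<Gamma> y a b c) d + G y c (Riem \<Gamma> y a b d) = 0"
    unfolding N.cov_commute[OF c y, of a b c] N.cov_commute[OF c y, of a b d] by (simp add: G_lin[OF y])
  then show ?thesis using G_sym[OF y, of c] by simp
qed

lemma Riem_skew_first: "Riem \<Gamma> y a b c = - Riem \<Gamma> y b a c"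
  by (simp add: Riem_def)

text \<open>The derivatives of \<open>\<Gamma>\<close> and the products \<open>\<Gamma>\<Gamma>\<close> cancel cyclically because \<open>\<Gamma>\<close> is symmetric.\<close>

lemma Riem_bianchi:
  assumes y: "y \<in> T"
  shows "Riem \<Gamma> y a b c + Riem \<Gamma> y b c a + Riem \<Gamma> y c a b = 0"
proof -
  have "pd w (\<lambda>y. \<Gamma> y u v) y = pd w (\<lambda>y. \<Gamma> y v u) y" for u v w
    by (rule pd_cong_open[OF open_T y]) (rule \<Gamma>_sym)
  from this[of a b c] this[of a c b] this[of b c a] show ?thesis
    using \<Gamma>_sym[OF y, of a b] \<Gamma>_sym[OF y, of c a] \<Gamma>_sym[OF y, of b c]
    by (simp add: Riem_def)
qed

text \<open>The classical octahedron argument: a combination of the four Bianchi identities obtained by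
rotating \<open>a\<close>, \<open>b\<close>, \<open>c\<close>, \<open>d\<close>, with both skew symmetries.\<close>

lemma Riem_pair:
  assumes y: "y \<in> T"
  shows "G y (Riem \<Gamma> y a b c) d = G y (Riem \<Gamma> y c d a) b"
proof -
  define r where "r a b c d = G y (Riem \<Gamma> y a b c) d" for a b c d
  have 1: "r a b c d = - r b a c d" for a b c d
    unfolding r_def by (subst Riem_skew_first) (simp add: G_lin[OF y])
  have 2: "r a b c d = - r a b d c" for a b c d
    unfolding r_def by (rule Riem_skew_last[OF y])
  have 3: "r a b c d + r b c a d + r c a b d = 0" for a b c d
  proof -
    have "r a b c d + r b c a d + r c a b d = G y (Riem \<Gamma> y a b c + Riem \<Gamma> y b c a + Riem \<Gamma> y c a b) d"
      by (simp add: r_def G_lin[OF y])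
    then show ?thesis using Riem_bianchi[OF y] bilinear_lzero[OF G_bil[OF y]] by simp
  qed
  have "r a b c d = r c d a b"
    using 3[of a b c d] 3[of b c d a] 3[of c d a b] 3[of d a b c]
      1[of a b c d] 1[of a b d c] 1[of b c a d] 1[of b c d a] 1[of c a b d] 1[of c a d b]
      1[of c d a b] 1[of c d b a] 1[of d a b c] 1[of d a c b] 1[of d b c a] 1[of d b a c]
      2[of a b c d] 2[of b a c d] 2[of b c a d] 2[of c b a d] 2[of c a b d] 2[of a c b d]
      2[of c d a b] 2[of d c a b] 2[of d a b c] 2[of a d b c] 2[of d b c a] 2[of b d c a]
    by linarith
  then show ?thesis by (simp add: r_def)
qed

lemma Riem_linear_last:
  assumes y: "y \<in> T"
  shows "linear (Riem \<Gamma> y a b)"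
proof -
  interpret N: levi_civita_along T T "\<lambda>y. y" G \<Gamma> by (rule nab_levi_civita)
  have L: "linear (\<lambda>z. pd w (\<lambda>y. \<Gamma> y u z) y)" for u w
  proof -
    have pd_lin: "pd w (\<lambda>y. \<Gamma> y u (c *\<^sub>R z + z')) y = c *\<^sub>R pd w (\<lambda>y. \<Gamma> y u z) y + pd w (\<lambda>y. \<Gamma> y u z') y"
      for c z z'
    proof -
      have sm: "smooth_on T (\<lambda>y. \<Gamma> y u z)" for z using \<Gamma>_field by (simp add: bilinear_field_def)
      have "pd w (\<lambda>y. \<Gamma> y u (c *\<^sub>R z + z')) y = pd w (\<lambda>y. c *\<^sub>R \<Gamma> y u z + \<Gamma> y u z') y"
        by (rule pd_cong_open[OF open_T y]) (simp add: \<Gamma>_lin)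
      also have "\<dots> = c *\<^sub>R pd w (\<lambda>y. \<Gamma> y u z) y + pd w (\<lambda>y. \<Gamma> y u z') y"
        by (rule pd_eqI[OF has_derivative_add[OF has_derivative_scaleR_right]];
            rule smooth_on_has_derivative[OF open_T sm y])
      finally show ?thesis .
    qed
    show ?thesis
    proof (rule linearI)
      show add: "pd w (\<lambda>y. \<Gamma> y u (b1 + b2)) y = pd w (\<lambda>y. \<Gamma> y u b1) y + pd w (\<lambda>y. \<Gamma> y u b2) y" for b1 b2
        using pd_lin[of 1 b1 b2] by simp
      show "pd w (\<lambda>y. \<Gamma> y u (r *\<^sub>R b)) y = r *\<^sub>R pd w (\<lambda>y. \<Gamma> y u b) y" for r b
        using pd_lin[of r b 0] add[of 0 0] by simp
    qed
  qed
  show ?thesis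
    unfolding Riem_def
    by (intro linear_compose_sub linear_compose_add L
        linear_compose[OF bilinear_linear(1)[OF \<Gamma>_bil[OF y]] bilinear_linear(1)[OF \<Gamma>_bil[OF y]], unfolded o_def])
qed


definition first_form :: "'a \<Rightarrow> 'a \<Rightarrow> 'a \<Rightarrow> real" where
  "first_form x a b = G (\<phi> x) (pd a \<phi> x) (pd b \<phi> x)"

lemma cov_field_direction:
  assumes Z: "smooth_on T Z" and X: "smooth_on T X" and y: "y \<in> T"
  shows "nab \<Gamma> b (\<lambda>y. nab \<Gamma> (X y) Z y) y = nab \<Gamma> b (nab \<Gamma> (X y) Z) y + nab \<Gamma> (pd b X y) Z y"
proof -
  interpret N: levi_civita_along T T "\<lambda>y. y" G \<Gamma> by (rule nab_levi_civita)
  have "pd b (\<lambda>z. nab \<Gamma> (X z) Z z) y = pd b (\<lambda>z. nab \<Gamma> (X y) Z z) y + nab \<Gamma> (pd b X y) Z y"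
    by (rule pd_linear_field[OF open_T y, where L="\<lambda>z a. nab \<Gamma> a Z z"])
       (intro N.cov_linear Z N.smooth_on_cov X | assumption)+
  then show ?thesis by (simp add: cov_def[of \<Gamma> "\<lambda>y. y" b])
qed

text \<open>The curvature as it is defined for vector fields.  All derivatives of \<open>X\<close> and \<open>Y\<close> cancel against the bracket
term, so the value depends on the vectors at \<open>y\<close> only.\<close>

lemma Riem_fields:
  assumes Z: "smooth_on T Z" and X: "smooth_on T X" and Y: "smooth_on T Y" and y: "y \<in> T"
  shows "nab \<Gamma> (Y y) (\<lambda>y. nab \<Gamma> (X y) Z y) y - nab \<Gamma> (X y) (\<lambda>y. nab \<Gamma> (Y y) Z y) y
    + nab \<Gamma> (pd (X y) Y y - pd (Y y) X y) Z y = Riem \<Gamma> y (X y) (Y y) (Z y)"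
proof -
  interpret N: levi_civita_along T T "\<lambda>y. y" G \<Gamma> by (rule nab_levi_civita)
  show ?thesis
    unfolding cov_field_direction[OF Z X y] cov_field_direction[OF Z Y y]
      linear_diff[OF N.cov_linear[OF Z y]]
    using N.cov_commute[OF Z y, of "X y" "Y y"] by (simp add: algebra_simps)
qed

text \<open>The argument by which a metric has only one torsion-free compatible connection.  If \<open>\<gamma>\<close> is symmetric
and compatible with the first fundamental form at \<open>x\<close>, then the defect \<open>k w a b\<close> below is symmetric in
\<open>w\<close>, \<open>a\<close> and skew in \<open>a\<close>, \<open>b\<close>, hence zero.  So the connection of the source is the tangential part of the
one along \<open>\<phi>\<close>.\<close>

lemma gauss_formula:
  assumes x: "x \<in> S" and sym: "\<And>a b. \<gamma> a b = \<gamma> b a"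
    and compat\<gamma>: "\<And>w a b. pd w (\<lambda>x. G (\<phi> x) (pd a \<phi> x) (pd b \<phi> x)) x
      = G (\<phi> x) (pd (\<gamma> w a) \<phi> x) (pd b \<phi> x) + G (\<phi> x) (pd a \<phi> x) (pd (\<gamma> w b) \<phi> x)"
  shows "G (\<phi> x) (D w (pd a \<phi>) x - pd (\<gamma> w a) \<phi> x) (pd b \<phi> x) = 0"
proof -
  note T = map_in[OF x]
  define k where "k w a b = G (\<phi> x) (D w (pd a \<phi>) x - pd (\<gamma> w a) \<phi> x) (pd b \<phi> x)" for w a b
  have 1: "k w a b = - k w b a" for w a b
    using compat\<gamma>[where w=w and a=a and b=b]
      metric_deriv[OF smooth_on_pd[OF map_smooth] smooth_on_pd[OF map_smooth] x, of a b w] G_sym[OF T, of "pd a \<phi> x"]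
    by (simp add: k_def G_lin[OF T])
  have 2: "k w a b = k a w b" for w a b
    using torsion_free[OF x, of w a] sym[of w a] by (simp add: k_def)
  have "k w a b = 0"
    using 1[of w a b] 2[of w b a] 1[of b w a] 2[of b a w] 1[of a b w] 2[of a w b] by linarith
  then show ?thesis by (simp add: k_def)
qed

lemma cov_pull:
  assumes "smooth_on T V" "x \<in> S"
  shows "D u (\<lambda>x. V (\<phi> x)) x = nab \<Gamma> (pd u \<phi> x) V (\<phi> x)"
  using pd_pull[OF assms] by (simp add: cov_def)

lemma smooth_on_pull: "smooth_on T V \<Longrightarrow> smooth_on S (\<lambda>x. V (\<phi> x))"
  by (rule smooth_on_compose[OF open_S open_T _ map_smooth map_in])

text \<open>The Hessian of a vector field \<open>V\<close> of the target, restricted to \<open>\<phi>\<close>: besides \<open>\<nabla>\<^sup>2V\<close> there is a term from the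
second derivative of \<open>\<phi>\<close>.\<close>

lemma cov_cov_pull:
  assumes V: "smooth_on T V" and x: "x \<in> S"
  shows "D u (D v (\<lambda>x. V (\<phi> x))) x
    = nab2 \<Gamma> (pd u \<phi> x) (pd v \<phi> x) V (\<phi> x) + nab \<Gamma> (D u (pd v \<phi>) x) V (\<phi> x)"
proof -
  interpret N: levi_civita_along T T "\<lambda>y. y" G \<Gamma> by (rule nab_levi_civita)
  let ?L = "\<lambda>z a. nab \<Gamma> a V (\<phi> z)"
  have "D u (D v (\<lambda>x. V (\<phi> x))) x = D u (\<lambda>z. ?L z (pd v \<phi> z)) x"
    by (rule cov_cong[OF x]) (rule cov_pull[OF V])
  also have "\<dots> = pd u (\<lambda>z. ?L z (pd v \<phi> z)) x + \<Gamma> (\<phi> x) (pd u \<phi> x) (?L x (pd v \<phi> x))"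
    by (rule cov_def)
  also have "pd u (\<lambda>z. ?L z (pd v \<phi> z)) x
      = pd u (\<lambda>z. ?L z (pd v \<phi> x)) x + ?L x (pd u (pd v \<phi>) x)"
    by (rule pd_linear_field[OF open_S x, where L="?L"])
       (intro N.cov_linear[OF V map_in] smooth_on_pull N.smooth_on_cov V smooth_on_pd map_smooth | assumption)+
  also have "pd u (\<lambda>z. ?L z (pd v \<phi> x)) x = pd (pd u \<phi> x) (nab \<Gamma> (pd v \<phi> x) V) (\<phi> x)"
    by (rule pd_pull[OF N.smooth_on_cov[OF V] x])
  finally have "D u (D v (\<lambda>x. V (\<phi> x))) x
    = nab \<Gamma> (pd u \<phi> x) (nab \<Gamma> (pd v \<phi> x) V) (\<phi> x) + ?L x (pd u (pd v \<phi>) x)"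
    by (simp add: nab_eq)
  then show ?thesis
    by (simp add: nab2_def cov_def[of \<Gamma> \<phi> u "pd v \<phi>"] linear_add[OF N.cov_linear[OF V map_in[OF x]]])
qed


section \<open>Killing fields\<close>

text \<open>The Killing equation: \<open>\<nabla>V\<close> is skew.\<close>

definition killing :: "('d \<Rightarrow> 'd) \<Rightarrow> bool" where
  "killing V \<longleftrightarrow> smooth_on T V \<and>
    (\<forall>y\<in>T. \<forall>a b. G y (nab \<Gamma> a V y) b + G y a (nab \<Gamma> b V y) = 0)"

text \<open>The derivative in direction \<open>a\<close> of the Killing equation for constant \<open>b\<close> and \<open>c\<close>.\<close>

lemma nab2_skew:
  assumes V: "killing V" and y: "y \<in> T"
  shows "G y (nab2 \<Gamma> a b V y) c = - G y (nab2 \<Gamma> a c V y) b"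
proof -
  interpret N: levi_civita_along T T "\<lambda>y. y" G \<Gamma> by (rule nab_levi_civita)
  note c = smooth_on_const[OF open_T]
  have sV: "smooth_on T V" and
    kill: "\<And>y a b. y \<in> T \<Longrightarrow> G y (nab \<Gamma> a V y) b = - G y a (nab \<Gamma> b V y)"
    using V by (auto simp: killing_def eq_neg_iff_add_eq_0)
  have s: "smooth_on T (nab \<Gamma> b V)" for b by (rule N.smooth_on_cov[OF sV])
  have "pd a (\<lambda>y. G y (nab \<Gamma> b V y) c) y = pd a (\<lambda>y. - G y b (nab \<Gamma> c V y)) y"
    by (rule pd_cong_open[OF open_T y]) (rule kill)
  also have "\<dots> = - pd a (\<lambda>y. G y b (nab \<Gamma> c V y)) y"
    by (rule pd_eqI[OF has_derivative_minus], rule smooth_on_has_derivative[OF open_T N.smooth_on_G[OF c s] y])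
  finally have "G y (nab \<Gamma> a (nab \<Gamma> b V) y) c + G y (nab \<Gamma> b V y) (\<Gamma> y a c)
      = - (G y (\<Gamma> y a b) (nab \<Gamma> c V y) + G y b (nab \<Gamma> a (nab \<Gamma> c V) y))"
    using N.metric_deriv[OF s c y, of b c a] N.metric_deriv[OF c s y, of b c a]
    by (simp add: nab_eq[of _ _ "\<lambda>_. _"])
  then show ?thesis
    using kill[OF y, of b "\<Gamma> y a c"] kill[OF y, of "\<Gamma> y a b" c] G_sym[OF y, of b]
    by (simp add: nab2_def G_lin[OF y])
qed

text \<open>\<open>\<langle>\<nabla>\<^sup>2V(a, a), c\<rangle> = - \<langle>\<nabla>\<^sup>2V(a, c), a\<rangle>\<close> by skewness.  Exchanging \<open>a\<close> and \<open>c\<close> in the second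
derivative costs a curvature and leaves \<open>\<langle>\<nabla>\<^sup>2V(c, a), a\<rangle>\<close>, which is zero, again by skewness.\<close>

lemma nab2_diagonal:
  assumes V: "killing V" and y: "y \<in> T"
  shows "G y (nab2 \<Gamma> a a V y) c = - G y (Riem \<Gamma> y c a (V y)) a"
proof -
  interpret N: levi_civita_along T T "\<lambda>y. y" G \<Gamma> by (rule nab_levi_civita)
  have sV: "smooth_on T V" using V by (simp add: killing_def)
  have "nab2 \<Gamma> a c V y = nab2 \<Gamma> c a V y - Riem \<Gamma> y a c (V y)"
    using N.cov_commute[OF sV y, of a c] \<Gamma>_sym[OF y, of a c] by (simp add: nab2_def algebra_simps)
  moreover have "G y (nab2 \<Gamma> c a V y) a = 0"
    using nab2_skew[OF V y, of c a a] by simp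
  ultimately show ?thesis
    using nab2_skew[OF V y, of a a c] Riem_skew_first[of y a c "V y"] by (simp add: G_lin[OF y])
qed

end


section \<open>The Laplacian of the support function in coordinates\<close>

lemma sum_sym_skew:
  fixes a b :: "'i \<Rightarrow> 'i \<Rightarrow> real"
  assumes "\<And>i j. i \<in> I \<Longrightarrow> j \<in> I \<Longrightarrow> a i j = a j i" "\<And>i j. i \<in> I \<Longrightarrow> j \<in> I \<Longrightarrow> b i j = - b j i"
  shows "(\<Sum>i\<in>I. \<Sum>j\<in>I. a i j * b i j) = 0"
proof -
  have "(\<Sum>i\<in>I. \<Sum>j\<in>I. a i j * b i j) = (\<Sum>i\<in>I. \<Sum>j\<in>I. a j i * b j i)"
    by (rule sum.swap)
  also have "\<dots> = (\<Sum>i\<in>I. \<Sum>j\<in>I. - (a i j * b i j))"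
  proof (intro sum.cong refl)
    fix i j assume ij: "i \<in> I" "j \<in> I"
    show "a j i * b j i = - (a i j * b i j)"
      using assms(1)[OF ij] assms(2)[OF ij] by simp
  qed
  finally show ?thesis by (simp add: sum_negf)
qed

text \<open>\<open>\<eta>\<close> is a normal section along the immersion \<open>\<phi>\<close>, parallel in the normal connection; in the last assumption
\<open>s\<close> is minus the shape operator of \<open>\<eta>\<close> applied to \<open>u\<close>.\<close>

locale parallel_section = levi_civita_along S T \<phi> G \<Gamma>
  for S :: "'a::euclidean_space set" and T :: "'d::euclidean_space set"
    and \<phi> :: "'a \<Rightarrow> 'd" and G :: "'d \<Rightarrow> 'd \<Rightarrow> 'd \<Rightarrow> real" and \<Gamma> :: "'d \<Rightarrow> 'd \<Rightarrow> 'd \<Rightarrow> 'd" +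
  fixes \<eta> :: "'a \<Rightarrow> 'd"
  assumes immersed: "\<And>x u. x \<in> S \<Longrightarrow> pd u \<phi> x = 0 \<Longrightarrow> u = 0"
    and \<eta>_smooth: "smooth_on S \<eta>"
    and \<eta>_normal: "\<And>x u. x \<in> S \<Longrightarrow> G (\<phi> x) (\<eta> x) (pd u \<phi> x) = 0"
    and \<eta>_parallel: "\<And>x u. x \<in> S \<Longrightarrow> \<exists>s. D u \<eta> x = pd s \<phi> x"
begin

lemma first_form_inner:
  assumes x: "x \<in> S" shows "inner_product (first_form x)"
proof -
  note T = map_in[OF x]
  note lin = linear_compose[OF pd_map_linear[OF x] bilinear_linear(1)[OF G_bil[OF T]], unfolded o_def]
    linear_compose[OF pd_map_linear[OF x] bilinear_linear(2)[OF G_bil[OF T]], unfolded o_def]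
  show ?thesis
    unfolding inner_product_def first_form_def[abs_def] bilinear_def
    using lin G_sym[OF T] immersed[OF x] inner_productD(3)[OF G_inner[OF T]] by blast
qed

text \<open>Differentiating \<open>G(\<eta>, \<phi>\<^sub>w) = 0\<close> turns the left side into \<open>- G(\<eta>, D\<^sub>v \<phi>\<^sub>w)\<close>, which is symmetric as \<open>D\<close> has no
torsion.\<close>

lemma shape_sym:
  assumes x: "x \<in> S"
  shows "G (\<phi> x) (D v \<eta> x) (pd w \<phi> x) = G (\<phi> x) (D w \<eta> x) (pd v \<phi> x)"
proof -
  have "G (\<phi> x) (D v \<eta> x) (pd w \<phi> x) = - G (\<phi> x) (\<eta> x) (D v (pd w \<phi>) x)" for v w
  proof -
    have "pd v (\<lambda>x. G (\<phi> x) (\<eta> x) (pd w \<phi> x)) x = pd v (\<lambda>x. 0) x"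
      by (rule pd_cong_open[OF open_S x]) (rule \<eta>_normal)
    then show ?thesis
      using metric_deriv[OF \<eta>_smooth smooth_on_pd[OF map_smooth] x, of w v] by simp
  qed
  then show ?thesis using torsion_free[OF x] by simp
qed

lemma normal_orthogonal_cov:
  assumes "x \<in> S" "\<And>u. G (\<phi> x) \<nu> (pd u \<phi> x) = 0"
  shows "G (\<phi> x) (D v \<eta> x) \<nu> = 0"
  using \<eta>_parallel[OF assms(1), of v] assms(2) G_sym[OF map_in[OF assms(1)], of \<nu>] by metis

text \<open>The derivative of \<open>shape_sym\<close>.  Its two sides are \<open>\<langle>D\<^sup>2\<eta>(u, v), \<phi>\<^sub>w\<rangle>\<close> and \<open>\<langle>D\<^sup>2\<eta>(u, w), \<phi>\<^sub>v\<rangle>\<close>, where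
\<open>D\<^sup>2\<eta>(u, v) = D\<^sub>u D\<^sub>v \<eta> - D\<^sub>z \<eta>\<close> and \<open>\<phi>\<^sub>z\<close> is the tangential part of \<open>D\<^sub>u \<phi>\<^sub>v\<close>: because \<open>D\<eta>\<close> is tangent
and \<open>shape_sym\<close> holds, \<open>G(D\<^sub>z \<eta>, \<phi>\<^sub>w) = G(D\<^sub>w \<eta>, \<phi>\<^sub>z) = G(D\<^sub>w \<eta>, D\<^sub>u \<phi>\<^sub>v)\<close>.\<close>

lemma codazzi_sym:
  assumes x: "x \<in> S"
  shows "G (\<phi> x) (D u (D v \<eta>) x) (pd w \<phi> x) - G (\<phi> x) (D w \<eta> x) (D u (pd v \<phi>) x)
    = G (\<phi> x) (D u (D w \<eta>) x) (pd v \<phi> x) - G (\<phi> x) (D v \<eta> x) (D u (pd w \<phi>) x)"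
proof -
  have "pd u (\<lambda>x. G (\<phi> x) (D v \<eta> x) (pd w \<phi> x)) x
      = pd u (\<lambda>x. G (\<phi> x) (D w \<eta> x) (pd v \<phi> x)) x"
    by (rule pd_cong_open[OF open_S x]) (rule shape_sym)
  then show ?thesis
    using metric_deriv[OF smooth_on_cov[OF \<eta>_smooth] smooth_on_pd[OF map_smooth] x] by simp
qed


text \<open>This holds for every vector \<open>w\<close>.  It will be applied with \<open>w\<close> the covariant derivative in \<open>M\<close> of the constant
field \<open>v\<close> in direction \<open>u\<close>, when the left side is the Hessian of \<open>f\<close>.\<close>

lemma hessian_along:
  assumes V: "killing V" and x: "x \<in> S"
  defines "f \<equiv> \<lambda>x. G (\<phi> x) (\<eta> x) (V (\<phi> x))"
  shows "pd u (pd v f) x - pd w f x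
    = G (\<phi> x) (D u (D v \<eta>) x - D w \<eta> x) (V (\<phi> x))
      + G (\<phi> x) (D v \<eta> x) (nab \<Gamma> (pd u \<phi> x) V (\<phi> x))
      + G (\<phi> x) (D u \<eta> x) (nab \<Gamma> (pd v \<phi> x) V (\<phi> x))
      + G (\<phi> x) (\<eta> x) (nab2 \<Gamma> (pd u \<phi> x) (pd v \<phi> x) V (\<phi> x))
      + G (\<phi> x) (\<eta> x) (nab \<Gamma> (D u (pd v \<phi>) x - pd w \<phi> x) V (\<phi> x))"
proof -
  interpret N: levi_civita_along T T "\<lambda>y. y" G \<Gamma> by (rule nab_levi_civita)
  have sV: "smooth_on T V" using V by (simp add: killing_def)
  note T = map_in[OF x]
  show ?thesis
    using second_metric_deriv[OF \<eta>_smooth smooth_on_pull[OF sV] x, of v u]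
      metric_deriv[OF \<eta>_smooth smooth_on_pull[OF sV] x, of w]
    unfolding f_def cov_cov_pull[OF sV x] cov_pull[OF sV x]
    by (simp add: linear_diff[OF N.cov_linear[OF sV T]] G_lin[OF T])
qed

lemma shape_expand:
  assumes x: "x \<in> S" and E: "orthonormal_basis (first_form x) E"
  shows "D v \<eta> x = (\<Sum>j\<in>Basis. G (\<phi> x) (D v \<eta> x) (pd (E j) \<phi> x) *\<^sub>R pd (E j) \<phi> x)"
proof -
  obtain s where s: "D v \<eta> x = pd s \<phi> x" using \<eta>_parallel[OF x] by blast
  have "pd s \<phi> x = pd (\<Sum>j\<in>Basis. first_form x s (E j) *\<^sub>R E j) \<phi> x"
    using orthonormal_expand[OF first_form_inner[OF x] E, of s] by simp
  then show ?thesis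
    unfolding s by (simp add: linear_sum[OF pd_map_linear[OF x]] linear_scale[OF pd_map_linear[OF x]] first_form_def)
qed

text \<open>By \<open>shape_expand\<close> the sum is \<open>\<Sum>\<^sub>i\<^sub>j h\<^sub>i\<^sub>j k\<^sub>i\<^sub>j\<close> with the symmetric matrix \<open>h\<close> of the shape operator and a skew matrix \<open>k\<close>.\<close>

lemma shape_skew_trace:
  assumes x: "x \<in> S" and E: "orthonormal_basis (first_form x) E"
    and skew: "\<And>i j. i \<in> Basis \<Longrightarrow> j \<in> Basis \<Longrightarrow>
      G (\<phi> x) (pd (E j) \<phi> x) (k i) = - G (\<phi> x) (pd (E i) \<phi> x) (k j)"
  shows "(\<Sum>i\<in>Basis. G (\<phi> x) (D (E i) \<eta> x) (k i)) = 0"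
proof -
  note T = map_in[OF x]
  let ?h = "\<lambda>i j. G (\<phi> x) (D (E i) \<eta> x) (pd (E j) \<phi> x)"
  have "G (\<phi> x) (D (E i) \<eta> x) (k i) = (\<Sum>j\<in>Basis. ?h i j * G (\<phi> x) (pd (E j) \<phi> x) (k i))" for i
    by (subst shape_expand[OF x E])
       (simp add: G_lin[OF T] linear_sum[OF bilinear_linear(2)[OF G_bil[OF T], of "k i"]])
  then have "(\<Sum>i\<in>Basis. G (\<phi> x) (D (E i) \<eta> x) (k i))
      = (\<Sum>i\<in>Basis. \<Sum>j\<in>Basis. ?h i j * G (\<phi> x) (pd (E j) \<phi> x) (k i))"
    by (intro sum.cong refl)
  also have "\<dots> = 0"
    by (rule sum_sym_skew[OF shape_sym[OF x] skew])
  finally show ?thesis .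
qed

text \<open>The field \<open>X i\<close> is \<open>D\<eta>\<close> in direction \<open>E\<^sub>i\<close> and \<open>Y i\<close> is \<open>\<phi>\<close> differentiated in that direction.  The
derivative of the frame contributes \<open>2 \<Sum>\<^sub>i G(X\<^sub>i, D\<^sub>t Y\<^sub>i)\<close>, and \<open>G(Y\<^sub>j, D\<^sub>t Y\<^sub>i)\<close> is skew in \<open>i\<close> and \<open>j\<close>
since the \<open>Y\<^sub>i\<close> are orthonormal; so the trace may be differentiated as if the frame were parallel.\<close>

lemma trace_deriv:
  assumes x: "x \<in> S" and E: "\<And>i. i \<in> Basis \<Longrightarrow> smooth_on S (\<lambda>x. E x i)"
    and on: "\<And>x. x \<in> S \<Longrightarrow> orthonormal_basis (first_form x) (E x)"
  shows "pd t (\<lambda>x. \<Sum>i\<in>Basis. G (\<phi> x) (D (E x i) \<eta> x) (pd (E x i) \<phi> x)) x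
    = (\<Sum>i\<in>Basis. G (\<phi> x) (D t (D (E x i) \<eta>) x) (pd (E x i) \<phi> x)
        - G (\<phi> x) (D (E x i) \<eta> x) (D t (pd (E x i) \<phi>) x))"
proof -
  note T = map_in[OF x]
  define X where "X i z = D (E z i) \<eta> z" for i z
  define Y where "Y i z = pd (E z i) \<phi> z" for i z
  have sX: "smooth_on S (X i)" if "i \<in> Basis" for i
    unfolding X_def
    by (rule smooth_on_linear_field[OF open_S, where L="\<lambda>z a. D a \<eta> z"])
       (intro cov_linear \<eta>_smooth smooth_on_cov E that | assumption)+
  have sY: "smooth_on S (Y i)" if "i \<in> Basis" for i
    unfolding Y_def
    by (rule smooth_on_linear_field[OF open_S, where L="\<lambda>z a. pd a \<phi> z"])
       (intro pd_map_linear smooth_on_pd map_smooth E that | assumption)+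
  have sXY: "smooth_on S (\<lambda>z. G (\<phi> z) (X i z) (Y i z))" if "i \<in> Basis" for i
    by (intro smooth_on_G sX sY that)
  have pX: "D t (X i) x = D t (D (E x i) \<eta>) x + D (pd t (\<lambda>z. E z i) x) \<eta> x"
    if "i \<in> Basis" for i
  proof -
    have "pd t (\<lambda>z. D (E z i) \<eta> z) x
        = pd t (\<lambda>z. D (E x i) \<eta> z) x + D (pd t (\<lambda>z. E z i) x) \<eta> x"
      by (rule pd_linear_field[OF open_S x, where L="\<lambda>z a. D a \<eta> z"])
         (intro cov_linear \<eta>_smooth smooth_on_cov E that | assumption)+
    then show ?thesis by (simp add: X_def[abs_def] cov_def[of \<Gamma> \<phi> t])
  qed
  have pY: "D t (Y i) x = D t (pd (E x i) \<phi>) x + pd (pd t (\<lambda>z. E z i) x) \<phi> x"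
    if "i \<in> Basis" for i
  proof -
    have "pd t (\<lambda>z. pd (E z i) \<phi> z) x
        = pd t (\<lambda>z. pd (E x i) \<phi> z) x + pd (pd t (\<lambda>z. E z i) x) \<phi> x"
      by (rule pd_linear_field[OF open_S x, where L="\<lambda>z a. pd a \<phi> z"])
         (intro pd_map_linear smooth_on_pd map_smooth E that | assumption)+
    then show ?thesis by (simp add: Y_def[abs_def] cov_def[of \<Gamma> \<phi> t])
  qed
  have skew: "G (\<phi> x) (Y j x) (D t (Y i) x) = - G (\<phi> x) (Y i x) (D t (Y j) x)"
    if ij: "i \<in> Basis" "j \<in> Basis" for i j
  proof -
    have "pd t (\<lambda>z. G (\<phi> z) (Y i z) (Y j z)) x = pd t (\<lambda>z. if i = j then 1 else 0) x"
      by (rule pd_cong_open[OF open_S x])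
         (use on ij in \<open>simp add: Y_def orthonormal_basis_def first_form_def\<close>)
    then show ?thesis
      using metric_deriv[OF sY[OF ij(1)] sY[OF ij(2)] x, of t] G_sym[OF T, of "Y j x"] by simp
  qed
  have zero: "(\<Sum>i\<in>Basis. G (\<phi> x) (X i x) (D t (Y i) x)) = 0"
    unfolding X_def by (rule shape_skew_trace[OF x on[OF x]]) (unfold Y_def[symmetric], rule skew)
  have "pd t (\<lambda>z. \<Sum>i\<in>Basis. G (\<phi> z) (X i z) (Y i z)) x = (\<Sum>i\<in>Basis. pd t (\<lambda>z. G (\<phi> z) (X i z) (Y i z)) x)"
    by (rule pd_eqI[OF has_derivative_sum]) (rule smooth_on_has_derivative[OF open_S sXY x])
  also have "\<dots> = (\<Sum>i\<in>Basis. (G (\<phi> x) (D t (D (E x i) \<eta>) x) (Y i x)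
        - G (\<phi> x) (X i x) (D t (pd (E x i) \<phi>) x)) + 2 * G (\<phi> x) (X i x) (D t (Y i) x))"
  proof (rule sum.cong[OF refl])
    fix i :: 'a assume i: "i \<in> Basis"
    have "G (\<phi> x) (D (pd t (\<lambda>z. E z i) x) \<eta> x) (Y i x) = G (\<phi> x) (X i x) (pd (pd t (\<lambda>z. E z i) x) \<phi> x)"
      unfolding X_def Y_def by (rule shape_sym[OF x])
    then show "pd t (\<lambda>z. G (\<phi> z) (X i z) (Y i z)) x = (G (\<phi> x) (D t (D (E x i) \<eta>) x) (Y i x)
        - G (\<phi> x) (X i x) (D t (pd (E x i) \<phi>) x)) + 2 * G (\<phi> x) (X i x) (D t (Y i) x)"
      unfolding metric_deriv[OF sX[OF i] sY[OF i] x] pX[OF i] pY[OF i] by (simp add: G_lin[OF T])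
  qed
  finally show ?thesis
    unfolding sum.distrib sum_distrib_left[symmetric] zero by (simp add: X_def Y_def)
qed

text \<open>The four terms on the right are, in this order, the derivative of the mean curvature function, the mean
curvature vector, the Simons operator and the normal Ricci operator.  \<open>V\<close> is split at \<open>x\<close> into its tangential
part \<open>pd t \<phi> x\<close> and its normal part, the latter extended to a normal section \<open>\<xi>\<close> near \<open>x\<close>; \<open>w i\<close> is the
tangential part of \<open>D \<phi>\<^sub>e\<close> in direction \<open>e = E x i\<close>.\<close>

theorem laplacian_formula:
  assumes V: "killing V" and x: "x \<in> S"
    and E: "\<And>i. i \<in> Basis \<Longrightarrow> smooth_on S (\<lambda>x. E x i)"
    and on: "\<And>x. x \<in> S \<Longrightarrow> orthonormal_basis (first_form x) (E x)"
    and \<xi>: "smooth_on S \<xi>" and \<xi>_normal: "\<And>x u. x \<in> S \<Longrightarrow> G (\<phi> x) (\<xi> x) (pd u \<phi> x) = 0"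
    and split: "V (\<phi> x) = pd t \<phi> x + \<xi> x"
    and w: "\<And>i u. i \<in> Basis \<Longrightarrow> G (\<phi> x) (D (E x i) (pd (E x i) \<phi>) x - pd (w i) \<phi> x) (pd u \<phi> x) = 0"
  defines "f \<equiv> \<lambda>x. G (\<phi> x) (\<eta> x) (V (\<phi> x))"
  shows "- (\<Sum>i\<in>Basis. pd (E x i) (pd (E x i) f) x - pd (w i) f x)
    = - pd t (\<lambda>x. \<Sum>i\<in>Basis. G (\<phi> x) (D (E x i) \<eta> x) (pd (E x i) \<phi> x)) x
    + G (\<phi> x) (\<Sum>i\<in>Basis. D (E x i) (pd (E x i) \<phi>) x - pd (w i) \<phi> x) (nab \<Gamma> (\<eta> x) V (\<phi> x))
    + (\<Sum>i\<in>Basis. G (\<phi> x) (D (E x i) \<eta> x) (D (E x i) \<xi> x))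
    + (\<Sum>i\<in>Basis. G (\<phi> x) (Riem \<Gamma> (\<phi> x) (\<eta> x) (pd (E x i) \<phi> x) (\<xi> x)) (pd (E x i) \<phi> x))"
proof -
  note T = map_in[OF x]
  let ?g = "G (\<phi> x)" and ?y = "\<phi> x"
  let ?P = "\<lambda>a. pd a \<phi> x" and ?D = "\<lambda>a. D a \<eta> x"
  let ?D2 = "\<lambda>a b. D a (D b \<eta>) x" and ?Q = "\<lambda>a b. D a (pd b \<phi>) x"
  let ?R = "Riem \<Gamma> (\<phi> x)"
  have kill: "?g (nab \<Gamma> a V ?y) b = - ?g a (nab \<Gamma> b V ?y)" for a b
    using V T by (auto simp: killing_def eq_neg_iff_add_eq_0)
  \<comment> \<open>\<open>A u v a\<close> is \<open>\<langle>D\<^sup>2\<eta>(u, v), \<phi>\<^sub>a\<rangle>\<close>.\<close>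
  define A where "A u v a = ?g (?D2 u v) (?P a) - ?g (?D a) (?Q u v)" for u v a
  have A_sym: "A u v a = A u a v" for u v a
    unfolding A_def by (rule codazzi_sym[OF x])
  have A_comm: "A u v a - A v u a = - ?g (?R (?P u) (?P v) (\<eta> x)) (?P a)" for u v a
  proof -
    have "A u v a - A v u a = ?g (?D2 u v - ?D2 v u) (?P a)"
      unfolding A_def torsion_free[OF x, of v u] by (simp add: G_lin[OF T])
    then show ?thesis unfolding cov_commute[OF \<eta>_smooth x] by (simp add: G_lin[OF T])
  qed
  have summand: "pd (E x i) (pd (E x i) f) x - pd (w i) f x
      = A t (E x i) (E x i) - ?g (?D (E x i)) (D (E x i) \<xi> x)
        - ?g (?R (\<eta> x) (?P (E x i)) (\<xi> x)) (?P (E x i))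
        - ?g (?Q (E x i) (E x i) - ?P (w i)) (nab \<Gamma> (\<eta> x) V ?y)
        + 2 * ?g (?D (E x i)) (nab \<Gamma> (?P (E x i)) V ?y)"
    if i: "i \<in> Basis" for i
  proof -
    let ?e = "E x i"
    have \<xi>0: "?g (?D a) (\<xi> x) = 0" for a
      by (rule normal_orthogonal_cov[OF x \<xi>_normal[OF x]])
    \<comment> \<open>The normal part of \<open>D\<^sup>2\<eta>(e, e)\<close> gives the Simons operator.\<close>
    have normal: "?g (?D2 ?e ?e - ?D (w i)) (\<xi> x) = - ?g (?D ?e) (D ?e \<xi> x)"
    proof -
      have "pd ?e (\<lambda>z. G (\<phi> z) (D ?e \<eta> z) (\<xi> z)) x = pd ?e (\<lambda>z. 0) x"
        by (rule pd_cong_open[OF open_S x]) (rule normal_orthogonal_cov[OF _ \<xi>_normal])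
      then show ?thesis
        using metric_deriv[OF smooth_on_cov[OF \<eta>_smooth] \<xi> x, of ?e ?e] \<xi>0[of "w i"]
        by (simp add: G_lin[OF T])
    qed
    have tangential: "?g (?D2 ?e ?e - ?D (w i)) (?P t) = A ?e ?e t"
    proof -
      have "?g (?D (w i)) (?P t) = ?g (?D t) (?P (w i))" by (rule shape_sym[OF x])
      moreover have "?g (?D t) (?Q ?e ?e - ?P (w i)) = 0"
        by (rule normal_orthogonal_cov[OF x w[OF i]])
      ultimately show ?thesis by (simp add: A_def G_lin[OF T])
    qed
    \<comment> \<open>Codazzi moves \<open>t\<close> to the outer derivative; the pair symmetry brings the curvature into the form it has in the Ricci operator.\<close>
    have ricci: "A ?e ?e t = A t ?e ?e + ?g (?R (\<eta> x) (?P ?e) (?P t)) (?P ?e)"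
      using A_sym[of ?e ?e t] A_comm[of ?e t ?e] Riem_pair[OF T, of "?P t" "?P ?e" "\<eta> x" "?P ?e"]
        Riem_skew_first[of ?y "?P ?e" "?P t" "\<eta> x"] by (simp add: G_lin[OF T])
    \<comment> \<open>The tangential part of this term cancels against the curvature in the Codazzi equation.\<close>
    have RV: "?g (?R (\<eta> x) (?P ?e) (V ?y)) (?P ?e)
        = ?g (?R (\<eta> x) (?P ?e) (?P t)) (?P ?e) + ?g (?R (\<eta> x) (?P ?e) (\<xi> x)) (?P ?e)"
      unfolding split linear_add[OF Riem_linear_last[OF T]] by (simp add: G_lin[OF T])
    have "?g (\<eta> x) (nab2 \<Gamma> (?P ?e) (?P ?e) V ?y) = - ?g (?R (\<eta> x) (?P ?e) (V ?y)) (?P ?e)"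
      using nab2_diagonal[OF V T, of "?P ?e" "\<eta> x"] G_sym[OF T, of "\<eta> x"] by simp
    moreover have "?g (\<eta> x) (nab \<Gamma> (?Q ?e ?e - ?P (w i)) V ?y)
        = - ?g (?Q ?e ?e - ?P (w i)) (nab \<Gamma> (\<eta> x) V ?y)"
      using kill G_sym[OF T, of "\<eta> x"] by simp
    moreover have "?g (?D2 ?e ?e - ?D (w i)) (V ?y)
        = ?g (?D2 ?e ?e - ?D (w i)) (?P t) + ?g (?D2 ?e ?e - ?D (w i)) (\<xi> x)"
      unfolding split by (rule G_lin(2)[OF T])
    ultimately show ?thesis
      unfolding f_def hessian_along[OF V x] normal tangential ricci RV by simp
  qed
  have zero: "(\<Sum>i\<in>Basis. ?g (?D (E x i)) (nab \<Gamma> (?P (E x i)) V ?y)) = 0"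
  proof (rule shape_skew_trace[OF x on[OF x]])
    show "?g (?P (E x j)) (nab \<Gamma> (?P (E x i)) V ?y) = - ?g (?P (E x i)) (nab \<Gamma> (?P (E x j)) V ?y)" for i j
      using kill[of "?P (E x i)" "?P (E x j)"] G_sym[OF T, of "?P (E x j)"] by simp
  qed
  have sumG: "?g (\<Sum>i\<in>Basis. ?Q (E x i) (E x i) - ?P (w i)) (nab \<Gamma> (\<eta> x) V ?y)
      = (\<Sum>i\<in>Basis. ?g (?Q (E x i) (E x i) - ?P (w i)) (nab \<Gamma> (\<eta> x) V ?y))"
    by (rule linear_sum[OF bilinear_linear(2)[OF G_bil[OF T]]])
  have trace: "pd t (\<lambda>x. \<Sum>i\<in>Basis. G (\<phi> x) (D (E x i) \<eta> x) (pd (E x i) \<phi> x)) x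
      = (\<Sum>i\<in>Basis. A t (E x i) (E x i))"
    unfolding A_def by (rule trace_deriv[OF x E on])
  have "(\<Sum>i\<in>Basis. pd (E x i) (pd (E x i) f) x - pd (w i) f x)
      = (\<Sum>i\<in>Basis. A t (E x i) (E x i) - ?g (?D (E x i)) (D (E x i) \<xi> x)
        - ?g (?R (\<eta> x) (?P (E x i)) (\<xi> x)) (?P (E x i))
        - ?g (?Q (E x i) (E x i) - ?P (w i)) (nab \<Gamma> (\<eta> x) V ?y)
        + 2 * ?g (?D (E x i)) (nab \<Gamma> (?P (E x i)) V ?y))"
    by (rule sum.cong[OF refl]) (rule summand)
  then show ?thesis
    unfolding trace sumG unfolding sum.distrib sum_subtractf sum_distrib_left[symmetric] zero by simp
qed

end


section \<open>Tangential and normal parts\<close>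

lemma levi_civita_along_subset:
  assumes "levi_civita_along S T \<phi> G \<Gamma>" "open S'" "S' \<subseteq> S"
  shows "levi_civita_along S' T \<phi> G \<Gamma>"
  using assms smooth_on_subset[of S \<phi> S'] unfolding levi_civita_along_def by blast

locale framed_section = parallel_section S T \<phi> G \<Gamma> \<eta>
  for S :: "'a::euclidean_space set" and T :: "'d::euclidean_space set"
    and \<phi> :: "'a \<Rightarrow> 'd" and G :: "'d \<Rightarrow> 'd \<Rightarrow> 'd \<Rightarrow> real" and \<Gamma> :: "'d \<Rightarrow> 'd \<Rightarrow> 'd \<Rightarrow> 'd"
    and \<eta> :: "'a \<Rightarrow> 'd" +
  fixes E :: "'a \<Rightarrow> 'a \<Rightarrow> 'a"
  assumes E_smooth: "\<And>i. i \<in> Basis \<Longrightarrow> smooth_on S (\<lambda>x. E x i)"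
    and E_orthonormal: "\<And>x. x \<in> S \<Longrightarrow> orthonormal_basis (first_form x) (E x)"
begin

text \<open>The orthogonal projection onto the tangent space, pulled back by the derivative of \<open>\<phi>\<close> to the source.\<close>

definition tan_part :: "'a \<Rightarrow> 'd \<Rightarrow> 'a" where
  "tan_part x \<omega> = (\<Sum>i\<in>Basis. G (\<phi> x) \<omega> (pd (E x i) \<phi> x) *\<^sub>R E x i)"

definition perp :: "'a \<Rightarrow> 'd \<Rightarrow> 'd" where
  "perp x \<omega> = \<omega> - pd (tan_part x \<omega>) \<phi> x"

lemma tan_linear: "x \<in> S \<Longrightarrow> linear (tan_part x)"
  unfolding tan_part_def[abs_def]
  by (rule linearI) (simp_all add: G_lin[OF map_in] sum.distrib scaleR_add_left scaleR_sum_right)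

lemma perp_linear: "x \<in> S \<Longrightarrow> linear (perp x)"
  unfolding perp_def[abs_def]
  using linear_compose[OF tan_linear pd_map_linear, unfolded o_def]
  by (intro linear_compose_sub linear_ident) auto

text \<open>So \<open>tan_part x\<close> is the adjoint of the derivative of \<open>\<phi>\<close>.\<close>

lemma tan_adjoint:
  assumes x: "x \<in> S" shows "first_form x (tan_part x \<omega>) u = G (\<phi> x) \<omega> (pd u \<phi> x)"
proof -
  note T = map_in[OF x] and on = orthonormal_expand[OF first_form_inner[OF x] E_orthonormal[OF x], of u]
  note bil = inner_productD[OF first_form_inner[OF x]]
  have "first_form x (tan_part x \<omega>) u = (\<Sum>i\<in>Basis. G (\<phi> x) \<omega> (pd (E x i) \<phi> x) * first_form x (E x i) u)"
    unfolding tan_part_def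
    by (simp add: linear_sum[OF bilinear_linear(2)[OF bil(1)]] linear_scale[OF bilinear_linear(2)[OF bil(1)]])
  also have "\<dots> = G (\<phi> x) \<omega> (pd (\<Sum>i\<in>Basis. first_form x u (E x i) *\<^sub>R E x i) \<phi> x)"
    by (simp add: linear_sum[OF pd_map_linear[OF x]] linear_scale[OF pd_map_linear[OF x]]
        linear_sum[OF bilinear_linear(1)[OF G_bil[OF T]]] G_lin[OF T] bil(2)[of u] mult.commute)
  finally show ?thesis using on by simp
qed

lemma perp_normal:
  assumes x: "x \<in> S" shows "G (\<phi> x) (perp x \<omega>) (pd u \<phi> x) = 0"
  using tan_adjoint[OF x, of \<omega> u] by (simp add: perp_def G_lin[OF map_in[OF x]] first_form_def)

lemma tan_unique:
  assumes x: "x \<in> S" and w: "\<And>u. G (\<phi> x) (\<omega> - pd w \<phi> x) (pd u \<phi> x) = 0"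
  shows "tan_part x \<omega> = w"
proof (rule inner_product_eqI[OF first_form_inner[OF x]])
  fix u show "first_form x (tan_part x \<omega>) u = first_form x w u"
    using w[of u] unfolding tan_adjoint[OF x] by (simp add: G_lin[OF map_in[OF x]] first_form_def)
qed

lemma tan_tangent: "x \<in> S \<Longrightarrow> tan_part x (pd w \<phi> x) = w"
  by (rule tan_unique) (simp_all add: bilinear_lzero[OF G_bil[OF map_in]])

lemma perp_tangent: "x \<in> S \<Longrightarrow> perp x (pd w \<phi> x) = 0"
  by (simp add: perp_def tan_tangent)

lemma perp_fixed:
  assumes x: "x \<in> S" and "\<And>u. G (\<phi> x) \<omega> (pd u \<phi> x) = 0"
  shows "perp x \<omega> = \<omega>"
  using tan_unique[OF x, of \<omega> 0] assms(2) linear_0[OF pd_map_linear[OF x]] by (simp add: perp_def)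

lemma G_perp:
  assumes x: "x \<in> S" and \<nu>: "\<And>u. G (\<phi> x) \<nu> (pd u \<phi> x) = 0"
  shows "G (\<phi> x) (perp x \<omega>) \<nu> = G (\<phi> x) \<omega> \<nu>"
  using \<nu> G_sym[OF map_in[OF x], of \<nu>] by (simp add: perp_def G_lin[OF map_in[OF x]])

lemma smooth_on_perp:
  assumes \<zeta>: "smooth_on S \<zeta>" shows "smooth_on S (\<lambda>x. perp x (\<zeta> x))"
proof -
  have P: "smooth_on S (\<lambda>x. pd (u x) \<phi> x)" if "smooth_on S u" for u
    by (rule smooth_on_linear_field[OF open_S, where L="\<lambda>x a. pd a \<phi> x", OF pd_map_linear smooth_on_pd[OF map_smooth] that])
  show ?thesis
    unfolding perp_def tan_part_def
    by (intro smooth_on_diff[OF open_S] P smooth_on_sum[OF open_S] smooth_on_scaleR[OF open_S] smooth_on_G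
        E_smooth \<zeta> finite_Basis)
qed

definition second_form :: "'a \<Rightarrow> 'a \<Rightarrow> 'a \<Rightarrow> 'd" where
  "second_form x u v = perp x (D u (pd v \<phi>) x)"

lemma second_form_linear:
  assumes x: "x \<in> S"
  shows "linear (second_form x u)" "linear (\<lambda>u. second_form x u v)"
proof -
  have 1: "linear (\<lambda>u. second_form x u v)" for v
    unfolding second_form_def
    by (rule linear_compose[OF cov_linear[OF smooth_on_pd[OF map_smooth] x] perp_linear[OF x], unfolded o_def])
  then show "linear (\<lambda>u. second_form x u v)" .
  have "second_form x u = (\<lambda>v. second_form x v u)"
    using torsion_free[OF x, of u] by (auto simp: second_form_def)
  then show "linear (second_form x u)" using 1 by simp
qed

text \<open>The derivative of \<open>Y\<close> contributes only a tangent vector, so the second fundamental form is tensorial.\<close>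

lemma second_form_field:
  assumes x: "x \<in> S'" and S': "open S'" "S' \<subseteq> S" and Y: "smooth_on S' Y"
  shows "perp x (D u (\<lambda>x. pd (Y x) \<phi> x) x) = second_form x u (Y x)"
proof -
  have xS: "x \<in> S" using x S' by auto
  have sm: "smooth_on S' (pd a \<phi>)" for a
    by (rule smooth_on_subset[OF smooth_on_pd[OF map_smooth] S'(2)])
  have "pd u (\<lambda>x. pd (Y x) \<phi> x) x = pd u (\<lambda>z. pd (Y x) \<phi> z) x + pd (pd u Y x) \<phi> x"
    by (rule pd_linear_field[OF S'(1) x, where L="\<lambda>x a. pd a \<phi> x", OF _ sm Y])
       (use pd_map_linear S' in auto)
  then have "D u (\<lambda>x. pd (Y x) \<phi> x) x = D u (pd (Y x) \<phi>) x + pd (pd u Y x) \<phi> x"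
    by (simp add: cov_def)
  then show ?thesis
    by (simp add: second_form_def linear_add[OF perp_linear[OF xS]] perp_tangent[OF xS])
qed

lemma second_form_eta:
  assumes x: "x \<in> S"
  shows "G (\<phi> x) (second_form x u v) (\<eta> x) = - G (\<phi> x) (D u \<eta> x) (pd v \<phi> x)"
proof -
  have "pd u (\<lambda>x. G (\<phi> x) (\<eta> x) (pd v \<phi> x)) x = pd u (\<lambda>x. 0) x"
    by (rule pd_cong_open[OF open_S x]) (rule \<eta>_normal)
  then show ?thesis
    using metric_deriv[OF \<eta>_smooth smooth_on_pd[OF map_smooth] x, of v u]
      G_sym[OF map_in[OF x], of "D u (pd v \<phi>) x" "\<eta> x"]
    unfolding second_form_def G_perp[OF x \<eta>_normal[OF x]] by simp
qed

text \<open>With \<open>D\<eta>\<close> in direction \<open>E\<^sub>i\<close> equal to \<open>\<phi>\<^bsub>s i\<^esub>\<close>, differentiating \<open>G(\<phi>\<^bsub>s i\<^esub>, \<xi>) = 0\<close> replaces the derivative of \<open>\<xi>\<close>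
by that of \<open>\<phi>\<^bsub>s i\<^esub>\<close>.  Hence the sum depends on \<open>\<xi> x\<close> only, and is given by a normal vector.  The section
\<open>\<xi>\<close> may be defined on any smaller neighbourhood, as in the definition of the Simons operator.\<close>

lemma simons_representative:
  assumes x: "x \<in> S"
  shows "\<exists>\<zeta>. (\<forall>u. G (\<phi> x) \<zeta> (pd u \<phi> x) = 0) \<and>
    (\<forall>S' \<xi>. open S' \<and> x \<in> S' \<and> S' \<subseteq> S \<and> smooth_on S' \<xi> \<and> (\<forall>y\<in>S'. \<forall>u. G (\<phi> y) (\<xi> y) (pd u \<phi> y) = 0) \<longrightarrow>
      G (\<phi> x) \<zeta> (\<xi> x) = (\<Sum>i\<in>Basis. G (\<phi> x) (D (E x i) \<eta> x) (D (E x i) \<xi> x)))"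
proof -
  note T = map_in[OF x]
  define s where "s i = tan_part x (D (E x i) \<eta> x)" for i
  have s: "D (E x i) \<eta> x = pd (s i) \<phi> x" for i
    using \<eta>_parallel[OF x, of "E x i"] tan_tangent[OF x] by (auto simp: s_def)
  let ?\<omega> = "\<Sum>i\<in>Basis. D (E x i) (pd (s i) \<phi>) x"
  have main: "G (\<phi> x) (perp x (- ?\<omega>)) (\<xi> x) = (\<Sum>i\<in>Basis. G (\<phi> x) (D (E x i) \<eta> x) (D (E x i) \<xi> x))"
    if S': "open S'" "x \<in> S'" "S' \<subseteq> S" and \<xi>: "smooth_on S' \<xi>"
      and n: "\<And>y u. y \<in> S' \<Longrightarrow> G (\<phi> y) (\<xi> y) (pd u \<phi> y) = 0" for S' \<xi>
  proof -
    interpret L: levi_civita_along S' T \<phi> G \<Gamma>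
      by (rule levi_civita_along_subset[OF levi_civita_along_axioms S'(1,3)])
    have "G (\<phi> x) (pd (s i) \<phi> x) (D (E x i) \<xi> x) = - G (\<phi> x) (D (E x i) (pd (s i) \<phi>) x) (\<xi> x)" for i
    proof -
      have "pd (E x i) (\<lambda>y. G (\<phi> y) (pd (s i) \<phi> y) (\<xi> y)) x = pd (E x i) (\<lambda>y. 0) x"
        by (rule pd_cong_open[OF S'(1,2)]) (use n G_sym[OF L.map_in] in metis)
      then show ?thesis
        using L.metric_deriv[OF smooth_on_pd[OF L.map_smooth] \<xi> S'(2), of "s i" "E x i"] by simp
    qed
    then show ?thesis
      unfolding G_perp[OF x n[OF S'(2)]] s
      by (simp add: G_lin[OF T] linear_sum[OF bilinear_linear(2)[OF G_bil[OF T]]] sum_negf)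
  qed
  show ?thesis
  proof (rule exI[of _ "perp x (- ?\<omega>)"], intro conjI allI impI)
    show "G (\<phi> x) (perp x (- ?\<omega>)) (pd u \<phi> x) = 0" for u by (rule perp_normal[OF x])
  qed (elim conjE, rule main, auto)
qed

end


section \<open>Charts of a manifold\<close>

locale smooth_manifold =
  fixes A :: "('m::{t2_space, second_countable_topology}, 'e::euclidean_space) chart set"
  assumes atlas: "smooth_atlas A"
begin

lemma chart_open [simp]: "c \<in> A \<Longrightarrow> open (cdom c)"
  using atlas by (simp add: smooth_atlas_def)

lemma chart_homeo: "c \<in> A \<Longrightarrow> \<exists>h. homeomorphism (cdom c) (cmap c ` cdom c) (cmap c) h"
  using atlas by (simp add: smooth_atlas_def)

lemma cinv_cmap [simp]:
  assumes "c \<in> A" "p \<in> cdom c" shows "cinv c (cmap c p) = p"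
proof -
  obtain h where "homeomorphism (cdom c) (cmap c ` cdom c) (cmap c) h" using chart_homeo assms by blast
  then have "inj_on (cmap c) (cdom c)"
    by (intro inj_on_inverseI[where g=h]) (rule homeomorphism_apply1)
  then show ?thesis using assms by (simp add: cinv_def)
qed

lemma continuous_on_cinv:
  assumes c: "c \<in> A" shows "continuous_on (cmap c ` cdom c) (cinv c)"
proof -
  obtain h where h: "homeomorphism (cdom c) (cmap c ` cdom c) (cmap c) h" using chart_homeo c by blast
  have "cinv c x = h x" if "x \<in> cmap c ` cdom c" for x
    using that homeomorphism_apply1[OF h] c by auto
  then show ?thesis
    using homeomorphism_cont2[OF h] by (simp cong: continuous_on_cong)
qed

lemma image_chart_eq:
  "c \<in> A \<Longrightarrow> U \<subseteq> cdom c \<Longrightarrow> cmap c ` U = cmap c ` cdom c \<inter> cinv c -` U"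
  by (force simp: subset_iff)

lemma open_image:
  assumes c: "c \<in> A" and U: "open U" "U \<subseteq> cdom c" shows "open (cmap c ` U)"
proof -
  have "open (cmap c ` cdom c)" using atlas c by (simp add: smooth_atlas_def)
  then show ?thesis
    unfolding image_chart_eq[OF c U(2)]
    by (intro continuous_open_preimage[OF continuous_on_cinv[OF c]] U)
qed

lemma chart_at: "chart_at A p \<in> A" "p \<in> cdom (chart_at A p)"
proof -
  have "p \<in> (\<Union>c\<in>A. cdom c)" using atlas by (simp only: smooth_atlas_def) simp
  then have "\<exists>c. c \<in> A \<and> p \<in> cdom c" by blast
  from someI_ex[OF this] show "chart_at A p \<in> A" "p \<in> cdom (chart_at A p)"
    by (auto simp: chart_at_def)
qed

text \<open>Coordinate changes are smooth only on the image of the overlap of the two domains.\<close>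

definition transit :: "('m, 'e) chart \<Rightarrow> ('m, 'e) chart \<Rightarrow> 'e \<Rightarrow> 'e" where
  "transit c d x = cmap d (cinv c x)"

lemma transit_cmap: "c \<in> A \<Longrightarrow> p \<in> cdom c \<Longrightarrow> transit c d (cmap c p) = cmap d p"
  by (simp add: transit_def)

lemma smooth_transit:
  "c \<in> A \<Longrightarrow> d \<in> A \<Longrightarrow> smooth_on (cmap c ` (cdom c \<inter> cdom d)) (transit c d)"
  using atlas by (simp add: smooth_atlas_def transit_def[abs_def] o_def)

lemma open_overlap: "c \<in> A \<Longrightarrow> d \<in> A \<Longrightarrow> open (cmap c ` (cdom c \<inter> cdom d))"
  by (intro open_image) (auto simp: open_Int)

text \<open>The chain rule for a coordinate change, for functions with values in any normed space.  Applied to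
functions it transforms differentials, applied to coordinate maps it gives the cocycle rule
\<open>pd_transit_chain\<close> for the derivatives of coordinate changes.\<close>

lemma pd_chart_change:
  assumes c: "c \<in> A" "p \<in> cdom c" and d: "d \<in> A" "p \<in> cdom d"
    and U: "open U" "p \<in> U" "U \<subseteq> cdom d"
    and sm: "smooth_on (cmap d ` U) (\<lambda>x. \<Phi> (cinv d x))"
  shows "pd v (\<lambda>x. \<Phi> (cinv c x)) (cmap c p) = pd (pd v (transit c d) (cmap c p)) (\<lambda>x. \<Phi> (cinv d x)) (cmap d p)"
proof -
  let ?S = "cmap c ` (cdom c \<inter> U)"
  have S: "open ?S" by (intro open_image) (use c U in \<open>auto simp: open_Int\<close>)
  have T: "open (cmap d ` U)" by (intro open_image) (use d U in \<open>auto simp: open_Int\<close>)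
  have tr: "smooth_on ?S (transit c d)"
    by (rule smooth_on_subset[OF smooth_transit]) (use c d U in \<open>auto simp: open_Int\<close>)
  have in_S: "cmap c p \<in> ?S" using c U by auto
  have "pd v (\<lambda>x. \<Phi> (cinv c x)) (cmap c p) = pd v (\<lambda>x. \<Phi> (cinv d (transit c d x))) (cmap c p)"
  proof (rule pd_cong_open[OF S in_S])
    fix y assume "y \<in> ?S"
    then obtain r where r: "r \<in> cdom c" "r \<in> U" "y = cmap c r" by auto
    then have "r \<in> cdom d" using U by auto
    then show "\<Phi> (cinv c y) = \<Phi> (cinv d (transit c d y))"
      using r c d by (simp add: transit_cmap)
  qed
  also have "\<dots> = pd (pd v (transit c d) (cmap c p)) (\<lambda>x. \<Phi> (cinv d x)) (transit c d (cmap c p))"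
    by (rule pd_compose[OF S T sm tr in_S]) (use c U transit_cmap in \<open>auto simp: open_Int\<close>)
  finally show ?thesis using c by (simp add: transit_cmap)
qed

lemma pd_transit_self:
  assumes c: "c \<in> A" "p \<in> cdom c" shows "pd v (transit c c) (cmap c p) = v"
proof -
  have "pd v (transit c c) (cmap c p) = pd v (\<lambda>x. x) (cmap c p)"
    by (rule pd_cong_open[of "cmap c ` cdom c"])
       (use c open_image[OF c(1) chart_open[OF c(1)]] in \<open>auto simp: transit_cmap\<close>)
  then show ?thesis by simp
qed

lemma pd_transit_chain:
  assumes c: "c \<in> A" "p \<in> cdom c" and d: "d \<in> A" "p \<in> cdom d" and e: "e \<in> A" "p \<in> cdom e"
  shows "pd (pd v (transit c d) (cmap c p)) (transit d e) (cmap d p) = pd v (transit c e) (cmap c p)"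
  unfolding transit_def[of d e] transit_def[of c e, abs_def]
  by (rule pd_chart_change[OF c d, of "cdom d \<inter> cdom e", symmetric])
     (use smooth_transit[OF d(1) e(1)] d e in \<open>auto simp: transit_def[abs_def]\<close>)

lemma pd_transit_linear:
  assumes "c \<in> A" "p \<in> cdom c" "d \<in> A" "p \<in> cdom d"
  shows "linear (\<lambda>v. pd v (transit c d) (cmap c p))"
  by (rule smooth_on_linear_pd[OF open_overlap smooth_transit]) (use assms in \<open>auto simp: open_Int\<close>)

lemma comps_eq: "comps A c p v = pd v (transit (chart_at A p) c) (cmap (chart_at A p) p)"
  by (simp add: comps_def transit_def[abs_def] o_def)

lemma vec_of_eq: "vec_of A c p a = pd a (transit c (chart_at A p)) (cmap c p)"
  by (simp add: vec_of_def transit_def[abs_def] o_def)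

text \<open>The cocycle rule, read for components.  It allows working in one fixed chart near a point although the
preferred chart may jump from point to point.\<close>

lemma comps_change:
  assumes "c \<in> A" "p \<in> cdom c" "d \<in> A" "p \<in> cdom d"
  shows "comps A d p v = pd (comps A c p v) (transit c d) (cmap c p)"
  unfolding comps_eq by (rule pd_transit_chain[symmetric]) (use assms chart_at in \<open>auto simp: open_Int\<close>)

lemma comps_vec_of [simp]:
  assumes "c \<in> A" "p \<in> cdom c" shows "comps A c p (vec_of A c p a) = a"
  unfolding comps_eq vec_of_eq using pd_transit_chain[OF assms chart_at assms] pd_transit_self[OF assms] by simp

lemma vec_of_comps [simp]:
  assumes "c \<in> A" "p \<in> cdom c" shows "vec_of A c p (comps A c p v) = v"
  unfolding comps_eq vec_of_eq using pd_transit_chain[OF chart_at assms chart_at] pd_transit_self[OF chart_at] by simp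

lemma comps_linear: "c \<in> A \<Longrightarrow> p \<in> cdom c \<Longrightarrow> linear (comps A c p)"
  unfolding comps_eq[abs_def] by (rule pd_transit_linear[OF chart_at])

lemma vec_of_linear: "c \<in> A \<Longrightarrow> p \<in> cdom c \<Longrightarrow> linear (vec_of A c p)"
  unfolding vec_of_eq[abs_def] by (rule pd_transit_linear[OF _ _ chart_at])

lemma comps_chart_at [simp]: "comps A (chart_at A p) p v = v"
  unfolding comps_eq by (rule pd_transit_self[OF chart_at])

lemma comps_inject:
  assumes "c \<in> A" "p \<in> cdom c" "comps A c p v = comps A c p w" shows "v = w"
  using vec_of_comps[OF assms(1,2)] assms(3) by metis

definition local_field :: "('m, 'e) chart \<Rightarrow> ('m \<Rightarrow> 'e) \<Rightarrow> 'e \<Rightarrow> 'e" where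
  "local_field c X x = comps A c (cinv c x) (X (cinv c x))"

lemma local_field_cmap [simp]: "c \<in> A \<Longrightarrow> p \<in> cdom c \<Longrightarrow> local_field c X (cmap c p) = comps A c p (X p)"
  by (simp add: local_field_def)

lemma smooth_vf_loc:
  "smooth_vf_on A U X \<Longrightarrow> c \<in> A \<Longrightarrow> smooth_on (cmap c ` (cdom c \<inter> U)) (local_field c X)"
  by (simp add: smooth_vf_on_def local_field_def[abs_def])

lemma smooth_fun_loc:
  "smooth_fun_on A U h \<Longrightarrow> c \<in> A \<Longrightarrow> smooth_on (cmap c ` (cdom c \<inter> U)) (\<lambda>x. h (cinv c x))"
  by (simp add: smooth_fun_on_def o_def)

text \<open>Smoothness in the chart \<open>d\<close> implies smoothness in every other chart, on the overlap.  The three criteria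
\<open>smooth_fun_onI\<close>, \<open>smooth_vf_onI\<close> and \<open>smooth_section_onI\<close> rest on this; they reduce the
definitions, which quantify over the whole atlas, to a single chart.\<close>

lemma smooth_transfer:
  assumes c: "c \<in> A" and d: "d \<in> A" and U: "open U" "U \<subseteq> cdom d" and sm: "smooth_on (cmap d ` U) h"
  shows "smooth_on (cmap c ` (cdom c \<inter> U)) (\<lambda>x. h (transit c d x))"
proof (rule smooth_on_compose[OF _ _ sm])
  show "open (cmap c ` (cdom c \<inter> U))" by (intro open_image) (use c U in \<open>auto simp: open_Int\<close>)
  show "open (cmap d ` U)" by (intro open_image) (use d U in \<open>auto simp: open_Int\<close>)
  show "smooth_on (cmap c ` (cdom c \<inter> U)) (transit c d)"
    by (rule smooth_on_subset[OF smooth_transit]) (use c d U in \<open>auto simp: open_Int\<close>)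
  show "transit c d x \<in> cmap d ` U" if "x \<in> cmap c ` (cdom c \<inter> U)" for x
    using that c by (auto simp: transit_cmap)
qed

lemma smooth_fun_onI:
  assumes d: "d \<in> A" and U: "open U" "U \<subseteq> cdom d" and sm: "smooth_on (cmap d ` U) (\<lambda>x. h (cinv d x))"
  shows "smooth_fun_on A U h"
  unfolding smooth_fun_on_def
proof
  fix c assume c: "c \<in> A"
  show "smooth_on (cmap c ` (cdom c \<inter> U)) (h \<circ> cinv c)"
  proof (rule smooth_on_cong[OF _ smooth_transfer[OF c d U sm]])
    show "open (cmap c ` (cdom c \<inter> U))" by (intro open_image) (use c U in \<open>auto simp: open_Int\<close>)
    show "(h \<circ> cinv c) x = h (cinv d (transit c d x))" if "x \<in> cmap c ` (cdom c \<inter> U)" for x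
      using that c d U(2) by (auto simp: transit_cmap subset_iff)
  qed
qed

lemma smooth_vf_onI:
  assumes d: "d \<in> A" and U: "open U" "U \<subseteq> cdom d" and sm: "smooth_on (cmap d ` U) (local_field d X)"
  shows "smooth_vf_on A U X"
  unfolding smooth_vf_on_def
proof
  fix c assume c: "c \<in> A"
  let ?W = "cdom c \<inter> U"
  have W: "open ?W" "?W \<subseteq> cdom d" "cdom c \<inter> ?W = ?W" using U c chart_open by auto
  have oW: "open (cmap d ` ?W)" by (rule open_image[OF d W(1,2)])
  have "smooth_on (cmap d ` ?W) (\<lambda>y. pd (local_field d X y) (transit d c) y)"
  proof (rule smooth_on_linear_field[OF oW, where L="\<lambda>y a. pd a (transit d c) y"])
    have tr: "smooth_on (cmap d ` ?W) (transit d c)"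
      by (rule smooth_on_subset[OF smooth_transit]) (use c d U in \<open>auto simp: open_Int\<close>)
    show "linear (\<lambda>a. pd a (transit d c) y)" if "y \<in> cmap d ` ?W" for y
      by (rule smooth_on_linear_pd[OF oW tr that])
    show "smooth_on (cmap d ` ?W) (\<lambda>y. pd a (transit d c) y)" for a
      by (rule smooth_on_pd[OF tr])
    show "smooth_on (cmap d ` ?W) (local_field d X)"
      by (rule smooth_on_subset[OF sm]) auto
  qed
  from smooth_transfer[OF c d W(1,2) this]
  have sm': "smooth_on (cmap c ` ?W) (\<lambda>x. pd (local_field d X (transit c d x)) (transit d c) (transit c d x))"
    unfolding W(3) .
  show "smooth_on (cmap c ` ?W) (\<lambda>x. comps A c (cinv c x) (X (cinv c x)))"
  proof (rule smooth_on_cong[OF _ sm'])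
    show "open (cmap c ` ?W)" by (intro open_image) (use c W in \<open>auto simp: open_Int\<close>)
    show "comps A c (cinv c x) (X (cinv c x)) = pd (local_field d X (transit c d x)) (transit d c) (transit c d x)"
      if x: "x \<in> cmap c ` ?W" for x
    proof -
      obtain p where p: "p \<in> cdom c" "p \<in> U" "x = cmap c p" using x by auto
      then have "p \<in> cdom d" using U by auto
      then show ?thesis
        using p c d comps_change[OF d \<open>p \<in> cdom d\<close> c p(1)] by (simp add: transit_cmap)
    qed
  qed
qed

definition field_of :: "('m, 'e) chart \<Rightarrow> ('e \<Rightarrow> 'e) \<Rightarrow> 'm \<Rightarrow> 'e" where
  "field_of c Y p = vec_of A c p (Y (cmap c p))"

lemma local_field_field_of: "c \<in> A \<Longrightarrow> x \<in> cmap c ` cdom c \<Longrightarrow> local_field c (field_of c Y) x = Y x"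
  by (auto simp: local_field_def field_of_def)

lemma smooth_field_of:
  assumes c: "c \<in> A" and U: "open U" "U \<subseteq> cdom c" and Y: "smooth_on (cmap c ` U) Y"
  shows "smooth_vf_on A U (field_of c Y)"
  by (rule smooth_vf_onI[OF c U], rule smooth_on_cong[OF open_image[OF c U] Y], rule local_field_field_of[OF c])
     (use U in \<open>auto simp: open_Int\<close>)

lemma dfun_chart:
  assumes c: "c \<in> A" "p \<in> cdom c" and U: "open U" "p \<in> U" and h: "smooth_fun_on A U h"
  shows "dfun A h p v = pd (comps A c p v) (\<lambda>x. h (cinv c x)) (cmap c p)"
  unfolding dfun_def comps_eq o_def
  by (rule pd_chart_change[OF chart_at c, of "cdom c \<inter> U"])
     (use smooth_fun_loc[OF h c(1)] c U in \<open>auto simp: open_Int\<close>)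

text \<open>The components transform by the derivative of the coordinate change \<open>\<tau>\<close>.  Differentiating them once more
produces a term with the second derivative of \<open>\<tau>\<close>, which is symmetric and cancels in the bracket.\<close>

lemma lie_bracket_chart:
  assumes c: "c \<in> A" "p \<in> cdom c" and U: "open U" "p \<in> U"
    and X: "smooth_vf_on A U X" and Y: "smooth_vf_on A U Y"
  shows "comps A c p (lie_bracket A X Y p)
    = pd (comps A c p (X p)) (local_field c Y) (cmap c p) - pd (comps A c p (Y p)) (local_field c X) (cmap c p)"
proof -
  define d where "d = chart_at A p"
  have d: "d \<in> A" "p \<in> cdom d" using chart_at by (auto simp: d_def)
  let ?W = "cdom d \<inter> (cdom c \<inter> U)" and ?z = "cmap d p" and ?\<tau> = "transit d c"
  let ?S = "cmap d ` ?W" and ?T = "cmap c ` (cdom c \<inter> U)"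
  have S: "open ?S" by (intro open_image) (use c d U in \<open>auto simp: open_Int\<close>)
  have T: "open ?T" by (intro open_image) (use c U in \<open>auto simp: open_Int\<close>)
  have z: "?z \<in> ?S" using c d U by auto
  have \<tau>: "smooth_on ?S ?\<tau>"
    by (rule smooth_on_subset[OF smooth_transit]) (use c d in \<open>auto simp: open_Int\<close>)
  have key: "pd (pd w ?\<tau> ?z) (local_field c Z) (cmap c p)
      = pd w (pd (Z p) ?\<tau>) ?z + pd (pd w (local_field d Z) ?z) ?\<tau> ?z"
    if Z: "smooth_vf_on A U Z" for Z w
  proof -
    have sc: "smooth_on ?T (local_field c Z)" by (rule smooth_vf_loc[OF Z c(1)])
    have sd: "smooth_on ?S (local_field d Z)"
      by (rule smooth_on_subset[OF smooth_vf_loc[OF Z d(1)]]) auto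
    have "pd w (\<lambda>x. local_field c Z (?\<tau> x)) ?z = pd w (\<lambda>x. pd (local_field d Z x) ?\<tau> x) ?z"
    proof (rule pd_cong_open[OF S z])
      fix y assume "y \<in> ?S"
      then obtain r where r: "r \<in> cdom d" "r \<in> cdom c" "r \<in> U" "y = cmap d r" by auto
      then show "local_field c Z (?\<tau> y) = pd (local_field d Z y) ?\<tau> y"
        using c d comps_change[OF d(1) r(1) c(1) r(2)] by (simp add: transit_cmap)
    qed
    moreover have "pd w (\<lambda>x. local_field c Z (?\<tau> x)) ?z = pd (pd w ?\<tau> ?z) (local_field c Z) (?\<tau> ?z)"
      by (rule pd_compose[OF S T sc \<tau> z]) (use c d U in \<open>auto simp: transit_cmap\<close>)
    moreover have "pd w (\<lambda>x. pd (local_field d Z x) ?\<tau> x) ?z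
        = pd w (\<lambda>x. pd (local_field d Z ?z) ?\<tau> x) ?z + pd (pd w (local_field d Z) ?z) ?\<tau> ?z"
      by (rule pd_linear_field[OF S z, where L="\<lambda>y a. pd a ?\<tau> y"])
         (intro smooth_on_linear_pd[OF S \<tau>] smooth_on_pd \<tau> sd | assumption)+
    moreover have "local_field d Z ?z = Z p" using d by (simp add: d_def)
    ultimately show ?thesis using d by (simp add: transit_cmap)
  qed
  have cp: "comps A c p v = pd v ?\<tau> ?z" for v by (simp add: comps_eq d_def)
  have "lie_bracket A X Y p = pd (X p) (local_field d Y) ?z - pd (Y p) (local_field d X) ?z"
    by (simp add: lie_bracket_def Let_def d_def local_field_def[abs_def])
  then show ?thesis
    unfolding cp key[OF X] key[OF Y]
    using pd_commute[OF S \<tau> z, of "X p" "Y p"] linear_diff[OF smooth_on_linear_pd[OF S \<tau> z]] by simp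
qed


lemma smooth_vf_subset: "smooth_vf_on A U X \<Longrightarrow> W \<subseteq> U \<Longrightarrow> smooth_vf_on A W X"
  unfolding smooth_vf_on_def by (blast intro: smooth_on_subset image_mono)

lemma smooth_vf_combination:
  fixes h :: "'i \<Rightarrow> 'm \<Rightarrow> real"
  assumes U: "open U" and I: "finite I"
    and h: "\<And>i. i \<in> I \<Longrightarrow> smooth_fun_on A U (h i)" and Y: "\<And>i. i \<in> I \<Longrightarrow> smooth_vf_on A U (Y i)"
  shows "smooth_vf_on A U (\<lambda>p. \<Sum>i\<in>I. h i p *\<^sub>R Y i p)"
  unfolding smooth_vf_on_def
proof
  fix c assume c: "c \<in> A"
  have S: "open (cmap c ` (cdom c \<inter> U))" by (intro open_image) (use c U in \<open>auto simp: open_Int\<close>)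
  show "smooth_on (cmap c ` (cdom c \<inter> U))
      (\<lambda>x. comps A c (cinv c x) (\<Sum>i\<in>I. h i (cinv c x) *\<^sub>R Y i (cinv c x)))"
  proof (rule smooth_on_cong[OF S])
    show "smooth_on (cmap c ` (cdom c \<inter> U)) (\<lambda>x. \<Sum>i\<in>I. h i (cinv c x) *\<^sub>R local_field c (Y i) x)"
      by (intro smooth_on_sum[OF S] smooth_on_scaleR[OF S] smooth_fun_loc[OF h] smooth_vf_loc[OF Y] I c)
    fix x assume "x \<in> cmap c ` (cdom c \<inter> U)"
    then have "cinv c x \<in> cdom c" using c by auto
    from comps_linear[OF c this]
    show "comps A c (cinv c x) (\<Sum>i\<in>I. h i (cinv c x) *\<^sub>R Y i (cinv c x))
        = (\<Sum>i\<in>I. h i (cinv c x) *\<^sub>R local_field c (Y i) x)"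
      by (simp add: linear_sum linear_scale local_field_def)
  qed
qed

text \<open>The components of a smooth field are smooth functions, so the field can be expanded in coordinate fields.\<close>

lemma smooth_fun_inner_loc:
  assumes c: "c \<in> A" and U: "open U" "U \<subseteq> cdom c" and Y: "smooth_vf_on A U Y"
  shows "smooth_fun_on A U (\<lambda>p. comps A c p (Y p) \<bullet> j)"
proof (rule smooth_fun_onI[OF c U])
  have "cdom c \<inter> U = U" using U by auto
  then have "smooth_on (cmap c ` U) (local_field c Y)" using smooth_vf_loc[OF Y c] by simp
  from smooth_on_inner_left[OF open_image[OF c U] this]
  show "smooth_on (cmap c ` U) (\<lambda>x. comps A c (cinv c x) (Y (cinv c x)) \<bullet> j)"
    by (simp add: local_field_def[abs_def])
qed


section \<open>Connection, metric and curvature in a chart\<close>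

text \<open>The Christoffel symbols, extended to arbitrary constant vectors \<open>a\<close> and \<open>b\<close> instead of basis vectors.\<close>

definition christoffel :: "('m \<Rightarrow> 'e \<Rightarrow> ('m \<Rightarrow> 'e) \<Rightarrow> 'e) \<Rightarrow> ('m, 'e) chart \<Rightarrow> 'e \<Rightarrow> 'e \<Rightarrow> 'e \<Rightarrow> 'e" where
  "christoffel nabla c x a b =
     comps A c (cinv c x) (nabla (cinv c x) (vec_of A c (cinv c x) a) (\<lambda>q. vec_of A c q b))"

lemma smooth_vf_coordinate: "c \<in> A \<Longrightarrow> smooth_vf_on A (cdom c) (\<lambda>q. vec_of A c q b)"
  using smooth_field_of[OF _ _ _ smooth_on_const[OF open_image], of c "cdom c" b]
  by (simp add: field_of_def[abs_def])

context
  fixes nabla :: "'m \<Rightarrow> 'e \<Rightarrow> ('m \<Rightarrow> 'e) \<Rightarrow> 'e"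
  assumes conn: "connection A nabla"
begin

lemma connection_axioms:
  assumes "open U" "p \<in> U" "smooth_vf_on A U Y"
  shows "linear (\<lambda>v. nabla p v Y)"
    and "(\<And>q. q \<in> U \<Longrightarrow> Z q = Y q) \<Longrightarrow> nabla p v Z = nabla p v Y"
    and "smooth_vf_on A U Z \<Longrightarrow> nabla p v (\<lambda>q. Y q + Z q) = nabla p v Y + nabla p v Z"
    and "smooth_fun_on A U h \<Longrightarrow>
      nabla p v (\<lambda>q. h q *\<^sub>R Y q) = dfun A h p v *\<^sub>R Y p + h p *\<^sub>R nabla p v Y"
proof -
  note ax = conn[unfolded connection_def, THEN conjunct1, rule_format, OF conjI[OF assms(1) conjI[OF assms(2,3)]]]
  show "linear (\<lambda>v. nabla p v Y)" by (rule ax[THEN conjunct1])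
  show "(\<And>q. q \<in> U \<Longrightarrow> Z q = Y q) \<Longrightarrow> nabla p v Z = nabla p v Y"
    by (rule ax[THEN conjunct2, THEN conjunct1, rule_format])
  show "smooth_vf_on A U Z \<Longrightarrow> nabla p v (\<lambda>q. Y q + Z q) = nabla p v Y + nabla p v Z"
    by (rule ax[THEN conjunct2, THEN conjunct2, THEN conjunct1, rule_format])
  show "smooth_fun_on A U h \<Longrightarrow>
      nabla p v (\<lambda>q. h q *\<^sub>R Y q) = dfun A h p v *\<^sub>R Y p + h p *\<^sub>R nabla p v Y"
    by (rule ax[THEN conjunct2, THEN conjunct2, THEN conjunct2, rule_format])
qed

lemmas nabla_linear = connection_axioms(1)
lemmas nabla_local = connection_axioms(2)
lemmas nabla_add = connection_axioms(3)
lemmas nabla_scale = connection_axioms(4)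

lemma nabla_smooth:
  "open U \<Longrightarrow> smooth_vf_on A U X \<Longrightarrow> smooth_vf_on A U Y \<Longrightarrow> smooth_vf_on A U (\<lambda>q. nabla q (X q) Y)"
  by (rule conn[unfolded connection_def, THEN conjunct2, rule_format]) blast

lemma nabla_zero:
  assumes U: "open U" "p \<in> U" shows "nabla p v (\<lambda>q. 0) = 0"
proof -
  have z: "smooth_vf_on A U (\<lambda>q. 0)"
    using smooth_vf_combination[OF U(1), of "{}"] by simp
  \<comment> \<open>Additivity for the decomposition \<open>0 = 0 + 0\<close>.\<close>
  have "nabla p v (\<lambda>q. 0) = nabla p v (\<lambda>q. 0) + nabla p v (\<lambda>q. 0)"
    using nabla_add[OF U z z, of v] by simp
  then show ?thesis by simp
qed

lemma nabla_combination:
  fixes h :: "'i \<Rightarrow> 'm \<Rightarrow> real"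
  assumes U: "open U" "p \<in> U" and I: "finite I"
    and h: "\<And>i. i \<in> I \<Longrightarrow> smooth_fun_on A U (h i)" and Y: "\<And>i. i \<in> I \<Longrightarrow> smooth_vf_on A U (Y i)"
  shows "nabla p v (\<lambda>p. \<Sum>i\<in>I. h i p *\<^sub>R Y i p)
    = (\<Sum>i\<in>I. dfun A (h i) p v *\<^sub>R Y i p + h i p *\<^sub>R nabla p v (Y i))"
  using I h Y
proof (induction I rule: finite_induct)
  case empty
  then show ?case using nabla_zero[OF U] by simp
next
  case (insert i I)
  have 1: "smooth_vf_on A U (\<lambda>p. \<Sum>i\<in>I. h i p *\<^sub>R Y i p)"
    by (rule smooth_vf_combination[OF U(1)]) (use insert in auto)
  have 2: "smooth_vf_on A U (\<lambda>p. h i p *\<^sub>R Y i p)"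
    using smooth_vf_combination[OF U(1), of "{i}" h Y] insert.prems by simp
  show ?case
    using nabla_add[OF U 2 1, of v] nabla_scale[OF U, of "Y i" "h i" v] insert by simp
qed

text \<open>Near \<open>p\<close> the field is a combination of coordinate fields with smooth coefficients; locality, additivity
and the Leibniz rule then determine its covariant derivative.\<close>

lemma nabla_chart_sum:
  assumes c: "c \<in> A" "p \<in> cdom c" and U: "open U" "p \<in> U" and Y: "smooth_vf_on A U Y"
  shows "comps A c p (nabla p v Y) = pd (comps A c p v) (local_field c Y) (cmap c p)
    + (\<Sum>j\<in>Basis. (comps A c p (Y p) \<bullet> j) *\<^sub>R christoffel nabla c (cmap c p) (comps A c p v) j)"
proof -
  let ?W = "cdom c \<inter> U"
  have W: "open ?W" "p \<in> ?W" "?W \<subseteq> cdom c" using c U by (auto simp: open_Int)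
  have S: "open (cmap c ` ?W)" by (rule open_image[OF c(1) W(1,3)])
  have x: "cmap c p \<in> cmap c ` ?W" using W by auto
  define h where "h j q = comps A c q (Y q) \<bullet> j" for j q
  have YW: "smooth_vf_on A ?W Y" by (rule smooth_vf_subset[OF Y]) auto
  have h: "smooth_fun_on A ?W (h j)" for j
    unfolding h_def by (rule smooth_fun_inner_loc[OF c(1) W(1,3) YW])
  have co: "smooth_vf_on A ?W (\<lambda>q. vec_of A c q j)" for j
    by (rule smooth_vf_subset[OF smooth_vf_coordinate[OF c(1)]]) auto
  have eq: "(\<Sum>j\<in>Basis. h j q *\<^sub>R vec_of A c q j) = Y q" if "q \<in> ?W" for q
    unfolding h_def using that c linear_expand[OF vec_of_linear[of c q], of "comps A c q (Y q)"] by simp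
  have dh: "dfun A (h j) p v = pd (comps A c p v) (local_field c Y) (cmap c p) \<bullet> j" for j
  proof -
    have "dfun A (h j) p v = pd (comps A c p v) (\<lambda>x. h j (cinv c x)) (cmap c p)"
      by (rule dfun_chart[OF c W(1,2) h])
    then show ?thesis
      using pd_bounded_linear[OF S smooth_vf_loc[OF Y c(1)] x bounded_linear_inner_left, of j "comps A c p v"]
      by (simp add: h_def local_field_def[abs_def])
  qed
  have "nabla p v Y = nabla p v (\<lambda>q. \<Sum>j\<in>Basis. h j q *\<^sub>R vec_of A c q j)"
    by (rule nabla_local[OF W(1,2) smooth_vf_combination[OF W(1) finite_Basis h co]]) (simp add: eq)
  also have "\<dots> = (\<Sum>j\<in>Basis. dfun A (h j) p v *\<^sub>R vec_of A c p j + h j p *\<^sub>R nabla p v (\<lambda>q. vec_of A c q j))"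
    by (rule nabla_combination[OF W(1,2) finite_Basis h co])
  finally have "comps A c p (nabla p v Y)
      = (\<Sum>j\<in>Basis. dfun A (h j) p v *\<^sub>R j + h j p *\<^sub>R christoffel nabla c (cmap c p) (comps A c p v) j)"
    using c by (simp add: christoffel_def linear_sum[OF comps_linear[OF c]]
      linear_add[OF comps_linear[OF c]] linear_scale[OF comps_linear[OF c]])
  then show ?thesis
    by (simp add: dh sum.distrib euclidean_representation h_def)
qed

text \<open>Linearity in \<open>b\<close> comes from \<open>nabla_chart_sum\<close> applied to the coordinate field with constant
components \<open>b\<close>, whose derivative term vanishes.\<close>

lemma christoffel_linear_right:
  assumes c: "c \<in> A" and x: "x \<in> cmap c ` cdom c"
  shows "linear (christoffel nabla c x a)"
proof -
  obtain p where p: "p \<in> cdom c" "x = cmap c p" using x by auto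
  have eq: "christoffel nabla c x a b = (\<Sum>j\<in>Basis. (b \<bullet> j) *\<^sub>R christoffel nabla c x a j)" for b
  proof -
    have "pd a (local_field c (\<lambda>q. vec_of A c q b)) x = pd a (\<lambda>_. b) x"
      by (rule pd_cong_open[OF open_image[OF c chart_open[OF c] order_refl] x])
         (use c in \<open>auto simp: local_field_def\<close>)
    then show ?thesis
      using nabla_chart_sum[OF c p(1) chart_open[OF c] p(1) smooth_vf_coordinate[OF c], of "vec_of A c p a" b] c p
      by (simp add: christoffel_def)
  qed
  have "linear (\<lambda>b. \<Sum>j\<in>Basis. (b \<bullet> j) *\<^sub>R christoffel nabla c x a j)"
    by (intro linear_compose_sum ballI linearI) (simp_all add: inner_add_left scaleR_add_left)
  then show ?thesis by (rule back_subst[of linear]) (rule ext, rule eq[symmetric])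
qed

lemma nabla_chart:
  assumes c: "c \<in> A" "p \<in> cdom c" and U: "open U" "p \<in> U" and Y: "smooth_vf_on A U Y"
  shows "comps A c p (nabla p v Y) = nab (christoffel nabla c) (comps A c p v) (local_field c Y) (cmap c p)"
  using nabla_chart_sum[OF assms, of v] c
    linear_expand[OF christoffel_linear_right[OF c(1), of "cmap c p" "comps A c p v"], of "comps A c p (Y p)"]
  by (simp add: nab_eq)

lemma christoffel_field:
  assumes c: "c \<in> A"
  shows "bilinear_field (cmap c ` cdom c) (christoffel nabla c)"
  unfolding bilinear_field_def bilinear_def
proof (intro conjI ballI allI)
  fix x a b assume x: "x \<in> cmap c ` cdom c"
  then obtain p where p: "p \<in> cdom c" "x = cmap c p" by auto
  show "linear (christoffel nabla c x a)" by (rule christoffel_linear_right[OF c x])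
  have "linear (\<lambda>v. nabla p v (\<lambda>q. vec_of A c q b))"
    by (rule nabla_linear[OF chart_open[OF c] p(1) smooth_vf_coordinate[OF c]])
  from linear_compose[OF linear_compose[OF vec_of_linear[OF c p(1)] this] comps_linear[OF c p(1)]]
  show "linear (\<lambda>a. christoffel nabla c x a b)"
    using c p by (simp add: christoffel_def o_def)
next
  fix a b
  have "smooth_vf_on A (cdom c) (\<lambda>q. nabla q (vec_of A c q a) (\<lambda>q. vec_of A c q b))"
    by (intro nabla_smooth chart_open smooth_vf_coordinate c)
  from smooth_vf_loc[OF this c] show "smooth_on (cmap c ` cdom c) (\<lambda>x. christoffel nabla c x a b)"
    by (simp add: local_field_def[abs_def] christoffel_def)
qed

end

definition metric_chart :: "('m \<Rightarrow> 'e \<Rightarrow> 'e \<Rightarrow> real) \<Rightarrow> ('m, 'e) chart \<Rightarrow> 'e \<Rightarrow> 'e \<Rightarrow> 'e \<Rightarrow> real" where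
  "metric_chart g c x a b = g (cinv c x) (vec_of A c (cinv c x) a) (vec_of A c (cinv c x) b)"

lemma metric_chart_comps:
  "c \<in> A \<Longrightarrow> p \<in> cdom c \<Longrightarrow> g p u v = metric_chart g c (cmap c p) (comps A c p u) (comps A c p v)"
  by (simp add: metric_chart_def)

text \<open>Smoothness of the entries on basis vectors suffices.  \<open>U\<close> may be smaller than the domain of the chart; for the
induced metric it is the part mapped into one chart of the target.\<close>

lemma metric_chart_field:
  assumes c: "c \<in> A" and U: "open U" "U \<subseteq> cdom c" and ip: "\<And>p. p \<in> U \<Longrightarrow> inner_product (g p)"
    and sm: "\<And>i j. i \<in> Basis \<Longrightarrow> j \<in> Basis \<Longrightarrow> smooth_on (cmap c ` U) (\<lambda>x. metric_chart g c x i j)"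
  shows "bilinear_field (cmap c ` U) (metric_chart g c)" "x \<in> cmap c ` U \<Longrightarrow> inner_product (metric_chart g c x)"
proof -
  have S: "open (cmap c ` U)" by (rule open_image[OF c U])
  have ip': "inner_product (metric_chart g c x)" if x: "x \<in> cmap c ` U" for x
  proof -
    obtain p where p: "p \<in> U" "x = cmap c p" "p \<in> cdom c" using x U by auto
    note G = inner_productD[OF ip[OF p(1)]] and lin = vec_of_linear[OF c p(3)]
    have nz: "vec_of A c p u \<noteq> 0" if "u \<noteq> 0" for u
      using that comps_vec_of[OF c p(3), of u] linear_0[OF comps_linear[OF c p(3)]] by auto
    show ?thesis
      unfolding inner_product_def bilinear_def metric_chart_def[abs_def]
      using linear_compose[OF lin bilinear_linear(1)[OF G(1)]] linear_compose[OF lin bilinear_linear(2)[OF G(1)]]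
        G(2,3) nz p c by (auto simp: o_def)
  qed
  then show "x \<in> cmap c ` U \<Longrightarrow> inner_product (metric_chart g c x)" .
  show "bilinear_field (cmap c ` U) (metric_chart g c)"
    unfolding bilinear_field_def
  proof (intro conjI ballI allI)
    show "bilinear (metric_chart g c x)" if "x \<in> cmap c ` U" for x
      by (rule inner_productD(1)[OF ip'[OF that]])
    fix u v
    show "smooth_on (cmap c ` U) (\<lambda>x. metric_chart g c x u v)"
    proof (rule smooth_on_cong[OF S])
      show "smooth_on (cmap c ` U) (\<lambda>x. \<Sum>i\<in>Basis. \<Sum>j\<in>Basis. ((u \<bullet> i) * (v \<bullet> j)) *\<^sub>R metric_chart g c x i j)"
        by (intro smooth_on_sum[OF S] smooth_on_scaleR[OF S] smooth_on_const[OF S] sm finite_Basis)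
      show "metric_chart g c x u v = (\<Sum>i\<in>Basis. \<Sum>j\<in>Basis. ((u \<bullet> i) * (v \<bullet> j)) *\<^sub>R metric_chart g c x i j)"
        if "x \<in> cmap c ` U" for x
      proof -
        note bil = inner_productD(1)[OF ip'[OF that]]
        have "metric_chart g c x u v = (\<Sum>i\<in>Basis. (u \<bullet> i) *\<^sub>R metric_chart g c x i v)"
          by (rule linear_expand[OF bilinear_linear(2)[OF bil]])
        also have "\<dots> = (\<Sum>i\<in>Basis. (u \<bullet> i) *\<^sub>R (\<Sum>j\<in>Basis. (v \<bullet> j) *\<^sub>R metric_chart g c x i j))"
          by (intro sum.cong refl arg_cong2[where f=scaleR] linear_expand[OF bilinear_linear(1)[OF bil]])
        finally show ?thesis by (simp add: sum_distrib_left mult.assoc)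
      qed
    qed
  qed
qed

text \<open>The axioms of the Riemannian connection, evaluated on coordinate fields, whose brackets vanish, are
exactly the symmetry and the metric compatibility of the Christoffel symbols.\<close>

lemma levi_civita_chart:
  assumes c: "c \<in> A" and U: "open U" "U \<subseteq> cdom c" and ip: "\<And>p. p \<in> U \<Longrightarrow> inner_product (g p)"
    and G: "bilinear_field (cmap c ` U) (metric_chart g c)"
    and rc: "riemannian_connection A g nabla"
  shows "levi_civita_along (cmap c ` U) (cmap c ` U) (\<lambda>x. x) (metric_chart g c) (christoffel nabla c)"
proof -
  have conn: "connection A nabla" using rc by (simp add: riemannian_connection_def)
  have S: "open (cmap c ` U)" by (rule open_image[OF c U])
  have co: "smooth_vf_on A U (\<lambda>q. vec_of A c q b)" for b
    by (rule smooth_vf_subset[OF smooth_vf_coordinate[OF c] U(2)])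
  have const: "pd w (local_field c (\<lambda>q. vec_of A c q b)) x = 0" if "x \<in> cmap c ` U" for b w x
  proof -
    have "pd w (local_field c (\<lambda>q. vec_of A c q b)) x = pd w (\<lambda>_. b) x"
      by (rule pd_cong_open[OF S that]) (use c U in \<open>auto simp: local_field_def subset_iff\<close>)
    then show ?thesis by simp
  qed
  have christ: "comps A c p (nabla p (vec_of A c p a) (\<lambda>q. vec_of A c q b)) = christoffel nabla c (cmap c p) a b"
    if "p \<in> cdom c" for p a b
    using that c by (simp add: christoffel_def)
  show ?thesis
  proof
    show "bilinear_field (cmap c ` U) (christoffel nabla c)"
      using christoffel_field[OF conn c] smooth_on_subset[of "cmap c ` cdom c" _ "cmap c ` U"] U
      unfolding bilinear_field_def by blast
    fix y assume "y \<in> cmap c ` U"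
    then obtain p where p: "p \<in> U" "y = cmap c p" "p \<in> cdom c" using U by auto
    note y = \<open>y \<in> cmap c ` U\<close>[unfolded p(2)]
    show "inner_product (metric_chart g c y)"
      by (rule metric_chart_field(2)[OF c U ip _ \<open>y \<in> cmap c ` U\<close>])
         (use G in \<open>auto simp: bilinear_field_def\<close>)
    fix a b
    note ax = rc[unfolded riemannian_connection_def, THEN conjunct2, rule_format, OF conjI[OF U(1) conjI[OF p(1) conjI[OF co co]]]]
    have "nabla p (vec_of A c p a) (\<lambda>q. vec_of A c q b) - nabla p (vec_of A c p b) (\<lambda>q. vec_of A c q a)
        = lie_bracket A (\<lambda>q. vec_of A c q a) (\<lambda>q. vec_of A c q b) p"
      by (rule ax[THEN conjunct1])
    then have "christoffel nabla c y a b - christoffel nabla c y b a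
        = comps A c p (lie_bracket A (\<lambda>q. vec_of A c q a) (\<lambda>q. vec_of A c q b) p)"
      using christ[OF p(3)] linear_diff[OF comps_linear[OF c p(3)]] p(2) by metis
    also have "\<dots> = 0"
      using lie_bracket_chart[OF c p(3) U(1) p(1) co co] const[OF y] by simp
    finally show "christoffel nabla c y a b = christoffel nabla c y b a" by simp
    fix w
    have "smooth_fun_on A U (\<lambda>q. g q (vec_of A c q a) (vec_of A c q b))"
      by (rule smooth_fun_onI[OF c U]) (use G in \<open>auto simp: bilinear_field_def metric_chart_def[abs_def]\<close>)
    from dfun_chart[OF c p(3) U(1) p(1) this, of "vec_of A c p w"]
    have "pd w (\<lambda>y. metric_chart g c y a b) y = dfun A (\<lambda>q. g q (vec_of A c q a) (vec_of A c q b)) p (vec_of A c p w)"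
      using c p by (simp add: metric_chart_def[abs_def])
    also have "\<dots> = g p (nabla p (vec_of A c p w) (\<lambda>q. vec_of A c q a)) (vec_of A c p b)
        + g p (vec_of A c p a) (nabla p (vec_of A c p w) (\<lambda>q. vec_of A c q b))"
      by (rule ax[THEN conjunct2, rule_format])
    finally show "pd w (\<lambda>y. metric_chart g c y a b) y = metric_chart g c y (christoffel nabla c y w a) b
        + metric_chart g c y a (christoffel nabla c y w b)"
      using metric_chart_comps[OF c p(3), of g] c p christ[OF p(3)] by simp
  qed (use S G in \<open>auto intro: smooth_on_ident\<close>)
qed


text \<open>For coordinate fields the bracket with \<open>V\<close> is \<open>- pd b V\<close>, and the derivative of the metric in direction \<open>V\<close>
is expressed by \<open>\<Gamma>\<close>; together they form the covariant derivative of \<open>V\<close>.\<close>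

lemma killing_chart:
  assumes c: "c \<in> A" and lc: "levi_civita_along (cmap c ` cdom c) (cmap c ` cdom c) (\<lambda>x. x) (metric_chart g c) \<Gamma>"
    and V: "killing_field A g V"
  shows "levi_civita_along.killing (cmap c ` cdom c) (metric_chart g c) \<Gamma> (local_field c V)"
proof -
  interpret L: levi_civita_along "cmap c ` cdom c" "cmap c ` cdom c" "\<lambda>x. x" "metric_chart g c" \<Gamma> by (rule lc)
  have sV: "smooth_vf_on A UNIV V" using V by (simp add: killing_field_def)
  have sV': "smooth_on (cmap c ` cdom c) (local_field c V)" using smooth_vf_loc[OF sV c] by simp
  have co: "smooth_vf_on A (cdom c) (\<lambda>q. vec_of A c q b)" for b
    by (rule smooth_vf_coordinate[OF c])
  have "metric_chart g c y (nab \<Gamma> a (local_field c V) y) b + metric_chart g c y a (nab \<Gamma> b (local_field c V) y) = 0"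
    if y: "y \<in> cmap c ` cdom c" for y a b
  proof -
    obtain p where p: "p \<in> cdom c" "y = cmap c p" using y by auto
    note comb = metric_chart_comps[OF c p(1), of g]
    have br: "comps A c p (lie_bracket A V (\<lambda>q. vec_of A c q b) p) = - pd b (local_field c V) y" for b
    proof -
      have "pd w (local_field c (\<lambda>q. vec_of A c q b)) y = pd w (\<lambda>_. b) y" for w
        by (rule pd_cong_open[OF L.open_S y]) (use c in \<open>auto simp: local_field_def\<close>)
      then show ?thesis
        using lie_bracket_chart[OF c p(1) chart_open[OF c] p(1) smooth_vf_subset[OF sV subset_UNIV] co] c p by simp
    qed
    have sg: "smooth_fun_on A (cdom c) (\<lambda>q. g q (vec_of A c q a) (vec_of A c q b))"
      by (rule smooth_fun_onI[OF c chart_open[OF c] order_refl])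
         (use L.G_field in \<open>auto simp: bilinear_field_def metric_chart_def[abs_def]\<close>)
    have "metric_chart g c y (\<Gamma> y (local_field c V y) a) b + metric_chart g c y a (\<Gamma> y (local_field c V y) b)
        = pd (local_field c V y) (\<lambda>y. metric_chart g c y a b) y"
      using L.compat[OF y] by simp
    also have "\<dots> = dfun A (\<lambda>q. g q (vec_of A c q a) (vec_of A c q b)) p (V p)"
      using dfun_chart[OF c p(1) chart_open[OF c] p(1) sg, of "V p"] c p by (simp add: metric_chart_def[abs_def])
    also have "\<dots> = g p (lie_bracket A V (\<lambda>q. vec_of A c q a) p) (vec_of A c p b)
        + g p (vec_of A c p a) (lie_bracket A V (\<lambda>q. vec_of A c q b) p)"
      by (rule V[unfolded killing_field_def, THEN conjunct2, rule_format,
            OF conjI[OF chart_open[OF c] conjI[OF p(1) conjI[OF co co]]]])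
    also have "\<dots> = - metric_chart g c y (pd a (local_field c V) y) b - metric_chart g c y a (pd b (local_field c V) y)"
      unfolding comb br using c p L.G_lin[OF y] by simp
    finally show ?thesis
      using L.\<Gamma>_sym[OF y, of "local_field c V y"] by (simp add: nab_eq L.G_lin[OF y])
  qed
  then show ?thesis using sV' by (simp add: L.killing_def)
qed

text \<open>\<open>Riem_fields\<close> shows that the value is the same for all extensions, and the fields with constant
components in \<open>c\<close> are extensions; so the definite description is meaningful.\<close>

lemma curvature_chart:
  assumes rc: "riemannian_connection A g nabla" and ip: "\<And>p. inner_product (g p)"
    and c: "c \<in> A" "p \<in> cdom c" and G: "bilinear_field (cmap c ` cdom c) (metric_chart g c)"
  shows "comps A c p (curvature A nabla p x y z)
    = Riem (christoffel nabla c) (cmap c p) (comps A c p x) (comps A c p y) (comps A c p z)"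
proof -
  have conn: "connection A nabla" using rc by (simp add: riemannian_connection_def)
  let ?\<Gamma> = "christoffel nabla c"
  have key: "comps A c p (nabla p (Y p) (\<lambda>q. nabla q (X q) Z) - nabla p (X p) (\<lambda>q. nabla q (Y q) Z)
        + nabla p (lie_bracket A X Y p) Z)
      = Riem ?\<Gamma> (cmap c p) (comps A c p (X p)) (comps A c p (Y p)) (comps A c p (Z p))"
    if U: "open U" "p \<in> U" and X: "smooth_vf_on A U X" and Y: "smooth_vf_on A U Y" and Z: "smooth_vf_on A U Z"
    for U X Y Z
  proof -
    let ?W = "cdom c \<inter> U"
    have W: "open ?W" "?W \<subseteq> cdom c" "p \<in> ?W" using c U by (auto simp: open_Int)
    have pW: "cmap c p \<in> cmap c ` ?W" using W by auto
    have GW: "bilinear_field (cmap c ` ?W) (metric_chart g c)"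
      using G smooth_on_subset[of "cmap c ` cdom c" _ "cmap c ` ?W"] unfolding bilinear_field_def by blast
    interpret L: levi_civita_along "cmap c ` ?W" "cmap c ` ?W" "\<lambda>x. x" "metric_chart g c" ?\<Gamma>
      by (rule levi_civita_chart[OF c(1) W(1,2) ip GW rc])
    note sm = smooth_vf_loc[OF X c(1)] smooth_vf_loc[OF Y c(1)] smooth_vf_loc[OF Z c(1)]
    have nab1: "comps A c p (nabla p v (\<lambda>q. nabla q (X q) Z))
        = nab ?\<Gamma> (comps A c p v) (\<lambda>y. nab ?\<Gamma> (local_field c X y) (local_field c Z) y) (cmap c p)"
      if X: "smooth_vf_on A U X" for v X
    proof -
      have "comps A c p (nabla p v (\<lambda>q. nabla q (X q) Z))
          = nab ?\<Gamma> (comps A c p v) (local_field c (\<lambda>q. nabla q (X q) Z)) (cmap c p)"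
        by (rule nabla_chart[OF conn c U nabla_smooth[OF conn U(1) X Z]])
      also have "\<dots> = nab ?\<Gamma> (comps A c p v) (\<lambda>y. nab ?\<Gamma> (local_field c X y) (local_field c Z) y) (cmap c p)"
      proof (rule L.cov_cong[OF pW])
        fix y assume "y \<in> cmap c ` ?W"
        then obtain r where r: "r \<in> cdom c" "r \<in> U" "y = cmap c r" by auto
        show "local_field c (\<lambda>q. nabla q (X q) Z) y = nab ?\<Gamma> (local_field c X y) (local_field c Z) y"
          using nabla_chart[OF conn c(1) r(1) U(1) r(2) Z, of "X r"] c r by simp
      qed
      finally show ?thesis .
    qed
    show ?thesis
      using L.Riem_fields[OF sm(3,1,2) pW] c nabla_chart[OF conn c U Z, of "lie_bracket A X Y p"]
      by (simp add: linear_add[OF comps_linear[OF c]] linear_diff[OF comps_linear[OF c]]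
          nab1[OF X] nab1[OF Y] lie_bracket_chart[OF c U X Y])
  qed
  let ?r = "vec_of A c p (Riem ?\<Gamma> (cmap c p) (comps A c p x) (comps A c p y) (comps A c p z))"
  have "curvature A nabla p x y z = ?r"
    unfolding curvature_def
  proof (rule the_equality)
    show "\<forall>U X Y Z. open U \<and> p \<in> U \<and> smooth_vf_on A U X \<and> smooth_vf_on A U Y \<and> smooth_vf_on A U Z \<and>
        X p = x \<and> Y p = y \<and> Z p = z \<longrightarrow>
        nabla p y (\<lambda>q. nabla q (X q) Z) - nabla p x (\<lambda>q. nabla q (Y q) Z) + nabla p (lie_bracket A X Y p) Z = ?r"
    proof (intro allI impI, elim conjE)
      fix U X Y Z
      assume U: "open U" "p \<in> U" and XYZ: "smooth_vf_on A U X" "smooth_vf_on A U Y" "smooth_vf_on A U Z"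
        and p: "X p = x" "Y p = y" "Z p = z"
      show "nabla p y (\<lambda>q. nabla q (X q) Z) - nabla p x (\<lambda>q. nabla q (Y q) Z) + nabla p (lie_bracket A X Y p) Z = ?r"
        by (rule comps_inject[OF c]) (use key[OF U XYZ] c p in simp)
    qed
    let ?e = "\<lambda>v q. vec_of A c q (comps A c p v)"
    fix r assume "\<forall>U X Y Z. open U \<and> p \<in> U \<and> smooth_vf_on A U X \<and> smooth_vf_on A U Y \<and> smooth_vf_on A U Z \<and>
        X p = x \<and> Y p = y \<and> Z p = z \<longrightarrow>
        nabla p y (\<lambda>q. nabla q (X q) Z) - nabla p x (\<lambda>q. nabla q (Y q) Z) + nabla p (lie_bracket A X Y p) Z = r"
    from this[rule_format, of "cdom c" "?e x" "?e y" "?e z"]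
    have "nabla p y (\<lambda>q. nabla q (?e x q) (?e z)) - nabla p x (\<lambda>q. nabla q (?e y q) (?e z))
        + nabla p (lie_bracket A (?e x) (?e y) p) (?e z) = r"
      using c smooth_vf_coordinate[OF c(1)] by simp
    then show "r = ?r"
      using key[OF chart_open[OF c(1)] c(2) smooth_vf_coordinate[OF c(1)] smooth_vf_coordinate[OF c(1)]
          smooth_vf_coordinate[OF c(1)], of "comps A c p y" "comps A c p x" "comps A c p z"] c
      by (intro comps_inject[OF c, of r]) simp
  qed
  then show ?thesis using c by simp
qed

end


section \<open>Immersions in charts\<close>

locale riemannian_immersion =
  M: smooth_manifold A + N: smooth_manifold B
  for A :: "('m::{t2_space, second_countable_topology}, 'e::euclidean_space) chart set"
    and B :: "('n::{t2_space, second_countable_topology}, 'd::euclidean_space) chart set" +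
  fixes g :: "'n \<Rightarrow> 'd \<Rightarrow> 'd \<Rightarrow> real" and nabla :: "'n \<Rightarrow> 'd \<Rightarrow> ('n \<Rightarrow> 'd) \<Rightarrow> 'd" and F :: "'m \<Rightarrow> 'n"
  assumes metric: "riemannian_metric B g" and rconn: "riemannian_connection B g nabla"
    and imm: "immersion A B F"
begin

lemma conn: "connection B nabla"
  using rconn by (simp add: riemannian_connection_def)

lemma g_inner: "inner_product (g p)"
  using metric by (simp add: riemannian_metric_def)

definition local_map :: "('m, 'e) chart \<Rightarrow> ('n, 'd) chart \<Rightarrow> 'e \<Rightarrow> 'd" where
  "local_map c d x = cmap d (F (cinv c x))"

definition local_section :: "('m, 'e) chart \<Rightarrow> ('n, 'd) chart \<Rightarrow> ('m \<Rightarrow> 'd) \<Rightarrow> 'e \<Rightarrow> 'd" where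
  "local_section c d \<xi> x = comps B d (F (cinv c x)) (\<xi> (cinv c x))"

lemma open_dom: "c \<in> A \<Longrightarrow> d \<in> B \<Longrightarrow> open (cdom c \<inter> F -` cdom d)"
  using imm N.chart_open M.chart_open
  by (auto simp: immersion_def smooth_map_def intro!: open_Int open_vimage)

lemma smooth_local_map:
  "c \<in> A \<Longrightarrow> d \<in> B \<Longrightarrow> smooth_on (cmap c ` (cdom c \<inter> F -` cdom d)) (local_map c d)"
  using imm by (simp add: immersion_def smooth_map_def local_map_def[abs_def] o_def)

lemma local_map_cmap [simp]: "c \<in> A \<Longrightarrow> p \<in> cdom c \<Longrightarrow> local_map c d (cmap c p) = cmap d (F p)"
  by (simp add: local_map_def)

lemma local_section_cmap [simp]: "c \<in> A \<Longrightarrow> p \<in> cdom c \<Longrightarrow> local_section c d \<xi> (cmap c p) = comps B d (F p) (\<xi> p)"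
  by (simp add: local_section_def)

lemma dmap_chart:
  assumes c: "c \<in> A" "p \<in> cdom c" and d: "d \<in> B" "F p \<in> cdom d"
  shows "comps B d (F p) (dmap A B F p v) = pd (comps A c p v) (local_map c d) (cmap c p)"
proof -
  define c0 d0 where "c0 = chart_at A p" and "d0 = chart_at B (F p)"
  have c0: "c0 \<in> A" "p \<in> cdom c0" and d0: "d0 \<in> B" "F p \<in> cdom d0"
    using M.chart_at N.chart_at by (auto simp: c0_def d0_def)
  let ?W = "(cdom c0 \<inter> F -` cdom d0) \<inter> (cdom c0 \<inter> F -` cdom d)"
  let ?S = "cmap c0 ` ?W" and ?T = "cmap d0 ` (cdom d0 \<inter> cdom d)" and ?z = "cmap c0 p"
  have S: "open ?S"
    by (rule M.open_image[OF c0(1)]) (use open_dom[OF c0(1) d0(1)] open_dom[OF c0(1) d(1)] in \<open>auto intro: open_Int\<close>)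
  have z: "?z \<in> ?S" using c0 d0 d by auto
  have "pd v (\<lambda>x. N.transit d0 d (local_map c0 d0 x)) ?z = pd (pd v (local_map c0 d0) ?z) (N.transit d0 d) (local_map c0 d0 ?z)"
    by (rule pd_compose[OF S N.open_overlap[OF d0(1) d(1)] N.smooth_transit[OF d0(1) d(1)]
          smooth_on_subset[OF smooth_local_map[OF c0(1) d0(1)]] z]) (use c0 d d0 in auto)
  moreover have "pd v (\<lambda>x. N.transit d0 d (local_map c0 d0 x)) ?z = pd v (\<lambda>x. cmap d (F (cinv c0 x))) ?z"
    by (rule pd_cong_open[OF S z]) (use c0 d0 in \<open>auto simp: N.transit_cmap\<close>)
  moreover have "pd v (\<lambda>x. cmap d (F (cinv c0 x))) ?z
      = pd (pd v (M.transit c0 c) ?z) (\<lambda>x. cmap d (F (cinv c x))) (cmap c p)"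
    by (rule M.pd_chart_change[OF c0 c open_dom[OF c(1) d(1)]])
       (use smooth_local_map[OF c(1) d(1)] c d in \<open>auto simp: local_map_def[abs_def]\<close>)
  ultimately show ?thesis
    using c0 d0 by (simp add: dmap_def N.comps_eq M.comps_eq c0_def[symmetric] d0_def[symmetric]
        local_map_def[abs_def] o_def)
qed

lemma smooth_section_sec:
  "smooth_section_on A B F U \<xi> \<Longrightarrow> c \<in> A \<Longrightarrow> d \<in> B \<Longrightarrow>
    smooth_on (cmap c ` (cdom c \<inter> F -` cdom d \<inter> U)) (local_section c d \<xi>)"
  by (simp add: smooth_section_on_def local_section_def[abs_def])

text \<open>Both charts change at once: the one of the source by composition, the one of the target by a linear map depending on the point.\<close>

lemma smooth_section_onI:
  assumes c: "c \<in> A" and d: "d \<in> B" and W: "open W" "W \<subseteq> cdom c \<inter> F -` cdom d"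
    and sm: "smooth_on (cmap c ` W) (local_section c d \<xi>)"
  shows "smooth_section_on A B F W \<xi>"
  unfolding smooth_section_on_def
proof (intro ballI)
  fix c' d' assume c': "c' \<in> A" and d': "d' \<in> B"
  let ?W = "cdom c' \<inter> F -` cdom d' \<inter> W"
  have oW: "open ?W" "?W \<subseteq> cdom c" using open_dom[OF c' d'] W by (auto intro: open_Int)
  have S: "open (cmap c ` ?W)" by (rule M.open_image[OF c oW])
  have tr: "smooth_on (cmap c ` ?W) (\<lambda>y. pd a (N.transit d d') (local_map c d y))" for a
    by (rule smooth_on_compose[OF S N.open_overlap[OF d d'] smooth_on_pd[OF N.smooth_transit[OF d d']]
          smooth_on_subset[OF smooth_local_map[OF c d]]]) (use W c in \<open>auto simp: subset_iff\<close>)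
  have "smooth_on (cmap c ` ?W) (\<lambda>y. pd (local_section c d \<xi> y) (N.transit d d') (local_map c d y))"
  proof (rule smooth_on_linear_field[OF S, where L="\<lambda>y a. pd a (N.transit d d') (local_map c d y)", OF _ tr])
    show "linear (\<lambda>a. pd a (N.transit d d') (local_map c d y))" if y: "y \<in> cmap c ` ?W" for y
    proof -
      obtain p where p: "p \<in> ?W" "y = cmap c p" using y by auto
      then have "p \<in> cdom c" "F p \<in> cdom d" "F p \<in> cdom d'" using W by auto
      then show ?thesis using N.pd_transit_linear[OF d _ d'] p c by simp
    qed
    show "smooth_on (cmap c ` ?W) (local_section c d \<xi>)" by (rule smooth_on_subset[OF sm]) auto
  qed
  from M.smooth_transfer[OF c' c oW this]
  have sm': "smooth_on (cmap c' ` ?W) (\<lambda>x. pd (local_section c d \<xi> (M.transit c' c x)) (N.transit d d') (local_map c d (M.transit c' c x)))"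
    by (simp add: Int_assoc[symmetric] Int_left_absorb)
  show "smooth_on (cmap c' ` ?W) (\<lambda>x. comps B d' (F (cinv c' x)) (\<xi> (cinv c' x)))"
  proof (rule smooth_on_cong[OF _ sm'])
    show "open (cmap c' ` ?W)" by (rule M.open_image[OF c' oW(1)]) auto
    fix x assume "x \<in> cmap c' ` ?W"
    then obtain p where p: "p \<in> ?W" "x = cmap c' p" by auto
    then have "p \<in> cdom c" "F p \<in> cdom d" "p \<in> cdom c'" "F p \<in> cdom d'" using W by auto
    then show "comps B d' (F (cinv c' x)) (\<xi> (cinv c' x))
        = pd (local_section c d \<xi> (M.transit c' c x)) (N.transit d d') (local_map c d (M.transit c' c x))"
      using p c c' d d' N.comps_change[of d "F p" d' "\<xi> p"] by (simp add: M.transit_cmap)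
  qed
qed

lemma smooth_section_dmap:
  assumes W: "open W" and Y: "smooth_vf_on A W Y"
  shows "smooth_section_on A B F W (\<lambda>q. dmap A B F q (Y q))"
  unfolding smooth_section_on_def
proof (intro ballI)
  fix c d assume c: "c \<in> A" and d: "d \<in> B"
  let ?S = "cmap c ` (cdom c \<inter> F -` cdom d \<inter> W)"
  have S: "open ?S" by (rule M.open_image[OF c]) (use open_dom[OF c d] W in \<open>auto intro: open_Int\<close>)
  have sm: "smooth_on ?S (local_map c d)" by (rule smooth_on_subset[OF smooth_local_map[OF c d]]) auto
  show "smooth_on ?S (\<lambda>x. comps B d (F (cinv c x)) (dmap A B F (cinv c x) (Y (cinv c x))))"
  proof (rule smooth_on_cong[OF S])
    show "smooth_on ?S (\<lambda>x. pd (M.local_field c Y x) (local_map c d) x)"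
      by (rule smooth_on_linear_field[OF S, where L="\<lambda>x a. pd a (local_map c d) x",
            OF smooth_on_linear_pd[OF S sm] smooth_on_pd[OF sm]])
         (assumption, rule smooth_on_subset[OF M.smooth_vf_loc[OF Y c]], auto)
    show "comps B d (F (cinv c x)) (dmap A B F (cinv c x) (Y (cinv c x))) = pd (M.local_field c Y x) (local_map c d) x"
      if "x \<in> ?S" for x
      using that c d by (auto simp: dmap_chart)
  qed
qed

lemma levi_civita_local:
  assumes c: "c \<in> A" and d: "d \<in> B"
  shows "levi_civita_along (cmap c ` (cdom c \<inter> F -` cdom d)) (cmap d ` cdom d) (local_map c d)
    (N.metric_chart g d) (N.christoffel nabla d)"
proof -
  have "smooth_on (cmap d ` cdom d) (\<lambda>x. N.metric_chart g d x i j)" if "i \<in> Basis" "j \<in> Basis" for i j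
    using metric that N.smooth_fun_loc[of "cdom d" "\<lambda>p. g p (vec_of B d p i) (vec_of B d p j)" d] d
    by (simp add: riemannian_metric_def N.metric_chart_def[abs_def])
  note G = N.metric_chart_field(1)[OF d N.chart_open[OF d] order_refl g_inner this]
  interpret L: levi_civita_along "cmap d ` cdom d" "cmap d ` cdom d" "\<lambda>x. x" "N.metric_chart g d" "N.christoffel nabla d"
    by (rule N.levi_civita_chart[OF d N.chart_open[OF d] order_refl g_inner G rconn])
  show ?thesis
  proof
    show "open (cmap c ` (cdom c \<inter> F -` cdom d))" by (rule M.open_image[OF c open_dom[OF c d]]) auto
    show "local_map c d x \<in> cmap d ` cdom d" if "x \<in> cmap c ` (cdom c \<inter> F -` cdom d)" for x
      using that c by auto
  qed (use L.open_T L.G_field L.G_inner L.\<Gamma>_field L.\<Gamma>_sym L.compat smooth_local_map[OF c d] in auto)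
qed

text \<open>The definition of \<open>cov_along\<close> uses the preferred chart \<open>d0\<close> at \<open>F p\<close>.  Its coordinate fields have components
\<open>J j\<close> in \<open>d\<close>, the section is \<open>\<Sum>\<^sub>j a\<^sub>j (J\<^sub>j \<circ> \<phi>)\<close>, and the product and chain rules give the formula with
the Christoffel symbols of \<open>d\<close>.\<close>

lemma cov_along_chart:
  assumes c: "c \<in> A" "p \<in> cdom c" and d: "d \<in> B" "F p \<in> cdom d"
    and W: "open W" "p \<in> W" and \<xi>: "smooth_section_on A B F W \<xi>"
  shows "comps B d (F p) (cov_along A B F nabla p v \<xi>)
    = cov (N.christoffel nabla d) (local_map c d) (comps A c p v) (local_section c d \<xi>) (cmap c p)"
proof -
  define d0 where "d0 = chart_at B (F p)"
  have d0: "d0 \<in> B" "F p \<in> cdom d0" using N.chart_at by (auto simp: d0_def)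
  let ?\<Gamma> = "N.christoffel nabla d" and ?\<phi> = "local_map c d" and ?x = "cmap c p" and ?u = "comps A c p v"
  let ?W = "(cdom c \<inter> F -` cdom d) \<inter> (F -` cdom d0 \<inter> W)"
  have oF: "open (F -` cdom d0)"
    using imm d0 by (auto simp: immersion_def smooth_map_def intro!: open_vimage)
  have oW: "open ?W" "?W \<subseteq> cdom c" using open_dom[OF c(1) d(1)] oF W by (auto intro!: open_Int)
  let ?S = "cmap c ` ?W"
  have S: "open ?S" by (rule M.open_image[OF c(1) oW])
  have x: "?x \<in> ?S" using c d d0 W by auto
  define a where "a j q = comps B d0 (F q) (\<xi> q) \<bullet> j" for j q
  define J where "J j = N.local_field d (\<lambda>y. vec_of B d0 y j)" for j
  have a_fun: "smooth_fun_on A (F -` cdom d0 \<inter> W) (a j)" for j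
    unfolding smooth_fun_on_def
  proof
    fix c' assume c': "c' \<in> A"
    have "open (cmap c' ` (cdom c' \<inter> F -` cdom d0 \<inter> W))"
      by (rule M.open_image[OF c']) (use open_dom[OF c' d0(1)] W in \<open>auto intro: open_Int\<close>)
    from smooth_on_inner_left[OF this smooth_section_sec[OF \<xi> c' d0(1)]]
    show "smooth_on (cmap c' ` (cdom c' \<inter> (F -` cdom d0 \<inter> W))) (a j \<circ> cinv c')"
      by (simp add: a_def[abs_def] local_section_def[abs_def] o_def Int_assoc)
  qed
  have a_sm: "smooth_on ?S (\<lambda>x. a j (cinv c x))" for j
    by (rule smooth_on_subset[OF M.smooth_fun_loc[OF a_fun c(1)]]) auto
  let ?T = "cmap d ` (cdom d \<inter> cdom d0)"
  have T: "open ?T" by (rule N.open_overlap[OF d(1) d0(1)])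
  have J_sm: "smooth_on ?T (J j)" for j
    unfolding J_def by (rule N.smooth_vf_loc[OF N.smooth_vf_coordinate[OF d0(1)] d(1)])
  have \<phi>_sm: "smooth_on ?S ?\<phi>" by (rule smooth_on_subset[OF smooth_local_map[OF c(1) d(1)]]) auto
  have \<phi>_in: "?\<phi> x \<in> ?T" if "x \<in> ?S" for x using that c by auto
  have J\<phi>_sm: "smooth_on ?S (\<lambda>x. J j (?\<phi> x))" for j
    by (rule smooth_on_compose[OF S T J_sm \<phi>_sm \<phi>_in])
  have expand: "local_section c d \<xi> x = (\<Sum>j\<in>Basis. a j (cinv c x) *\<^sub>R J j (?\<phi> x))" if x: "x \<in> ?S" for x
  proof -
    obtain r where r: "r \<in> ?W" "x = cmap c r" using x by auto
    have "comps B d (F r) (\<xi> r) = comps B d (F r) (vec_of B d0 (F r) (comps B d0 (F r) (\<xi> r)))"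
      using r d0 by simp
    also have "vec_of B d0 (F r) (comps B d0 (F r) (\<xi> r)) = (\<Sum>j\<in>Basis. a j r *\<^sub>R vec_of B d0 (F r) j)"
      unfolding a_def by (rule linear_expand[OF N.vec_of_linear]) (use r d0 in auto)
    finally show ?thesis
      using r c d by (simp add: J_def linear_sum[OF N.comps_linear] linear_scale[OF N.comps_linear] oW(2)[THEN subsetD])
  qed
  have pd_sec: "pd ?u (local_section c d \<xi>) ?x
      = (\<Sum>j\<in>Basis. a j p *\<^sub>R pd (pd ?u ?\<phi> ?x) (J j) (?\<phi> ?x) + pd ?u (\<lambda>x. a j (cinv c x)) ?x *\<^sub>R J j (?\<phi> ?x))"
  proof -
    have "pd ?u (local_section c d \<xi>) ?x = pd ?u (\<lambda>x. \<Sum>j\<in>Basis. a j (cinv c x) *\<^sub>R J j (?\<phi> x)) ?x"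
      by (rule pd_cong_open[OF S x expand])
    also have "\<dots> = (\<Sum>j\<in>Basis. a j (cinv c ?x) *\<^sub>R pd ?u (\<lambda>x. J j (?\<phi> x)) ?x + pd ?u (\<lambda>x. a j (cinv c x)) ?x *\<^sub>R J j (?\<phi> ?x))"
      by (rule pd_eqI[OF has_derivative_sum[OF bounded_bilinear.FDERIV[OF bounded_bilinear_scaleR]]];
          rule smooth_on_has_derivative[OF S _ x]; rule a_sm J\<phi>_sm)
    finally show ?thesis
      unfolding pd_compose[OF S T J_sm \<phi>_sm x \<phi>_in[OF x]] using c by simp
  qed
  have dfun: "dfun A (a j) p v = pd ?u (\<lambda>x. a j (cinv c x)) ?x" for j
    by (rule M.dfun_chart[OF c _ _ a_fun]) (use oF W d0 in \<open>auto intro: open_Int\<close>)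
  have nab: "comps B d (F p) (nabla (F p) (dmap A B F p v) (\<lambda>y. vec_of B d0 y j))
      = pd (pd ?u ?\<phi> ?x) (J j) (?\<phi> ?x) + ?\<Gamma> (?\<phi> ?x) (pd ?u ?\<phi> ?x) (J j (?\<phi> ?x))" for j
    using N.nabla_chart[OF conn d N.chart_open[OF d0(1)] d0(2) N.smooth_vf_coordinate[OF d0(1)]]
      dmap_chart[OF c d] c by (simp add: nab_eq J_def)
  have \<Gamma>lin: "linear (?\<Gamma> (cmap d (F p)) (pd ?u ?\<phi> ?x))"
    by (rule N.christoffel_linear_right[OF conn d(1)]) (use d in auto)
  have "comps B d (F p) (cov_along A B F nabla p v \<xi>)
      = (\<Sum>j\<in>Basis. dfun A (a j) p v *\<^sub>R J j (?\<phi> ?x)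
          + a j p *\<^sub>R (pd (pd ?u ?\<phi> ?x) (J j) (?\<phi> ?x) + ?\<Gamma> (?\<phi> ?x) (pd ?u ?\<phi> ?x) (J j (?\<phi> ?x))))"
    unfolding cov_along_def Let_def d0_def[symmetric] a_def[symmetric]
    using c d by (simp add: linear_sum[OF N.comps_linear] linear_add[OF N.comps_linear]
        linear_scale[OF N.comps_linear] nab J_def)
  also have "\<dots> = pd ?u (local_section c d \<xi>) ?x + ?\<Gamma> (?\<phi> ?x) (pd ?u ?\<phi> ?x) (local_section c d \<xi> ?x)"
    unfolding pd_sec dfun expand[OF x] using c
    by (simp add: linear_sum[OF \<Gamma>lin] linear_scale[OF \<Gamma>lin] sum.distrib scaleR_add_right algebra_simps)
  finally show ?thesis by (simp add: cov_def)
qed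

end


section \<open>Extrinsic geometry in charts\<close>

locale parallel_immersion = riemannian_immersion A B g nabla F
  for A :: "('m::{t2_space, second_countable_topology}, 'e::euclidean_space) chart set"
    and B :: "('n::{t2_space, second_countable_topology}, 'd::euclidean_space) chart set"
    and g nabla F +
  fixes \<eta> :: "'m \<Rightarrow> 'd"
  assumes \<eta>_normal: "normal_section_on A B F g UNIV \<eta>" and \<eta>_parallel: "parallel_normal A B F g nabla \<eta>"
begin

lemma parallel_section_local:
  assumes c: "c \<in> A" and d: "d \<in> B"
  shows "parallel_section (cmap c ` (cdom c \<inter> F -` cdom d)) (cmap d ` cdom d) (local_map c d)
    (N.metric_chart g d) (N.christoffel nabla d) (local_section c d \<eta>)"
proof -
  let ?S = "cmap c ` (cdom c \<inter> F -` cdom d)"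
  interpret L: levi_civita_along ?S "cmap d ` cdom d" "local_map c d" "N.metric_chart g d" "N.christoffel nabla d"
    by (rule levi_civita_local[OF c d])
  have \<eta>_sec: "smooth_section_on A B F UNIV \<eta>" using \<eta>_normal by (simp add: normal_section_on_def)
  show ?thesis
  proof
    show "smooth_on ?S (local_section c d \<eta>)" using smooth_section_sec[OF \<eta>_sec c d] by simp
    fix x u assume "x \<in> ?S"
    then obtain p where p: "p \<in> cdom c" "F p \<in> cdom d" "x = cmap c p" by auto
    have dm: "comps B d (F p) (dmap A B F p (vec_of A c p u)) = pd u (local_map c d) x" for u
      using dmap_chart[OF c p(1) d p(2), of "vec_of A c p u"] c p by simp
    show "u = 0" if "pd u (local_map c d) x = 0"
    proof -
      have "dmap A B F p (vec_of A c p u) = dmap A B F p (vec_of A c p 0)"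
        by (rule N.comps_inject[OF d p(2)])
           (use dm[of u] dm[of 0] that linear_0[OF L.pd_map_linear[OF \<open>x \<in> ?S\<close>]] in simp)
      then have "vec_of A c p u = vec_of A c p 0"
        using imm by (simp add: immersion_def inj_def)
      then show ?thesis using c p M.comps_vec_of by metis
    qed
    have "g (F p) (\<eta> p) (dmap A B F p (vec_of A c p u)) = 0"
      using \<eta>_normal by (simp add: normal_section_on_def is_normal_def)
    then show "N.metric_chart g d (local_map c d x) (local_section c d \<eta> x) (pd u (local_map c d) x) = 0"
      unfolding N.metric_chart_comps[OF d p(2)] dm using c p by simp
    let ?v = "vec_of A c p u"
    have "cov_along A B F nabla p ?v \<eta> = dmap A B F p (tang A B F g p (cov_along A B F nabla p ?v \<eta>))"
      using \<eta>_parallel by (simp add: parallel_normal_def normal_part_def)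
    then have "comps B d (F p) (cov_along A B F nabla p ?v \<eta>)
        = pd (comps A c p (tang A B F g p (cov_along A B F nabla p ?v \<eta>))) (local_map c d) x"
      using dmap_chart[OF c p(1) d p(2)] p(3) by metis
    then show "\<exists>s. cov (N.christoffel nabla d) (local_map c d) u (local_section c d \<eta>) x = pd s (local_map c d) x"
      using cov_along_chart[OF c p(1) d p(2) open_UNIV UNIV_I \<eta>_sec, of ?v] c p by auto
  qed
qed

text \<open>The smooth frame comes from Gram-Schmidt applied to the first fundamental form.\<close>

lemma framed_section_local:
  assumes c: "c \<in> A" and d: "d \<in> B"
  shows "\<exists>E. framed_section (cmap c ` (cdom c \<inter> F -` cdom d)) (cmap d ` cdom d) (local_map c d)
    (N.metric_chart g d) (N.christoffel nabla d) (local_section c d \<eta>) E"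
proof -
  let ?S = "cmap c ` (cdom c \<inter> F -` cdom d)"
  interpret L: parallel_section ?S "cmap d ` cdom d" "local_map c d" "N.metric_chart g d" "N.christoffel nabla d" "local_section c d \<eta>"
    by (rule parallel_section_local[OF c d])
  have "bilinear_field ?S L.first_form"
    unfolding bilinear_field_def
  proof (intro conjI ballI allI)
    show "bilinear (L.first_form x)" if "x \<in> ?S" for x
      by (rule inner_productD(1)[OF L.first_form_inner[OF that]])
    show "smooth_on ?S (\<lambda>x. L.first_form x u v)" for u v
      unfolding L.first_form_def by (intro L.smooth_on_G smooth_on_pd L.map_smooth)
  qed
  from smooth_orthonormal_frame[OF L.open_S this L.first_form_inner]
  obtain E where "\<forall>i\<in>Basis. smooth_on ?S (\<lambda>x. E x i)" "\<forall>x\<in>?S. orthonormal_basis (L.first_form x) (E x)"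
    by blast
  then show ?thesis
    by (intro exI[of _ E], unfold_locales) auto
qed

end

text \<open>A fixed pair of charts together with an orthonormal frame.  \<open>U\<close> is the part of the chart domain that \<open>F\<close>
maps into the domain of \<open>d\<close>; all points of \<open>U\<close> are treated alike, since the mean curvature function
and the gradient have to be differentiated.\<close>

locale parallel_immersion_chart = parallel_immersion A B g nabla F \<eta>
  for A :: "('m::{t2_space, second_countable_topology}, 'e::euclidean_space) chart set"
    and B :: "('n::{t2_space, second_countable_topology}, 'd::euclidean_space) chart set"
    and g nabla F \<eta> +
  fixes c :: "('m, 'e) chart" and d :: "('n, 'd) chart" and E :: "'e \<Rightarrow> 'e \<Rightarrow> 'e"
  assumes c: "c \<in> A" and d: "d \<in> B"
    and frame: "framed_section (cmap c ` (cdom c \<inter> F -` cdom d)) (cmap d ` cdom d) (local_map c d)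
      (N.metric_chart g d) (N.christoffel nabla d) (local_section c d \<eta>) E"
begin

abbreviation U where "U \<equiv> cdom c \<inter> F -` cdom d"
abbreviation S where "S \<equiv> cmap c ` U"
abbreviation \<phi> where "\<phi> \<equiv> local_map c d"
abbreviation G where "G \<equiv> N.metric_chart g d"
abbreviation \<Gamma> where "\<Gamma> \<equiv> N.christoffel nabla d"
abbreviation D where "D \<equiv> cov \<Gamma> \<phi>"
abbreviation ind where "ind \<equiv> induced_metric A B F g"
abbreviation cN where "cN p \<equiv> comps B d (F p)"
abbreviation cM where "cM p \<equiv> comps A c p"

sublocale L: framed_section S "cmap d ` cdom d" \<phi> G \<Gamma> "local_section c d \<eta>" E
  by (rule frame)

lemma open_U: "open U" and U_dom: "U \<subseteq> cdom c"
  using open_dom[OF c d] by auto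

lemma in_U: "p \<in> U \<Longrightarrow> p \<in> cdom c" "p \<in> U \<Longrightarrow> F p \<in> cdom d" "p \<in> U \<Longrightarrow> cmap c p \<in> S"
  by auto

lemma g_local: "p \<in> U \<Longrightarrow> g (F p) w z = G (\<phi> (cmap c p)) (cN p w) (cN p z)"
  using N.metric_chart_comps[OF d, of "F p" g w z] c by simp

lemma dmap_local: "p \<in> U \<Longrightarrow> cN p (dmap A B F p u) = pd (cM p u) \<phi> (cmap c p)"
  using dmap_chart[OF c _ d] by simp

lemma cN_lin: "p \<in> U \<Longrightarrow> linear (cN p)" and cM_lin: "p \<in> U \<Longrightarrow> linear (cM p)"
  using N.comps_linear[OF d] M.comps_linear[OF c] by auto

lemma vec_M [simp]: "p \<in> U \<Longrightarrow> cM p (vec_of A c p u) = u" "p \<in> U \<Longrightarrow> vec_of A c p (cM p u) = u"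
  and vec_N [simp]: "p \<in> U \<Longrightarrow> cN p (vec_of B d (F p) w) = w" "p \<in> U \<Longrightarrow> vec_of B d (F p) (cN p w) = w"
  using c d by auto

lemma vecM_lin: "p \<in> U \<Longrightarrow> linear (vec_of A c p)" and vecN_lin: "p \<in> U \<Longrightarrow> linear (vec_of B d (F p))"
  using M.vec_of_linear[OF c] N.vec_of_linear[OF d] by auto

lemma cN_inject: "p \<in> U \<Longrightarrow> cN p w = cN p z \<Longrightarrow> w = z"
  using vec_N(2) by metis

lemma ind_local: "p \<in> U \<Longrightarrow> ind p u v = L.first_form (cmap c p) (cM p u) (cM p v)"
  by (simp only: induced_metric_def g_local dmap_local L.first_form_def)

lemma ind_inner:
  assumes p: "p \<in> U" shows "inner_product (ind p)"
proof -
  have "inner_product (\<lambda>u v. L.first_form (cmap c p) (cM p u) (cM p v))"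
  proof (rule inner_product_pullback[OF L.first_form_inner[OF in_U(3)[OF p]] cM_lin[OF p]])
    show "u = 0" if "cM p u = 0" for u
      using vec_M(2)[OF p, of u] linear_0[OF vecM_lin[OF p]] that by simp
  qed
  then show ?thesis using ind_local[OF p] by presburger
qed

lemma ind_frame:
  assumes p: "p \<in> U" shows "orthonormal_basis (ind p) (\<lambda>i. vec_of A c p (E (cmap c p) i))"
  using L.E_orthonormal[OF in_U(3)[OF p]] p by (simp add: orthonormal_basis_def ind_local)

lemma ind_trace:
  assumes p: "p \<in> U" and b: "\<And>x. linear (b x)" "\<And>y. linear (\<lambda>x. b x y)"
  shows "metric_trace (ind p) b
    = (\<Sum>i\<in>Basis. b (vec_of A c p (E (cmap c p) i)) (vec_of A c p (E (cmap c p) i)))"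
  by (rule metric_trace_eq[OF ind_inner[OF p] ind_frame[OF p] b])

text \<open>Existence and uniqueness of the tangential part hold because \<open>tan_part\<close> is the orthogonal projection.\<close>

lemma tang_local:
  assumes p: "p \<in> U" shows "tang A B F g p w = vec_of A c p (L.tan_part (cmap c p) (cN p w))"
  unfolding tang_def
proof (rule the_equality)
  let ?x = "cmap c p"
  have eq: "g (F p) (w - dmap A B F p u) (dmap A B F p v) = G (\<phi> ?x) (cN p w - pd (cM p u) \<phi> ?x) (pd (cM p v) \<phi> ?x)" for u v
    unfolding g_local[OF p] linear_diff[OF cN_lin[OF p]] dmap_local[OF p] ..
  show "\<forall>v. g (F p) (w - dmap A B F p (vec_of A c p (L.tan_part ?x (cN p w)))) (dmap A B F p v) = 0"
    unfolding eq vec_M(1)[OF p] using L.perp_normal[OF in_U(3)[OF p]] by (simp add: L.perp_def)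
  fix u assume u: "\<forall>v. g (F p) (w - dmap A B F p u) (dmap A B F p v) = 0"
  have "L.tan_part ?x (cN p w) = cM p u"
    by (rule L.tan_unique[OF in_U(3)[OF p]])
       (use u[unfolded eq, rule_format, of "vec_of A c p _"] p in simp)
  then show "u = vec_of A c p (L.tan_part ?x (cN p w))" using p by simp
qed

lemma normal_part_local:
  "p \<in> U \<Longrightarrow> cN p (normal_part A B F g p w) = L.perp (cmap c p) (cN p w)"
  by (simp add: normal_part_def linear_diff[OF cN_lin] dmap_local tang_local L.perp_def)

lemma is_normal_local:
  assumes p: "p \<in> U"
  shows "is_normal A B F g p w \<longleftrightarrow> (\<forall>u. G (\<phi> (cmap c p)) (cN p w) (pd u \<phi> (cmap c p)) = 0)"
  unfolding is_normal_def g_local[OF p] dmap_local[OF p] using vec_M(1)[OF p] by metis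

lemma cov_local:
  assumes p: "p \<in> U" and W: "open W" "p \<in> W" and \<xi>: "smooth_section_on A B F W \<xi>"
  shows "cN p (cov_along A B F nabla p v \<xi>) = D (cM p v) (local_section c d \<xi>) (cmap c p)"
  by (rule cov_along_chart[OF c in_U(1)[OF p] d in_U(2)[OF p] W \<xi>])

lemma open_image_U: "open W \<Longrightarrow> open (cmap c ` (U \<inter> W))"
  by (rule M.open_image[OF c]) (use open_U in \<open>auto intro: open_Int\<close>)

text \<open>Any extension of \<open>v\<close> gives the same value by \<open>second_form_field\<close>, and the field with constant components
is an extension.\<close>

lemma second_ff_local:
  assumes p: "p \<in> U"
  shows "second_ff A B F g nabla p u v
    = vec_of B d (F p) (L.second_form (cmap c p) (cM p u) (cM p v))"
  unfolding second_ff_def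
proof (rule the_equality)
  let ?w = "vec_of B d (F p) (L.second_form (cmap c p) (cM p u) (cM p v))"
  have key: "normal_part A B F g p (cov_along A B F nabla p u (\<lambda>q. dmap A B F q (Y q))) = ?w"
    if W: "open W" "p \<in> W" and Y: "smooth_vf_on A W Y" and v: "Y p = v" for W Y
  proof (rule cN_inject[OF p])
    let ?S' = "cmap c ` (U \<inter> W)" and ?x = "cmap c p"
    have S': "open ?S'" "?S' \<subseteq> S" using open_image_U[OF W(1)] by auto
    have x: "?x \<in> ?S'" using p W by auto
    have eq: "local_section c d (\<lambda>q. dmap A B F q (Y q)) x = pd (M.local_field c Y x) \<phi> x" if "x \<in> ?S'" for x
      using that c dmap_chart[OF c _ d] by auto
    have Ysm: "smooth_on ?S' (M.local_field c Y)" by (rule smooth_on_subset[OF M.smooth_vf_loc[OF Y c]]) auto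
    have "cN p (cov_along A B F nabla p u (\<lambda>q. dmap A B F q (Y q)))
        = D (cM p u) (local_section c d (\<lambda>q. dmap A B F q (Y q))) ?x"
      by (rule cov_local[OF p W smooth_section_dmap[OF W(1) Y]])
    also have "\<dots> = D (cM p u) (\<lambda>x. pd (M.local_field c Y x) \<phi> x) ?x"
      unfolding cov_def eq[OF x] using pd_cong_open[OF S'(1) x eq] by simp
    finally show "cN p (normal_part A B F g p (cov_along A B F nabla p u (\<lambda>q. dmap A B F q (Y q)))) = cN p ?w"
      unfolding normal_part_local[OF p] vec_N(1)[OF p]
      using L.second_form_field[OF x S' Ysm, of "cM p u"] c p v by simp
  qed
  then show "\<forall>W Y. open W \<and> p \<in> W \<and> smooth_vf_on A W Y \<and> Y p = v \<longrightarrow>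
      normal_part A B F g p (cov_along A B F nabla p u (\<lambda>q. dmap A B F q (Y q))) = ?w" by blast
  fix w assume w: "\<forall>W Y. open W \<and> p \<in> W \<and> smooth_vf_on A W Y \<and> Y p = v \<longrightarrow>
      normal_part A B F g p (cov_along A B F nabla p u (\<lambda>q. dmap A B F q (Y q))) = w"
  let ?Y = "\<lambda>q. vec_of A c q (cM p v)"
  have Y: "open (cdom c)" "p \<in> cdom c" "smooth_vf_on A (cdom c) ?Y" "?Y p = v"
    using M.smooth_vf_coordinate[OF c] M.chart_open[OF c] p by auto
  show "w = ?w"
    using w[rule_format, OF conjI[OF Y(1) conjI[OF Y(2) conjI[OF Y(3,4)]]]] key[OF Y] by simp
qed

lemma trace_second_ff:
  assumes p: "p \<in> U"
  shows "cN p (real DIM('e) *\<^sub>R mean_curvature A B F g nabla p)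
    = (\<Sum>i\<in>Basis. L.second_form (cmap c p) (E (cmap c p) i) (E (cmap c p) i))"
proof -
  note x = in_U(3)[OF p]
  have "metric_trace (ind p) (second_ff A B F g nabla p)
      = (\<Sum>i\<in>Basis. second_ff A B F g nabla p (vec_of A c p (E (cmap c p) i)) (vec_of A c p (E (cmap c p) i)))"
  proof (rule ind_trace[OF p])
    show "linear (second_ff A B F g nabla p u)" for u
      using linear_compose[OF linear_compose[OF cM_lin[OF p] L.second_form_linear(1)[OF x, of "cM p u"]] vecN_lin[OF p]]
      by (simp add: second_ff_local[OF p, abs_def] o_def)
    show "linear (\<lambda>u. second_ff A B F g nabla p u v)" for v
      using linear_compose[OF linear_compose[OF cM_lin[OF p] L.second_form_linear(2)[OF x, of "cM p v"]] vecN_lin[OF p]]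
      by (simp add: second_ff_local[OF p] o_def)
  qed
  then show ?thesis
    using p by (simp add: mean_curvature_def second_ff_local[OF p] linear_sum[OF cN_lin[OF p]])
qed

text \<open>The trace of the second fundamental form may be computed in the chosen frame; pairing with \<open>\<eta>\<close> removes
the tangential parts, and \<open>second_form_eta\<close> moves the derivative to \<open>\<eta>\<close>.\<close>

lemma mean_curvature_eta:
  assumes p: "p \<in> U"
  shows "real DIM('e) * g (F p) (mean_curvature A B F g nabla p) (\<eta> p)
    = - (\<Sum>i\<in>Basis. G (\<phi> (cmap c p)) (D (E (cmap c p) i) (local_section c d \<eta>) (cmap c p)) (pd (E (cmap c p) i) \<phi> (cmap c p)))"
proof -
  note x = in_U(3)[OF p]
  let ?x = "cmap c p"
  have "real DIM('e) * g (F p) (mean_curvature A B F g nabla p) (\<eta> p)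
      = g (F p) (real DIM('e) *\<^sub>R mean_curvature A B F g nabla p) (\<eta> p)"
    using bilinear_lmul[OF inner_productD(1)[OF g_inner]] by simp
  also have "\<dots> = G (\<phi> ?x) (\<Sum>i\<in>Basis. L.second_form ?x (E ?x i) (E ?x i)) (local_section c d \<eta> ?x)"
    unfolding g_local[OF p] trace_second_ff[OF p] using c p by simp
  also have "\<dots> = (\<Sum>i\<in>Basis. G (\<phi> ?x) (L.second_form ?x (E ?x i) (E ?x i)) (local_section c d \<eta> ?x))"
    by (rule linear_sum[OF bilinear_linear(2)[OF L.G_bil[OF L.map_in[OF x]]]])
  finally show ?thesis unfolding L.second_form_eta[OF x] by (simp add: sum_negf)
qed

lemma shape_op_local:
  assumes p: "p \<in> U" and W: "open W" "p \<in> W" and \<xi>: "smooth_section_on A B F W \<xi>"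
  shows "cM p (shape_op A B F g nabla \<xi> p u)
    = - L.tan_part (cmap c p) (D (cM p u) (local_section c d \<xi>) (cmap c p))"
  unfolding shape_op_def linear_neg[OF cM_lin[OF p]] tang_local[OF p] vec_M(1)[OF p] cov_local[OF assms] ..

lemma \<eta>_section: "smooth_section_on A B F UNIV \<eta>"
  using \<eta>_normal by (simp add: normal_section_on_def)

lemma shape_op_linear:
  assumes p: "p \<in> U" and W: "open W" "p \<in> W" and \<xi>: "smooth_section_on A B F W \<xi>"
  shows "linear (shape_op A B F g nabla \<xi> p)"
proof -
  note x = in_U(3)[OF p]
  have S': "open (cmap c ` (U \<inter> W))" "cmap c ` (U \<inter> W) \<subseteq> S" "cmap c p \<in> cmap c ` (U \<inter> W)"
    using open_image_U[OF W(1)] p W by auto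
  interpret L': levi_civita_along "cmap c ` (U \<inter> W)" "cmap d ` cdom d" \<phi> G \<Gamma>
    by (rule levi_civita_along_subset[OF L.levi_civita_along_axioms S'(1,2)])
  have "smooth_on (cmap c ` (U \<inter> W)) (local_section c d \<xi>)"
    using smooth_section_sec[OF \<xi> c d] by simp
  from L'.cov_linear[OF this S'(3)]
  have "linear (\<lambda>u. - L.tan_part (cmap c p) (D (cM p u) (local_section c d \<xi>) (cmap c p)))"
    using linear_compose[OF linear_compose[OF cM_lin[OF p]] L.tan_linear[OF x]]
    by (intro linear_compose_neg) (simp add: o_def)
  from linear_compose[OF this vecM_lin[OF p]] show ?thesis
    unfolding shape_op_local[OF assms, symmetric] o_def vec_M(2)[OF p] .
qed

text \<open>Since \<open>D\<eta>\<close> is tangent, its inner product with the tangential part of \<open>D\<xi>\<close> is that with \<open>D\<xi>\<close> itself.\<close>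

lemma simons_trace:
  assumes p: "p \<in> U" and W: "open W" "p \<in> W" and \<xi>: "smooth_section_on A B F W \<xi>"
  shows "metric_trace (ind p) (\<lambda>u v. ind p (shape_op A B F g nabla \<eta> p u) (shape_op A B F g nabla \<xi> p v))
    = (\<Sum>i\<in>Basis. G (\<phi> (cmap c p)) (D (E (cmap c p) i) (local_section c d \<eta>) (cmap c p))
        (D (E (cmap c p) i) (local_section c d \<xi>) (cmap c p)))"
proof -
  note x = in_U(3)[OF p]
  let ?x = "cmap c p"
  note bil = inner_productD(1)[OF ind_inner[OF p]]
  have eq: "L.first_form ?x (- L.tan_part ?x (D a (local_section c d \<eta>) ?x)) (- L.tan_part ?x \<omega>)
      = G (\<phi> ?x) (D a (local_section c d \<eta>) ?x) \<omega>" for a \<omega>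
  proof -
    note ff = inner_productD[OF L.first_form_inner[OF x]]
    obtain s where s: "D a (local_section c d \<eta>) ?x = pd s \<phi> ?x" using L.\<eta>_parallel[OF x] by blast
    have "L.first_form ?x (- L.tan_part ?x (pd s \<phi> ?x)) (- L.tan_part ?x \<omega>) = L.first_form ?x (L.tan_part ?x \<omega>) s"
      using ff(2)[of s] by (simp add: bilinear_lneg[OF ff(1)] bilinear_rneg[OF ff(1)] L.tan_tangent[OF x])
    then show ?thesis
      unfolding s L.tan_adjoint[OF x] using L.G_sym[OF L.map_in[OF x]] by simp
  qed
  show ?thesis
  proof (subst ind_trace[OF p])
    show "linear (\<lambda>v. ind p (shape_op A B F g nabla \<eta> p u) (shape_op A B F g nabla \<xi> p v))" for u
      by (rule linear_compose[OF shape_op_linear[OF assms] bilinear_linear(1)[OF bil], unfolded o_def])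
    show "linear (\<lambda>u. ind p (shape_op A B F g nabla \<eta> p u) (shape_op A B F g nabla \<xi> p v))" for v
      by (rule linear_compose[OF shape_op_linear[OF p open_UNIV UNIV_I \<eta>_section] bilinear_linear(2)[OF bil], unfolded o_def])
  qed (simp only: ind_local[OF p] shape_op_local[OF assms] shape_op_local[OF p open_UNIV UNIV_I \<eta>_section]
      vec_M(1)[OF p] eq)
qed

text \<open>Projecting any smooth section to the normal spaces gives a smooth normal section.  Normal vectors at a
point thus extend to normal sections, by projecting a section with constant components.\<close>

lemma normal_extension:
  assumes \<zeta>: "smooth_on S \<zeta>"
  defines "\<xi> \<equiv> \<lambda>r. vec_of B d (F r) (L.perp (cmap c r) (\<zeta> (cmap c r)))"
  shows "normal_section_on A B F g U \<xi>" "\<And>x. x \<in> S \<Longrightarrow> local_section c d \<xi> x = L.perp x (\<zeta> x)"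
proof -
  show local_section: "local_section c d \<xi> x = L.perp x (\<zeta> x)" if "x \<in> S" for x
    using that c d by (auto simp: \<xi>_def)
  have "smooth_section_on A B F U \<xi>"
    by (rule smooth_section_onI[OF c d open_U order_refl])
       (rule smooth_on_cong[OF L.open_S L.smooth_on_perp[OF \<zeta>] local_section])
  moreover have "is_normal A B F g p (\<xi> p)" if p: "p \<in> U" for p
    unfolding is_normal_local[OF p] \<xi>_def vec_N(1)[OF p] using L.perp_normal[OF in_U(3)[OF p]] by blast
  ultimately show "normal_section_on A B F g U \<xi>" by (simp add: normal_section_on_def)
qed

text \<open>Existence is \<open>simons_representative\<close>.  For uniqueness, the difference of two candidates is itself the
value at \<open>p\<close> of a normal section, hence orthogonal to itself.\<close>

lemma simons_op_local:
  assumes p: "p \<in> U"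
  shows "is_normal A B F g p (simons_op A B F g nabla \<eta> p)"
    and "open W \<Longrightarrow> p \<in> W \<Longrightarrow> normal_section_on A B F g W \<xi> \<Longrightarrow>
      g (F p) (simons_op A B F g nabla \<eta> p) (\<xi> p)
        = (\<Sum>i\<in>Basis. G (\<phi> (cmap c p)) (D (E (cmap c p) i) (local_section c d \<eta>) (cmap c p))
        (D (E (cmap c p) i) (local_section c d \<xi>) (cmap c p)))"
proof -
  note x = in_U(3)[OF p]
  let ?x = "cmap c p"
  let ?tr = "\<lambda>\<xi>. metric_trace (ind p) (\<lambda>u v. ind p (shape_op A B F g nabla \<eta> p u) (shape_op A B F g nabla \<xi> p v))"
  let ?P = "\<lambda>\<zeta>. is_normal A B F g p \<zeta> \<and>
    (\<forall>W \<xi>. open W \<and> p \<in> W \<and> normal_section_on A B F g W \<xi> \<longrightarrow> g (F p) \<zeta> (\<xi> p) = ?tr \<xi>)"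
  obtain \<zeta> where \<zeta>: "\<And>u. G (\<phi> ?x) \<zeta> (pd u \<phi> ?x) = 0"
    "\<And>S' \<xi>. open S' \<and> ?x \<in> S' \<and> S' \<subseteq> S \<and> smooth_on S' \<xi> \<and> (\<forall>y\<in>S'. \<forall>u. G (\<phi> y) (\<xi> y) (pd u \<phi> y) = 0) \<Longrightarrow>
      G (\<phi> ?x) \<zeta> (\<xi> ?x) = (\<Sum>i\<in>Basis. G (\<phi> ?x) (D (E ?x i) (local_section c d \<eta>) ?x) (D (E ?x i) \<xi> ?x))"
    using L.simons_representative[OF x] by auto
  have ex: "?P (vec_of B d (F p) \<zeta>)"
  proof (intro conjI allI impI; (elim conjE)?)
    show "is_normal A B F g p (vec_of B d (F p) \<zeta>)"
      unfolding is_normal_local[OF p] vec_N(1)[OF p] using \<zeta>(1) by blast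
    fix W \<xi> assume W: "open W" "p \<in> W" and n: "normal_section_on A B F g W \<xi>"
    have \<xi>: "smooth_section_on A B F W \<xi>" and nW: "\<And>r. r \<in> W \<Longrightarrow> is_normal A B F g r (\<xi> r)"
      using n by (auto simp: normal_section_on_def)
    let ?S' = "cmap c ` (U \<inter> W)"
    have "G (\<phi> ?x) \<zeta> (local_section c d \<xi> ?x) = (\<Sum>i\<in>Basis. G (\<phi> ?x) (D (E ?x i) (local_section c d \<eta>) ?x) (D (E ?x i) (local_section c d \<xi>) ?x))"
    proof (rule \<zeta>(2)[of ?S'], intro conjI ballI allI)
      show "smooth_on ?S' (local_section c d \<xi>)" using smooth_section_sec[OF \<xi> c d] by simp
      fix y u assume "y \<in> ?S'"
      then obtain r where r: "r \<in> U" "r \<in> W" "y = cmap c r" by auto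
      show "G (\<phi> y) (local_section c d \<xi> y) (pd u \<phi> y) = 0"
        using nW[OF r(2)] unfolding is_normal_local[OF r(1)] r(3) local_section_cmap[OF c in_U(1)[OF r(1)]] by blast
    qed (use open_image_U[OF W(1)] p W in auto)
    then show "g (F p) (vec_of B d (F p) \<zeta>) (\<xi> p) = ?tr \<xi>"
      unfolding g_local[OF p] vec_N(1)[OF p] simons_trace[OF p W \<xi>] local_section_cmap[OF c in_U(1)[OF p]] .
  qed
  have unique: "\<zeta>1 = \<zeta>2" if 1: "?P \<zeta>1" and 2: "?P \<zeta>2" for \<zeta>1 \<zeta>2
  proof (rule ccontr)
    assume "\<zeta>1 \<noteq> \<zeta>2"
    let ?z = "\<zeta>1 - \<zeta>2"
    let ?\<xi> = "\<lambda>r. vec_of B d (F r) (L.perp (cmap c r) (cN p ?z))"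
    have n: "normal_section_on A B F g U ?\<xi>"
      by (rule normal_extension(1)[OF smooth_on_const[OF L.open_S]])
    have "\<forall>u. G (\<phi> ?x) (cN p ?z) (pd u \<phi> ?x) = 0"
      using 1 2 unfolding is_normal_local[OF p] linear_diff[OF cN_lin[OF p]]
      by (simp add: L.G_lin[OF L.map_in[OF x]])
    then have "?\<xi> p = ?z" using L.perp_fixed[OF x] p by simp
    moreover have "g (F p) \<zeta>1 (?\<xi> p) = g (F p) \<zeta>2 (?\<xi> p)"
      using 1[THEN conjunct2, rule_format, OF conjI[OF open_U conjI[OF p n]]]
        2[THEN conjunct2, rule_format, OF conjI[OF open_U conjI[OF p n]]] by simp
    ultimately have "g (F p) ?z ?z = 0"
      using bilinear_lsub[OF inner_productD(1)[OF g_inner]] by simp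
    then show False using inner_productD(3)[OF g_inner, of ?z "F p"] \<open>\<zeta>1 \<noteq> \<zeta>2\<close> by simp
  qed
  have P: "?P (simons_op A B F g nabla \<eta> p)"
    unfolding simons_op_def by (rule theI[of ?P, OF ex]) (rule unique[OF _ ex])
  then show "is_normal A B F g p (simons_op A B F g nabla \<eta> p)" by blast
  assume W: "open W" "p \<in> W" and n: "normal_section_on A B F g W \<xi>"
  then have \<xi>: "smooth_section_on A B F W \<xi>" by (simp add: normal_section_on_def)
  show "g (F p) (simons_op A B F g nabla \<eta> p) (\<xi> p)
        = (\<Sum>i\<in>Basis. G (\<phi> (cmap c p)) (D (E (cmap c p) i) (local_section c d \<eta>) (cmap c p))
        (D (E (cmap c p) i) (local_section c d \<xi>) (cmap c p)))"
    using P[THEN conjunct2, rule_format, OF conjI[OF W(1) conjI[OF W(2) n]]]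
    unfolding simons_trace[OF p W \<xi>] .
qed

text \<open>The trace may be evaluated in the frame only because the curvature is linear in its second argument;
this follows from linearity in the last argument by the pair symmetry.\<close>

lemma Ric_M_local:
  assumes p: "p \<in> U"
  shows "Ric_M A B F g nabla p w z = (\<Sum>i\<in>Basis. G (\<phi> (cmap c p))
    (Riem \<Gamma> (\<phi> (cmap c p)) (cN p w) (pd (E (cmap c p) i) \<phi> (cmap c p)) (cN p z)) (pd (E (cmap c p) i) \<phi> (cmap c p)))"
proof -
  note x = in_U(3)[OF p] and T = L.map_in[OF in_U(3)[OF p]]
  let ?y = "\<phi> (cmap c p)" and ?P = "\<lambda>u. pd (cM p u) \<phi> (cmap c p)"
  have eq: "g (F p) (curvature B nabla (F p) w (dmap A B F p u) z) (dmap A B F p v)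
      = G ?y (Riem \<Gamma> ?y (cN p w) (?P u) (cN p z)) (?P v)" for u v
    unfolding g_local[OF p] N.curvature_chart[OF rconn g_inner d in_U(2)[OF p] L.G_field] dmap_local[OF p]
    using c p by simp
  have P: "linear ?P" by (rule linear_compose[OF cM_lin[OF p] L.pd_map_linear[OF x], unfolded o_def])
  show ?thesis
    unfolding Ric_M_def eq
  proof (subst ind_trace[OF p])
    show "linear (\<lambda>v. G ?y (Riem \<Gamma> ?y (cN p w) (?P u) (cN p z)) (?P v))" for u
      by (rule linear_compose[OF P bilinear_linear(1)[OF L.G_bil[OF T]], unfolded o_def])
    show "linear (\<lambda>u. G ?y (Riem \<Gamma> ?y (cN p w) (?P u) (cN p z)) (?P v))" for v
      unfolding L.Riem_pair[OF T, of "cN p w"]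
      by (rule linear_compose[OF P bilinear_linear(1)[OF L.G_bil[OF T]], unfolded o_def])
  qed (simp add: vec_M(1)[OF p])
qed

lemma Ric_perp_local:
  assumes p: "p \<in> U"
  shows "is_normal A B F g p (Ric_perp A B F g nabla p w)"
    and "is_normal A B F g p z \<Longrightarrow> g (F p) (Ric_perp A B F g nabla p w) z = Ric_M A B F g nabla p w z"
proof -
  note x = in_U(3)[OF p] and T = L.map_in[OF in_U(3)[OF p]]
  let ?x = "cmap c p"
  let ?P = "\<lambda>\<zeta>. is_normal A B F g p \<zeta> \<and> (\<forall>z. is_normal A B F g p z \<longrightarrow> g (F p) \<zeta> z = Ric_M A B F g nabla p w z)"
  have "linear (\<lambda>z. G (\<phi> ?x) (Riem \<Gamma> (\<phi> ?x) (cN p w) a (cN p z)) a)" for a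
    using linear_compose[OF linear_compose[OF cN_lin[OF p] L.Riem_linear_last[OF T]] bilinear_linear(2)[OF L.G_bil[OF T]]]
    by (simp add: o_def)
  then have "linear (Ric_M A B F g nabla p w)"
    unfolding Ric_M_local[OF p, abs_def] by (intro linear_compose_sum) blast
  from riesz_inner_product[OF g_inner this]
  obtain r where r: "\<And>z. g (F p) r z = Ric_M A B F g nabla p w z" by blast
  have ex: "?P (normal_part A B F g p r)"
  proof (intro conjI allI impI)
    show "is_normal A B F g p (normal_part A B F g p r)"
      unfolding is_normal_local[OF p] normal_part_local[OF p] using L.perp_normal[OF x] by blast
    fix z assume "is_normal A B F g p z"
    then show "g (F p) (normal_part A B F g p r) z = Ric_M A B F g nabla p w z"
      unfolding is_normal_local[OF p] r[symmetric] g_local[OF p] normal_part_local[OF p]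
      using L.G_perp[OF x] by blast
  qed
  have unique: "\<zeta>1 = \<zeta>2" if 1: "?P \<zeta>1" and 2: "?P \<zeta>2" for \<zeta>1 \<zeta>2
  proof (rule ccontr)
    assume "\<zeta>1 \<noteq> \<zeta>2"
    have "is_normal A B F g p (\<zeta>1 - \<zeta>2)"
      using 1 2 bilinear_lsub[OF inner_productD(1)[OF g_inner]] by (simp add: is_normal_def)
    then have "g (F p) (\<zeta>1 - \<zeta>2) (\<zeta>1 - \<zeta>2) = 0"
      using 1 2 bilinear_lsub[OF inner_productD(1)[OF g_inner]] by simp
    then show False using inner_productD(3)[OF g_inner, of "\<zeta>1 - \<zeta>2" "F p"] \<open>\<zeta>1 \<noteq> \<zeta>2\<close> by simp
  qed
  have P: "?P (Ric_perp A B F g nabla p w)"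
    unfolding Ric_perp_def by (rule theI[of ?P, OF ex]) (rule unique[OF _ ex])
  then show "is_normal A B F g p (Ric_perp A B F g nabla p w)"
    and "is_normal A B F g p z \<Longrightarrow> g (F p) (Ric_perp A B F g nabla p w) z = Ric_M A B F g nabla p w z"
    by blast+
qed


lemma U_Int: "cdom c \<inter> U = U"
  by auto

lemma dfun_local:
  assumes "smooth_fun_on A U h" "p \<in> U"
  shows "dfun A h p v = pd (cM p v) (\<lambda>x. h (cinv c x)) (cmap c p)"
  by (rule M.dfun_chart[OF c in_U(1)[OF assms(2)] open_U assms(2,1)])

lemma smooth_fun_local: "smooth_fun_on A U h \<Longrightarrow> smooth_on S (\<lambda>x. h (cinv c x))"
  using M.smooth_fun_loc[OF _ c, of U h] by (simp only: U_Int)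

lemma gradient_inner:
  assumes h: "smooth_fun_on A U h" and p: "p \<in> U"
  shows "ind p (gradient A ind h p) v = pd (cM p v) (\<lambda>x. h (cinv c x)) (cmap c p)"
proof -
  have "linear (\<lambda>v. pd (cM p v) (\<lambda>x. h (cinv c x)) (cmap c p))"
    by (rule linear_compose[OF cM_lin[OF p] smooth_on_linear_pd[OF L.open_S smooth_fun_local[OF h] in_U(3)[OF p]],
          unfolded o_def])
  then have "linear (dfun A h p)" by (simp add: dfun_local[OF h p, abs_def])
  from gradient_property[where g=ind and p=p, OF ind_inner[OF p] this] show ?thesis unfolding dfun_local[OF h p] .
qed

text \<open>In the frame the gradient is \<open>\<Sum>\<^sub>i (E\<^sub>i h) E\<^sub>i\<close>.\<close>

lemma gradient_smooth:
  assumes h: "smooth_fun_on A U h"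
  shows "smooth_vf_on A U (gradient A ind h)"
proof -
  let ?h = "\<lambda>x. h (cinv c x)"
  note sh = smooth_fun_local[OF h]
  have eq: "M.local_field c (gradient A ind h) x = (\<Sum>i\<in>Basis. pd (E x i) ?h x *\<^sub>R E x i)" if x: "x \<in> S" for x
  proof -
    obtain p where p: "p \<in> U" "x = cmap c p" using x by auto
    note ff = inner_productD[OF L.first_form_inner[OF x]] and lin = smooth_on_linear_pd[OF L.open_S sh x]
    have "cM p (gradient A ind h p) = (\<Sum>i\<in>Basis. pd (E x i) ?h x *\<^sub>R E x i)"
    proof (rule inner_product_eqI[OF L.first_form_inner[OF x]])
      fix u
      have "L.first_form x (cM p (gradient A ind h p)) u = pd u ?h x"
        using gradient_inner[OF h p(1), of "vec_of A c p u"] unfolding ind_local[OF p(1)] vec_M(1)[OF p(1)] p(2) .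
      also have "\<dots> = pd (\<Sum>i\<in>Basis. L.first_form x u (E x i) *\<^sub>R E x i) ?h x"
        using orthonormal_expand[OF L.first_form_inner[OF x] L.E_orthonormal[OF x], of u] by simp
      also have "\<dots> = L.first_form x (\<Sum>i\<in>Basis. pd (E x i) ?h x *\<^sub>R E x i) u"
        by (simp add: linear_sum[OF lin] linear_scale[OF lin] ff(2)[of u] mult.commute
            linear_sum[OF bilinear_linear(2)[OF ff(1)]] linear_scale[OF bilinear_linear(2)[OF ff(1)]])
      finally show "L.first_form x (cM p (gradient A ind h p)) u
          = L.first_form x (\<Sum>i\<in>Basis. pd (E x i) ?h x *\<^sub>R E x i) u" .
    qed
    then show ?thesis using p c by simp
  qed
  have "smooth_on S (\<lambda>x. pd (E x i) ?h x)" if "i \<in> Basis" for i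
    by (rule smooth_on_linear_field[OF L.open_S, where L="\<lambda>x a. pd a ?h x",
          OF smooth_on_linear_pd[OF L.open_S sh] smooth_on_pd[OF sh] L.E_smooth[OF that]])
  then have "smooth_on S (\<lambda>x. \<Sum>i\<in>Basis. pd (E x i) ?h x *\<^sub>R E x i)"
    by (intro smooth_on_sum[OF L.open_S] smooth_on_scaleR[OF L.open_S] L.E_smooth finite_Basis)
  then show ?thesis
    by (intro M.smooth_vf_onI[OF c open_U U_dom] smooth_on_cong[OF L.open_S _ eq])
qed

text \<open>The gradient is never differentiated explicitly.  Pairing it with a field \<open>Y\<close> of constant components gives
\<open>Y h\<close>, and the metric compatibility of the connection of \<open>M\<close> then yields
\<open>\<langle>\<nabla>\<^sub>a grad h, a\<rangle> = a (Y h) - (\<nabla>\<^sub>a Y) h\<close> for \<open>Y\<close> with value \<open>a\<close>.\<close>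

lemma laplacian_local:
  assumes rcM: "riemannian_connection A ind nablaM" and h: "smooth_fun_on A U h" and p: "p \<in> U"
  defines "x \<equiv> cmap c p" and "hh \<equiv> \<lambda>x. h (cinv c x)"
  shows "laplacian A ind nablaM h p
    = (\<Sum>i\<in>Basis. pd (E x i) (pd (E x i) hh) x - pd (M.christoffel nablaM c x (E x i) (E x i)) hh x)"
proof -
  have connM: "connection A nablaM" using rcM by (simp add: riemannian_connection_def)
  note grad = gradient_smooth[OF h] and bil = inner_productD[OF ind_inner[OF p]]
  have x: "x \<in> S" using in_U(3)[OF p] by (simp add: x_def)
  have hess: "ind p (nablaM p (vec_of A c p a) (gradient A ind h)) (vec_of A c p a)
      = pd a (pd a hh) x - pd (M.christoffel nablaM c x a a) hh x" for a
  proof -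
    let ?Y = "\<lambda>r. vec_of A c r a" and ?k = "\<lambda>r. ind r (gradient A ind h r) (vec_of A c r a)"
    have Y: "smooth_vf_on A U ?Y"
      by (rule M.smooth_vf_subset[OF M.smooth_vf_coordinate[OF c] U_dom])
    have k: "?k (cinv c y) = pd a hh y" if y: "y \<in> S" for y
    proof -
      obtain r where r: "r \<in> U" "y = cmap c r" using y by auto
      then show ?thesis using gradient_inner[OF h r(1), of "vec_of A c r a"] c by (simp add: hh_def)
    qed
    have smk: "smooth_fun_on A U ?k"
      by (rule M.smooth_fun_onI[OF c open_U U_dom],
          rule smooth_on_cong[OF L.open_S smooth_on_pd[OF smooth_fun_local[OF h]] k[unfolded hh_def]])
    have "dfun A ?k p (vec_of A c p a) = ind p (nablaM p (vec_of A c p a) (gradient A ind h)) (?Y p)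
        + ind p (gradient A ind h p) (nablaM p (vec_of A c p a) ?Y)"
      by (rule rcM[unfolded riemannian_connection_def, THEN conjunct2, rule_format,
            OF conjI[OF open_U conjI[OF p conjI[OF grad Y]]], THEN conjunct2, rule_format])
    moreover have "dfun A ?k p (vec_of A c p a) = pd a (pd a hh) x"
      unfolding dfun_local[OF smk p] vec_M(1)[OF p] x_def
      by (rule pd_cong_open[OF L.open_S in_U(3)[OF p] k])
    moreover have "ind p (gradient A ind h p) (nablaM p (vec_of A c p a) ?Y) = pd (M.christoffel nablaM c x a a) hh x"
      unfolding gradient_inner[OF h p] hh_def using c p by (simp add: M.christoffel_def x_def)
    ultimately show ?thesis by simp
  qed
  have lin: "linear (\<lambda>u. nablaM p u (gradient A ind h))"
    by (rule M.nabla_linear[OF connM open_U p grad])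
  have "laplacian A ind nablaM h p = (\<Sum>i\<in>Basis. ind p (nablaM p (vec_of A c p (E x i)) (gradient A ind h)) (vec_of A c p (E x i)))"
    unfolding laplacian_def divergence_def x_def
  proof (rule ind_trace[OF p])
    show "linear (ind p (nablaM p u (gradient A ind h)))" for u
      by (rule bilinear_linear(1)[OF bil(1)])
    show "linear (\<lambda>u. ind p (nablaM p u (gradient A ind h)) v)" for v
      by (rule linear_compose[OF lin bilinear_linear(2)[OF bil(1)], unfolded o_def])
  qed
  then show ?thesis unfolding hess .
qed

text \<open>The connection of \<open>M\<close> is Riemannian for the induced metric, so its Christoffel symbols satisfy the hypotheses of \<open>gauss_formula\<close>.\<close>

lemma gauss_local:
  assumes rcM: "riemannian_connection A ind nablaM" and x: "x \<in> S"
  shows "G (\<phi> x) (D w (pd a \<phi>) x - pd (M.christoffel nablaM c x w a) \<phi> x) (pd b \<phi> x) = 0"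
proof -
  have mc: "M.metric_chart ind c y a b = L.first_form y a b" if y: "y \<in> S" for y a b
  proof -
    obtain r where r: "r \<in> U" "y = cmap c r" using y by auto
    then show ?thesis using c by (simp add: M.metric_chart_def ind_local)
  qed
  have bf: "bilinear_field S (M.metric_chart ind c)"
  proof (rule M.metric_chart_field(1)[OF c open_U U_dom ind_inner])
    show "smooth_on S (\<lambda>x. M.metric_chart ind c x i j)" for i j
      by (rule smooth_on_cong[OF L.open_S _ mc])
         (unfold L.first_form_def, intro L.smooth_on_G smooth_on_pd L.map_smooth)
  qed
  interpret LM: levi_civita_along S S "\<lambda>x. x" "M.metric_chart ind c" "M.christoffel nablaM c"
    by (rule M.levi_civita_chart[OF c open_U U_dom ind_inner bf rcM])
  show ?thesis
  proof (rule L.gauss_formula[OF x])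
    show "M.christoffel nablaM c x a b = M.christoffel nablaM c x b a" for a b
      by (rule LM.\<Gamma>_sym[OF x])
    fix w a b
    have "pd w (\<lambda>x. G (\<phi> x) (pd a \<phi> x) (pd b \<phi> x)) x = pd w (\<lambda>y. M.metric_chart ind c y a b) x"
      by (rule pd_cong_open[OF L.open_S x]) (simp only: mc L.first_form_def)
    then show "pd w (\<lambda>x. G (\<phi> x) (pd a \<phi> x) (pd b \<phi> x)) x
        = G (\<phi> x) (pd (M.christoffel nablaM c x w a) \<phi> x) (pd b \<phi> x)
          + G (\<phi> x) (pd a \<phi> x) (pd (M.christoffel nablaM c x w b) \<phi> x)"
      unfolding LM.compat[OF x] mc[OF x] by (simp add: L.first_form_def)
  qed
qed


section \<open>The Laplacian of the support function\<close>

text \<open>Each of the five expressions is translated by the preceding lemmas into a term of \<open>laplacian_formula\<close>.\<close>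

theorem support_function_laplacian:
  assumes rcM: "riemannian_connection A ind nablaM" and V: "killing_field B g V" and q: "q \<in> U"
  shows "- laplacian A ind nablaM (\<lambda>p. g (F p) (\<eta> p) (V (F p))) q =
      real DIM('e) * g (F q)
        (dmap A B F q (gradient A ind (\<lambda>p. g (F p) (mean_curvature A B F g nabla p) (\<eta> p)) q)) (V (F q))
    + real DIM('e) * g (F q) (mean_curvature A B F g nabla q) (nabla (F q) (\<eta> q) V)
    + g (F q) (simons_op A B F g nabla \<eta> q) (V (F q))
    + g (F q) (Ric_perp A B F g nabla q (\<eta> q)) (V (F q))"
proof -
  let ?V = "N.local_field d V" and ?\<eta> = "local_section c d \<eta>" and ?x = "cmap c q" and ?n = "real DIM('e)"
  let ?f = "\<lambda>p. g (F p) (\<eta> p) (V (F p))"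
    and ?m = "\<lambda>p. g (F p) (mean_curvature A B F g nabla p) (\<eta> p)"
    and ?\<tau> = "\<lambda>x. \<Sum>i\<in>Basis. G (\<phi> x) (D (E x i) ?\<eta> x) (pd (E x i) \<phi> x)"
  note x = in_U(3)[OF q] and T = L.map_in[OF in_U(3)[OF q]]
  have sV: "smooth_vf_on B UNIV V" using V by (simp add: killing_field_def)
  have K: "L.killing ?V"
    by (rule N.killing_chart[OF d L.nab_levi_civita V])
  have sV': "smooth_on (cmap d ` cdom d) ?V" using K by (simp add: L.killing_def)
  have V_loc: "cN r (V (F r)) = ?V (\<phi> (cmap c r))" if "r \<in> U" for r
    using that c d by simp
  define \<zeta> where "\<zeta> = (\<lambda>x. ?V (\<phi> x))"
  have \<zeta>: "smooth_on S \<zeta>" unfolding \<zeta>_def by (rule L.smooth_on_pull[OF sV'])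
  define t where "t = L.tan_part ?x (\<zeta> ?x)"
  \<comment> \<open>The normal part of \<open>V\<close> along \<open>F\<close>, as a normal section on all of \<open>U\<close>, and the tangential part \<open>t\<close> at \<open>q\<close> only.\<close>
  define \<xi> where "\<xi> = (\<lambda>r. vec_of B d (F r) (L.perp (cmap c r) (\<zeta> (cmap c r))))"
  note n\<xi> = normal_extension[OF \<zeta>, folded \<xi>_def]
  have split: "?V (\<phi> ?x) = pd t \<phi> ?x + local_section c d \<xi> ?x"
    unfolding n\<xi>(2)[OF x] t_def L.perp_def \<zeta>_def by simp
  have splitV: "V (F q) = dmap A B F q (vec_of A c q t) + \<xi> q"
  proof (rule cN_inject[OF q])
    show "cN q (V (F q)) = cN q (dmap A B F q (vec_of A c q t) + \<xi> q)"
      unfolding linear_add[OF cN_lin[OF q]] dmap_local[OF q] V_loc[OF q] split using c q by simp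
  qed
  have s\<xi>: "smooth_on S (local_section c d \<xi>)"
    by (rule smooth_on_cong[OF L.open_S L.smooth_on_perp[OF \<zeta>] n\<xi>(2)])
  have \<xi>_normal: "G (\<phi> y) (local_section c d \<xi> y) (pd u \<phi> y) = 0" if "y \<in> S" for y u
    unfolding n\<xi>(2)[OF that] by (rule L.perp_normal[OF that])
  \<comment> \<open>The Simons and Ricci operators have normal values and see only the normal part of \<open>V\<close>.\<close>
  have normal_pair: "g (F q) w (V (F q)) = g (F q) w (\<xi> q)" if "is_normal A B F g q w" for w
    using that bilinear_radd[OF inner_productD(1)[OF g_inner]] by (simp add: splitV is_normal_def)
  have \<xi>q: "is_normal A B F g q (\<xi> q)" using n\<xi>(1) q by (simp add: normal_section_on_def)

  have f_loc: "?f (cinv c y) = G (\<phi> y) (?\<eta> y) (?V (\<phi> y))" if y: "y \<in> S" for y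
  proof -
    obtain r where r: "r \<in> U" "y = cmap c r" using y by auto
    then show ?thesis unfolding r(2) M.cinv_cmap[OF c in_U(1)[OF r(1)]] g_local[OF r(1)] V_loc[OF r(1)]
        local_section_cmap[OF c in_U(1)[OF r(1)]] by simp
  qed
  have sf: "smooth_fun_on A U ?f"
    by (rule M.smooth_fun_onI[OF c open_U U_dom], rule smooth_on_cong[OF L.open_S _ f_loc])
       (intro L.smooth_on_G L.\<eta>_smooth L.smooth_on_pull[OF sV'])
  let ?w = "\<lambda>i. M.christoffel nablaM c ?x (E ?x i) (E ?x i)"
  let ?ff = "\<lambda>y. G (\<phi> y) (?\<eta> y) (?V (\<phi> y))"
  have pf: "pd v (\<lambda>x. ?f (cinv c x)) y = pd v ?ff y" if "y \<in> S" for v y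
    by (rule pd_cong_open[OF L.open_S that f_loc])
  have lap: "laplacian A ind nablaM ?f q
      = (\<Sum>i\<in>Basis. pd (E ?x i) (pd (E ?x i) ?ff) ?x - pd (?w i) ?ff ?x)"
    unfolding laplacian_local[OF rcM sf q] pf[OF x]
    by (intro sum.cong refl arg_cong2[where f=minus] pd_cong_open[OF L.open_S x pf])
  have s\<tau>: "smooth_on S ?\<tau>"
  proof (intro smooth_on_sum[OF L.open_S] finite_Basis L.smooth_on_G)
    fix i :: 'e assume i: "i \<in> Basis"
    show "smooth_on S (\<lambda>x. D (E x i) ?\<eta> x)"
      by (rule smooth_on_linear_field[OF L.open_S, where L="\<lambda>x a. D a ?\<eta> x",
            OF L.cov_linear[OF L.\<eta>_smooth] L.smooth_on_cov[OF L.\<eta>_smooth] L.E_smooth[OF i]])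
    show "smooth_on S (\<lambda>x. pd (E x i) \<phi> x)"
      by (rule smooth_on_linear_field[OF L.open_S, where L="\<lambda>x a. pd a \<phi> x",
            OF L.pd_map_linear smooth_on_pd[OF L.map_smooth] L.E_smooth[OF i]])
  qed
  have m_loc: "?m (cinv c y) = (- 1 / ?n) *\<^sub>R ?\<tau> y" if y: "y \<in> S" for y
  proof -
    obtain r where r: "r \<in> U" "y = cmap c r" using y by auto
    have "?n * ?m r = - ?\<tau> y" unfolding r(2) by (rule mean_curvature_eta[OF r(1)])
    then have "?m r = - ?\<tau> y / ?n" by (simp add: field_simps)
    then show ?thesis using r c by simp
  qed
  have sm: "smooth_fun_on A U ?m"
    by (rule M.smooth_fun_onI[OF c open_U U_dom], rule smooth_on_cong[OF L.open_S _ m_loc])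
       (intro smooth_on_scaleR[OF L.open_S] smooth_on_const[OF L.open_S] s\<tau>)
  have term1: "?n * g (F q) (dmap A B F q (gradient A ind ?m q)) (V (F q)) = - pd t ?\<tau> ?x"
  proof -
    let ?grad = "gradient A ind ?m q"
    have "g (F q) (dmap A B F q ?grad) (V (F q)) = G (\<phi> ?x) (\<zeta> ?x) (pd (cM q ?grad) \<phi> ?x)"
      unfolding g_local[OF q] dmap_local[OF q] V_loc[OF q] \<zeta>_def by (rule L.G_sym[OF T])
    also have "\<dots> = L.first_form ?x t (cM q ?grad)"
      unfolding t_def by (rule L.tan_adjoint[OF x, symmetric])
    also have "\<dots> = ind q ?grad (vec_of A c q t)"
      unfolding ind_local[OF q] vec_M(1)[OF q] by (rule inner_productD(2)[OF L.first_form_inner[OF x]])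
    also have "\<dots> = pd t (\<lambda>x. ?m (cinv c x)) ?x"
      unfolding gradient_inner[OF sm q] vec_M(1)[OF q] ..
    also have "\<dots> = pd t (\<lambda>x. (- 1 / ?n) *\<^sub>R ?\<tau> x) ?x"
      by (rule pd_cong_open[OF L.open_S x m_loc])
    also have "\<dots> = (- 1 / ?n) *\<^sub>R pd t ?\<tau> ?x"
      by (rule pd_bounded_linear[OF L.open_S s\<tau> x bounded_linear_scaleR_right])
    finally show ?thesis by simp
  qed
  have term2: "?n * g (F q) (mean_curvature A B F g nabla q) (nabla (F q) (\<eta> q) V)
      = G (\<phi> ?x) (\<Sum>i\<in>Basis. D (E ?x i) (pd (E ?x i) \<phi>) ?x - pd (?w i) \<phi> ?x) (nab \<Gamma> (?\<eta> ?x) ?V (\<phi> ?x))"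
  proof -
    \<comment> \<open>By the Gauss formula the tangential part is the covariant derivative in \<open>M\<close>.\<close>
    have "L.second_form ?x (E ?x i) (E ?x i) = D (E ?x i) (pd (E ?x i) \<phi>) ?x - pd (?w i) \<phi> ?x" for i
      unfolding L.second_form_def L.perp_def L.tan_unique[OF x gauss_local[OF rcM x]] ..
    moreover have "cN q (nabla (F q) (\<eta> q) V) = nab \<Gamma> (?\<eta> ?x) ?V (\<phi> ?x)"
      using N.nabla_chart[OF conn d in_U(2)[OF q] open_UNIV UNIV_I sV] c q by simp
    moreover have "?n * g (F q) (mean_curvature A B F g nabla q) (nabla (F q) (\<eta> q) V)
        = g (F q) (?n *\<^sub>R mean_curvature A B F g nabla q) (nabla (F q) (\<eta> q) V)"
      using bilinear_lmul[OF inner_productD(1)[OF g_inner]] by simp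
    ultimately show ?thesis
      unfolding g_local[OF q] trace_second_ff[OF q] by simp
  qed
  have term3: "g (F q) (simons_op A B F g nabla \<eta> q) (V (F q))
      = (\<Sum>i\<in>Basis. G (\<phi> ?x) (D (E ?x i) ?\<eta> ?x) (D (E ?x i) (local_section c d \<xi>) ?x))"
    unfolding normal_pair[OF simons_op_local(1)[OF q]]
    by (rule simons_op_local(2)[OF q open_U q n\<xi>(1)])
  have term4: "g (F q) (Ric_perp A B F g nabla q (\<eta> q)) (V (F q))
      = (\<Sum>i\<in>Basis. G (\<phi> ?x) (Riem \<Gamma> (\<phi> ?x) (?\<eta> ?x) (pd (E ?x i) \<phi> ?x) (local_section c d \<xi> ?x)) (pd (E ?x i) \<phi> ?x))"
    unfolding normal_pair[OF Ric_perp_local(1)[OF q]] Ric_perp_local(2)[OF q \<xi>q] Ric_M_local[OF q]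
      local_section_cmap[OF c in_U(1)[OF q]] ..
  show ?thesis
    unfolding lap term1 term2 term3 term4
    by (rule L.laplacian_formula[OF K x _ _ s\<xi> _ split])
       (rule L.E_smooth L.E_orthonormal \<xi>_normal gauss_local[OF rcM x], assumption?)+
qed

end

theorem corollary3p10:
  fixes A :: "('m::{t2_space, second_countable_topology}, 'e::euclidean_space) chart set"
    and B :: "('n::{t2_space, second_countable_topology}, 'd::euclidean_space) chart set"
    and g :: "'n \<Rightarrow> 'd \<Rightarrow> 'd \<Rightarrow> real"
    and nabla :: "'n \<Rightarrow> 'd \<Rightarrow> ('n \<Rightarrow> 'd) \<Rightarrow> 'd"
    and F :: "'m \<Rightarrow> 'n"
    and nablaM :: "'m \<Rightarrow> 'e \<Rightarrow> ('m \<Rightarrow> 'e) \<Rightarrow> 'e"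
    and V :: "'n \<Rightarrow> 'd"
    and \<eta> :: "'m \<Rightarrow> 'd"
    and f :: "'m \<Rightarrow> real"
    and q :: 'm
  assumes "smooth_atlas A"
    and "smooth_atlas B"
    and "riemannian_metric B g"
    and "riemannian_connection B g nabla"
    and "immersion A B F"
    and "riemannian_connection A (induced_metric A B F g) nablaM"
    and "killing_field B g V"
    and "normal_section_on A B F g UNIV \<eta>"
    and "\<And>p. g (F p) (\<eta> p) (\<eta> p) = 1"
    and "parallel_normal A B F g nabla \<eta>"
    and "\<And>p. f p = g (F p) (\<eta> p) (V (F p))"
  shows "- laplacian A (induced_metric A B F g) nablaM f q =
      real DIM('e) * g (F q)
        (dmap A B F q
          (gradient A (induced_metric A B F g)
            (\<lambda>p. g (F p) (mean_curvature A B F g nabla p) (\<eta> p)) q))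
        (V (F q))
    + real DIM('e) * g (F q) (mean_curvature A B F g nabla q) (nabla (F q) (\<eta> q) V)
    + g (F q) (simons_op A B F g nabla \<eta> q) (V (F q))
    + g (F q) (Ric_perp A B F g nabla q (\<eta> q)) (V (F q))"
proof -
  interpret parallel_immersion A B g nabla F \<eta>
    by unfold_locales (fact assms)+
  obtain E where E: "framed_section
      (cmap (chart_at A q) ` (cdom (chart_at A q) \<inter> F -` cdom (chart_at B (F q))))
      (cmap (chart_at B (F q)) ` cdom (chart_at B (F q))) (local_map (chart_at A q) (chart_at B (F q)))
      (N.metric_chart g (chart_at B (F q))) (N.christoffel nabla (chart_at B (F q)))
      (local_section (chart_at A q) (chart_at B (F q)) \<eta>) E"
    using framed_section_local[OF M.chart_at(1) N.chart_at(1)] by blast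
  interpret parallel_immersion_chart A B g nabla F \<eta> "chart_at A q" "chart_at B (F q)" E
    by (rule parallel_immersion_chart.intro[OF parallel_immersion_axioms])
       (rule parallel_immersion_chart_axioms.intro[OF M.chart_at(1) N.chart_at(1) E])
  have f: "f = (\<lambda>p. g (F p) (\<eta> p) (V (F p)))" using assms(11) by auto
  show ?thesis
    unfolding f
    by (rule support_function_laplacian[OF assms(6,7)]) (use M.chart_at(2) N.chart_at(2) in auto)
qed

end
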